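(* Let $\mathcal{P}=\mathcal{X}\cup\mathcal{Y}$, let $\alpha_s$ be a safe and $\alpha_c$ a co-safe $\mathsf{LTL}$ formula over $\mathcal{P}$, and $\varphi$ an $\mathsf{LTL_f}$ formula over $\mathcal{P}$. The deterministic Büchi automaton $\mathcal{A}^{\alpha_s,\alpha_c}_{\varphi}$ (defined below) accepts exactly those infinite words $\pi$ over $2^{\mathcal{P}\cup\{\mathsf{end}\}}$ such that either (i) for some $n$, $\mathsf{end}$ occurs only in $\pi(n)$ and $\pi(1)\cdots\pi(n)\models\varphi$ (under $\mathsf{LTL_f}$ semantics), or (ii) $\mathsf{end}$ does not occur in $\pi$ and $\pi\not\models\alpha_s\wedge\alpha_c$. Moreover, $\mathcal{A}^{\alpha_s,\alpha_c}_{\varphi}$ can be constructed in time doubly exponential in $|\alpha_s|+|\alpha_c|+|\varphi|$.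
   Context: Formulas are built from $\top,\bot,p,\neg,\wedge,\vee,\mathsf{X},\mathsf{U},\mathsf{R}$. Safe formulas: $\psi::=\top\mid\bot\mid p\mid\neg p\mid\psi\wedge\psi\mid\psi\vee\psi\mid\mathsf{X}\psi\mid\psi\mathsf{R}\psi$; co-safe formulas: the same with $\mathsf{U}$ in place of $\mathsf{R}$. $\mathsf{LTL}$ is interpreted on infinite traces as usual; $\mathsf{LTL_f}$ on finite traces with $\pi\models_i\mathsf{X}\psi$ iff $|\pi|>i$ and $\pi\models_{i+1}\psi$, and $\mathsf{U},\mathsf{R}$ ranging over positions $\le|\pi|$. A bad prefix of $\alpha_s$ is a finite word $w$ such that every infinite extension of $w$ falsifies $\alpha_s$; a good prefix of $\alpha_c$ is a finite word $w$ such that every infinite extension satisfies $\alpha_c$. A deterministic Büchi automaton accepts an infinite word iff its run visits accepting states infinitely often. Since formulas are over $\mathcal{P}$, the variable $\mathsf{end}$ is ignored when evaluating them on words over $2^{\mathcal{P}\cup\{\mathsf{end}\}}$. Construction: let $\mathcal{A}_s=\langle2^{\mathcal{P}},Q_s,\delta_s,q^s_0,F_s\rangle$ be a DFA accepting exactly the bad prefixes of $\alpha_s$, $\mathcal{A}_c=\langle2^{\mathcal{P}},Q_c,\delta_c,q^c_0,F_c\rangle$ a DFA accepting exactly the good prefixes of $\alpha_c$, and $\mathcal{A}_g=\langle2^{\mathcal{P}},Q_g,\delta_g,q^g_0,F_g\rangle$ a DFA accepting exactly the finite traces satisfying $\varphi$ (each obtained by the standard single-exponential NFA construction followed by subset construction).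 $\mathcal{A}^{\alpha_s,\alpha_c}_{\varphi}$ has alphabet $2^{\mathcal{P}\cup\{\mathsf{end}\}}$, states $((Q_s\cup\{q_{\mathsf{bad}}\})\times(Q_c\cup\{q_{\mathsf{good}}\})\times Q_g)\cup\{q_\top,q_\bot\}$, initial state $(q^s_0,q^c_0,q^g_0)$, accepting states $\{(q_s,q_c,q_g): q_s=q_{\mathsf{bad}}\text{ or }q_c\ne q_{\mathsf{good}}\}\cup\{q_\top\}$. For $\theta$ with $\mathsf{end}\notin\theta$: $\delta((q_s,q_c,q_g),\theta)=(\delta^*_s(q_s,\theta),\delta^*_c(q_c,\theta),\delta_g(q_g,\theta))$, where $\delta^*_s(q_s,\theta)=q_{\mathsf{bad}}$ if $q_s=q_{\mathsf{bad}}$ or $\delta_s(q_s,\theta)\in F_s$, else $\delta_s(q_s,\theta)$; and $\delta^*_c(q_c,\theta)=q_{\mathsf{good}}$ if $q_c=q_{\mathsf{good}}$ or $\delta_c(q_c,\theta)\in F_c$, else $\delta_c(q_c,\theta)$. For $\theta$ with $\mathsf{end}\in\theta$: $\delta((q_s,q_c,q_g),\theta)=q_\top$ if $\delta_g(q_g,\theta\setminus\{\mathsf{end}\})\in F_g$, and $q_\bot$ otherwise. $\delta(q_\top,\theta)=q_\top$ if $\mathsf{end}\notin\theta$ and $q_\bot$ otherwise; $\delta(q_\bot,\theta)=q_\bot$ for all $\theta$.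
   Formalization: The time bound proved is 2^(c|P|)·2^(2^(n^c)) with n=|α_s|+|α_c|+|φ|, for finite P; the factor in |P| is needed since the alphabet 2^(P∪{end}) is written out and P may contain variables not in the formulas; it is absorbed when |P| is at most 2^poly(n). *)

theory Defs
  imports Main "HOL-Library.Omega_Words_Fun"
begin

section \<open>Formulas\<close>

datatype (vars: 'a) ltl =
    TT
  | FF
  | Prop 'a
  | Not "'a ltl"
  | And "'a ltl" "'a ltl"
  | Or "'a ltl" "'a ltl"
  | Next "'a ltl"
  | Until "'a ltl" "'a ltl"
  | Release "'a ltl" "'a ltl"

fun safe :: "'a ltl \<Rightarrow> bool" where
  "safe TT = True"
| "safe FF = True"
| "safe (Prop p) = True"
| "safe (Not \<psi>) = (\<exists>p. \<psi> = Prop p)"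
| "safe (And \<psi> \<chi>) = (safe \<psi> \<and> safe \<chi>)"
| "safe (Or \<psi> \<chi>) = (safe \<psi> \<and> safe \<chi>)"
| "safe (Next \<psi>) = safe \<psi>"
| "safe (Until \<psi> \<chi>) = False"
| "safe (Release \<psi> \<chi>) = (safe \<psi> \<and> safe \<chi>)"

fun cosafe :: "'a ltl \<Rightarrow> bool" where
  "cosafe TT = True"
| "cosafe FF = True"
| "cosafe (Prop p) = True"
| "cosafe (Not \<psi>) = (\<exists>p. \<psi> = Prop p)"
| "cosafe (And \<psi> \<chi>) = (cosafe \<psi> \<and> cosafe \<chi>)"
| "cosafe (Or \<psi> \<chi>) = (cosafe \<psi> \<and> cosafe \<chi>)"
| "cosafe (Next \<psi>) = cosafe \<psi>"
| "cosafe (Until \<psi> \<chi>) = (cosafe \<psi> \<and> cosafe \<chi>)"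
| "cosafe (Release \<psi> \<chi>) = False"

fun fsize :: "'a ltl \<Rightarrow> nat" where
  "fsize TT = 1"
| "fsize FF = 1"
| "fsize (Prop p) = 1"
| "fsize (Not \<psi>) = fsize \<psi> + 1"
| "fsize (And \<psi> \<chi>) = fsize \<psi> + fsize \<chi> + 1"
| "fsize (Or \<psi> \<chi>) = fsize \<psi> + fsize \<chi> + 1"
| "fsize (Next \<psi>) = fsize \<psi> + 1"
| "fsize (Until \<psi> \<chi>) = fsize \<psi> + fsize \<chi> + 1"
| "fsize (Release \<psi> \<chi>) = fsize \<psi> + fsize \<chi> + 1"

text \<open>Positions are counted from 0, on infinite as well as on finite traces.\<close>

fun sat :: "'a set word \<Rightarrow> nat \<Rightarrow> 'a ltl \<Rightarrow> bool" where
  "sat \<pi> i TT = True"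
| "sat \<pi> i FF = False"
| "sat \<pi> i (Prop p) = (p \<in> \<pi> i)"
| "sat \<pi> i (Not \<psi>) = (\<not> sat \<pi> i \<psi>)"
| "sat \<pi> i (And \<psi> \<chi>) = (sat \<pi> i \<psi> \<and> sat \<pi> i \<chi>)"
| "sat \<pi> i (Or \<psi> \<chi>) = (sat \<pi> i \<psi> \<or> sat \<pi> i \<chi>)"
| "sat \<pi> i (Next \<psi>) = sat \<pi> (Suc i) \<psi>"
| "sat \<pi> i (Until \<psi> \<chi>) = (\<exists>j\<ge>i. sat \<pi> j \<chi> \<and> (\<forall>k. i \<le> k \<and> k < j \<longrightarrow> sat \<pi> k \<psi>))"
| "sat \<pi> i (Release \<psi> \<chi>) = (\<forall>j\<ge>i. sat \<pi> j \<chi> \<or> (\<exists>k. i \<le> k \<and> k < j \<and> sat \<pi> k \<psi>))"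

fun satf :: "'a set list \<Rightarrow> nat \<Rightarrow> 'a ltl \<Rightarrow> bool" where
  "satf w i TT = True"
| "satf w i FF = False"
| "satf w i (Prop p) = (p \<in> w ! i)"
| "satf w i (Not \<psi>) = (\<not> satf w i \<psi>)"
| "satf w i (And \<psi> \<chi>) = (satf w i \<psi> \<and> satf w i \<chi>)"
| "satf w i (Or \<psi> \<chi>) = (satf w i \<psi> \<or> satf w i \<chi>)"
| "satf w i (Next \<psi>) = (Suc i < length w \<and> satf w (Suc i) \<psi>)"
| "satf w i (Until \<psi> \<chi>) =
    (\<exists>j. i \<le> j \<and> j < length w \<and> satf w j \<chi> \<and> (\<forall>k. i \<le> k \<and> k < j \<longrightarrow> satf w k \<psi>))"
| "satf w i (Release \<psi> \<chi>) =
    (\<forall>j. i \<le> j \<and> j < length w \<longrightarrow> satf w j \<chi> \<or> (\<exists>k. i \<le> k \<and> k < j \<and> satf w k \<psi>))"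

definition bad_prefix :: "'a set \<Rightarrow> 'a ltl \<Rightarrow> 'a set list \<Rightarrow> bool" where
  "bad_prefix P \<alpha> w \<longleftrightarrow>
     w \<in> lists (Pow P) \<and> (\<forall>u. range u \<subseteq> Pow P \<longrightarrow> \<not> sat (w \<frown> u) 0 \<alpha>)"

definition good_prefix :: "'a set \<Rightarrow> 'a ltl \<Rightarrow> 'a set list \<Rightarrow> bool" where
  "good_prefix P \<alpha> w \<longleftrightarrow>
     w \<in> lists (Pow P) \<and> (\<forall>u. range u \<subseteq> Pow P \<longrightarrow> sat (w \<frown> u) 0 \<alpha>)"


section \<open>Automata\<close>

record ('l, 'q) aut =
  alphabet :: "'l set"
  states :: "'q set"
  trans :: "'q \<Rightarrow> 'l \<Rightarrow> 'q"
  init :: 'q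
  accepting :: "'q set"

text \<open>Well-formed deterministic finite-state automata; whether they are read as
  DFAs or as deterministic Buechi automata depends only on the language assigned to them.\<close>

definition det_aut :: "('l, 'q) aut \<Rightarrow> bool" where
  "det_aut A \<longleftrightarrow> finite (alphabet A) \<and> finite (states A) \<and>
     init A \<in> states A \<and> accepting A \<subseteq> states A \<and>
     (\<forall>q\<in>states A. \<forall>l\<in>alphabet A. trans A q l \<in> states A)"

definition dfa_language :: "('l, 'q) aut \<Rightarrow> 'l list set" where
  "dfa_language A = {w \<in> lists (alphabet A). foldl (trans A) (init A) w \<in> accepting A}"

fun run :: "('l, 'q) aut \<Rightarrow> 'l word \<Rightarrow> 'q word" where
  "run A \<pi> 0 = init A"
| "run A \<pi> (Suc n) = trans A (run A \<pi> n) (\<pi> n)"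

definition buchi_language :: "('l, 'q) aut \<Rightarrow> 'l word set" where
  "buchi_language A =
     {\<pi>. range \<pi> \<subseteq> alphabet A \<and> (\<exists>\<^sub>\<infinity>n. run A \<pi> n \<in> accepting A)}"

definition bad_prefix_dfa :: "'a set \<Rightarrow> 'a ltl \<Rightarrow> ('a set, 'q) aut \<Rightarrow> bool" where
  "bad_prefix_dfa P \<alpha> A \<longleftrightarrow> det_aut A \<and> alphabet A = Pow P \<and>
     dfa_language A = {w. bad_prefix P \<alpha> w}"

definition good_prefix_dfa :: "'a set \<Rightarrow> 'a ltl \<Rightarrow> ('a set, 'q) aut \<Rightarrow> bool" where
  "good_prefix_dfa P \<alpha> A \<longleftrightarrow> det_aut A \<and> alphabet A = Pow P \<and>
     dfa_language A = {w. good_prefix P \<alpha> w}"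

text \<open>A finite trace is a nonempty finite word.\<close>

definition ltlf_dfa :: "'a set \<Rightarrow> 'a ltl \<Rightarrow> ('a set, 'q) aut \<Rightarrow> bool" where
  "ltlf_dfa P \<phi> A \<longleftrightarrow> det_aut A \<and> alphabet A = Pow P \<and>
     dfa_language A = {w \<in> lists (Pow P). w \<noteq> [] \<and> satf w 0 \<phi>}"


section \<open>The automaton for a specification\<close>

text \<open>The alphabet \<open>2\<^bsup>P \<union> {end}\<^esup>\<close> is rendered with letters of type \<^typ>\<open>'a option set\<close>:
  \<^term>\<open>None\<close> is the fresh variable \<open>end\<close>, and \<^term>\<open>Some p\<close> is the variable \<open>p\<close> of \<open>P\<close>.\<close>

definition ext :: "'a set \<Rightarrow> 'a option set" where
  "ext P = insert None (Some ` P)"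

definition strip :: "'a option set \<Rightarrow> 'a set" where
  "strip \<theta> = {p. Some p \<in> \<theta>}"

text \<open>\<^term>\<open>None\<close> in the first component of \<open>Live\<close> is \<open>q\<^bsub>bad\<^esub>\<close>,
  in the second component it is \<open>q\<^bsub>good\<^esub>\<close>.\<close>

datatype ('s, 'c, 'g) pstate = Live "'s option" "'c option" 'g | Top | Bot

fun star :: "('l, 'q) aut \<Rightarrow> 'q option \<Rightarrow> 'l \<Rightarrow> 'q option" where
  "star A None \<theta> = None"
| "star A (Some q) \<theta> = (if trans A q \<theta> \<in> accepting A then None else Some (trans A q \<theta>))"

fun spec_trans ::
  "('a set, 's) aut \<Rightarrow> ('a set, 'c) aut \<Rightarrow> ('a set, 'g) aut \<Rightarrow>
   ('s, 'c, 'g) pstate \<Rightarrow> 'a option set \<Rightarrow> ('s, 'c, 'g) pstate" where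
  "spec_trans As Ac Ag (Live qs qc qg) \<theta> =
     (if None \<notin> \<theta>
      then Live (star As qs (strip \<theta>)) (star Ac qc (strip \<theta>)) (trans Ag qg (strip \<theta>))
      else if trans Ag qg (strip \<theta>) \<in> accepting Ag then Top else Bot)"
| "spec_trans As Ac Ag Top \<theta> = (if None \<notin> \<theta> then Top else Bot)"
| "spec_trans As Ac Ag Bot \<theta> = Bot"

definition live_states ::
  "('a set, 's) aut \<Rightarrow> ('a set, 'c) aut \<Rightarrow> ('a set, 'g) aut \<Rightarrow> ('s, 'c, 'g) pstate set" where
  "live_states As Ac Ag =
     {Live qs qc qg | qs qc qg. qs \<in> insert None (Some ` states As) \<and>
        qc \<in> insert None (Some ` states Ac) \<and> qg \<in> states Ag}"

definition spec_aut ::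
  "'a set \<Rightarrow> ('a set, 's) aut \<Rightarrow> ('a set, 'c) aut \<Rightarrow> ('a set, 'g) aut \<Rightarrow>
   ('a option set, ('s, 'c, 'g) pstate) aut" where
  "spec_aut P As Ac Ag =
     \<lparr> alphabet = Pow (ext P),
       states = live_states As Ac Ag \<union> {Top, Bot},
       trans = spec_trans As Ac Ag,
       init = Live (Some (init As)) (Some (init Ac)) (init Ag),
       accepting = {Live qs qc qg | qs qc qg.
           Live qs qc qg \<in> live_states As Ac Ag \<and> (qs = None \<or> qc \<noteq> None)} \<union> {Top} \<rparr>"


section \<open>Computation time\<close>

text \<open>
  The model of computation is a first-order functional language whose data are binary
  trees, in the style of the tree languages of Neil Jones (Computability and Complexity from a
  Programming Perspective, MIT Press 1997). A program denotes a partial function of one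
  argument. \<open>Rec p\<close> is the recursive function with body \<open>p\<close>, and \<open>Call\<close>
  invokes the innermost enclosing recursive function (a whole program is its own outermost one).

  In \<open>exec d p x n y\<close>, the body of the innermost enclosing recursive function is \<open>d\<close>, and
  \<open>p\<close> yields \<open>y\<close> on the argument \<open>x\<close> at cost \<open>n\<close>. Every evaluation step is charged with the
  size of its argument, so no data can be shared or copied for free: the output is never larger
  than the cost, and the cost is polynomially related to Turing machine time.
\<close>

datatype tree = Leaf | Node tree tree

datatype prog =
    Arg
  | Quote tree
  | Left
  | Right
  | Pair prog prog
  | Eq prog prog
  | Seq prog prog
  | If prog prog prog
  | Rec prog
  | Call

fun left :: "tree \<Rightarrow> tree" where
  "left Leaf = Leaf"
| "left (Node x y) = x"

fun right :: "tree \<Rightarrow> tree" where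
  "right Leaf = Leaf"
| "right (Node x y) = y"

definition enc_bool :: "bool \<Rightarrow> tree" where
  "enc_bool b = (if b then Node Leaf Leaf else Leaf)"

definition cost :: "tree \<Rightarrow> nat" where
  "cost x = 1 + size x"

inductive exec :: "prog \<Rightarrow> prog \<Rightarrow> tree \<Rightarrow> nat \<Rightarrow> tree \<Rightarrow> bool" where
  Arg: "exec d Arg x (cost x) x"
| Quote: "exec d (Quote t) x (cost x + size t) t"
| Left: "exec d Left x (cost x) (left x)"
| Right: "exec d Right x (cost x) (right x)"
| Pair: "exec d p x m y \<Longrightarrow> exec d q x n z \<Longrightarrow>
    exec d (Pair p q) x (cost x + m + n) (Node y z)"
| Eq: "exec d p x m y \<Longrightarrow> exec d q x n z \<Longrightarrow>
    exec d (Eq p q) x (cost x + m + n) (enc_bool (y = z))"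
| Seq: "exec d p x m y \<Longrightarrow> exec d q y n z \<Longrightarrow>
    exec d (Seq p q) x (cost x + m + n) z"
| If_True: "exec d p x m y \<Longrightarrow> y \<noteq> Leaf \<Longrightarrow> exec d q x n z \<Longrightarrow>
    exec d (If p q r) x (cost x + m + n) z"
| If_False: "exec d p x m Leaf \<Longrightarrow> exec d r x n z \<Longrightarrow>
    exec d (If p q r) x (cost x + m + n) z"
| Rec: "exec p p x n y \<Longrightarrow> exec d (Rec p) x (cost x + n) y"
| Call: "exec d d x n y \<Longrightarrow> exec d Call x (cost x + n) y"

lemma exec_size: "exec d p x n y \<Longrightarrow> size y \<le> n"
proof (induction rule: exec.induct)
  case (Left d x)
  then show ?case by (cases x) (auto simp: cost_def)
next
  case (Right d x)
  then show ?case by (cases x) (auto simp: cost_def)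
qed (auto simp: cost_def enc_bool_def)

lemma exec_deterministic: "exec d p x n y \<Longrightarrow> exec d p x n' y' \<Longrightarrow> n = n' \<and> y = y'"
proof (induction arbitrary: n' y' rule: exec.induct)
  case (Arg d x)
  then show ?case by cases auto
next
  case (Quote d t x)
  then show ?case by cases auto
next
  case (Left d x)
  then show ?case by cases auto
next
  case (Right d x)
  then show ?case by cases auto
next
  case (Pair d p x m y q n z)
  from Pair.prems show ?case by cases (use Pair.IH in blast)
next
  case (Eq d p x m y q n z)
  from Eq.prems show ?case by cases (use Eq.IH in blast)
next
  case (Seq d p x m y q n z)
  from Seq.prems show ?case by cases (use Seq.IH in blast)
next
  case (If_True d p x m y q n z r)
  from If_True.prems show ?case by cases (use If_True.IH If_True.hyps in blast)+
next
  case (If_False d p x m r n z q)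
  from If_False.prems show ?case by cases (use If_False.IH in blast)+
next
  case (Rec p x n y d)
  from Rec.prems show ?case by cases (use Rec.IH in blast)
next
  case (Call d x n y)
  from Call.prems show ?case by cases (use Call.IH in blast)
qed

definition computes_within :: "prog \<Rightarrow> tree \<Rightarrow> nat \<Rightarrow> tree \<Rightarrow> bool" where
  "computes_within M x T y \<longleftrightarrow> (\<exists>n\<le>T. exec M M x n y)"


section \<open>Encoding of formulas and automata as trees\<close>

fun enc_list :: "tree list \<Rightarrow> tree" where
  "enc_list [] = Leaf"
| "enc_list (x # xs) = Node x (enc_list xs)"

definition enc_nat :: "nat \<Rightarrow> tree" where
  "enc_nat n = enc_list (replicate n Leaf)"

text \<open>The function \<open>\<nu>\<close> numbers the variables of \<open>P\<close> by \<open>0, \<dots>, k - 1\<close>, where \<open>k\<close> is the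
  cardinality of \<open>P\<close>.\<close>

fun enc_ltl :: "('a \<Rightarrow> nat) \<Rightarrow> 'a ltl \<Rightarrow> tree" where
  "enc_ltl \<nu> TT = enc_list [enc_nat 0]"
| "enc_ltl \<nu> FF = enc_list [enc_nat 1]"
| "enc_ltl \<nu> (Prop p) = enc_list [enc_nat 2, enc_nat (\<nu> p)]"
| "enc_ltl \<nu> (Not \<psi>) = enc_list [enc_nat 3, enc_ltl \<nu> \<psi>]"
| "enc_ltl \<nu> (And \<psi> \<chi>) = enc_list [enc_nat 4, enc_ltl \<nu> \<psi>, enc_ltl \<nu> \<chi>]"
| "enc_ltl \<nu> (Or \<psi> \<chi>) = enc_list [enc_nat 5, enc_ltl \<nu> \<psi>, enc_ltl \<nu> \<chi>]"
| "enc_ltl \<nu> (Next \<psi>) = enc_list [enc_nat 6, enc_ltl \<nu> \<psi>]"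
| "enc_ltl \<nu> (Until \<psi> \<chi>) = enc_list [enc_nat 7, enc_ltl \<nu> \<psi>, enc_ltl \<nu> \<chi>]"
| "enc_ltl \<nu> (Release \<psi> \<chi>) = enc_list [enc_nat 8, enc_ltl \<nu> \<psi>, enc_ltl \<nu> \<chi>]"

text \<open>A letter is the bit vector that starts with the bit of \<open>end\<close> and goes on with the bits
  of the \<open>k\<close> variables in the order of their numbers.\<close>

definition enc_letter :: "nat \<Rightarrow> ('a \<Rightarrow> nat) \<Rightarrow> 'a option set \<Rightarrow> tree" where
  "enc_letter k \<nu> \<theta> =
     enc_list (map enc_bool ((None \<in> \<theta>) # map (\<lambda>i. i \<in> \<nu> ` strip \<theta>) [0..<k]))"

fun enc_option :: "tree option \<Rightarrow> tree" where
  "enc_option None = Leaf"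
| "enc_option (Some x) = Node x Leaf"

text \<open>The component automata of a constructed automaton use trees as state names.\<close>

fun enc_pstate :: "(tree, tree, tree) pstate \<Rightarrow> tree" where
  "enc_pstate (Live qs qc qg) = enc_list [enc_nat 0, enc_option qs, enc_option qc, qg]"
| "enc_pstate Top = enc_list [enc_nat 1]"
| "enc_pstate Bot = enc_list [enc_nat 2]"

text \<open>An automaton is written out in full: the alphabet, the states, the transition table,
  the initial state and the accepting states. The lists may be in any order.\<close>

definition encodes_aut ::
  "('l \<Rightarrow> tree) \<Rightarrow> ('q \<Rightarrow> tree) \<Rightarrow> ('l, 'q) aut \<Rightarrow> tree \<Rightarrow> bool" where
  "encodes_aut el eq A t \<longleftrightarrow> (\<exists>ls qs ts fs.
     t = enc_list
       [enc_list (map el ls),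
        enc_list (map eq qs),
        enc_list (map (\<lambda>(q, l, q'). enc_list [eq q, el l, eq q']) ts),
        eq (init A),
        enc_list (map eq fs)] \<and>
     set ls = alphabet A \<and>
     set qs = states A \<and>
     set ts = {(q, l, trans A q l) | q l. q \<in> states A \<and> l \<in> alphabet A} \<and>
     set fs = accepting A)"

end

theory Submission
  imports Defs
begin

text \<open>
  A truth vector of a suffix of a word is the list of those formulas of a closure that hold there.
  The vector of \<open>a u\<close> is a function of the letter \<open>a\<close> and the vector of \<open>u\<close>, so a set \<open>S\<close> of vectors
  can be pulled back along \<open>a\<close>. Starting from the vectors that contain a formula, this gives a
  deterministic automaton whose states are the sets of vectors; one transition function serves all
  three components. A finite trace is decided by whether the vector of the empty word is in the set
  reached. For bad prefixes of \<open>\<alpha>s\<close> and good prefixes of \<open>\<alpha>c\<close> the question is whether the set reached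
  contains a vector of some infinite word. The vectors with an infinite chain of predecessors are
  the greatest fixed point of the image under all letters. Such a chain need not be the sequence
  of true vectors of its word, but it can only be wrong about unbounded \<open>U\<close> and \<open>R\<close> formulas in the
  direction that is harmless for safe, respectively co-safe, formulas.

  For the running time, functions computable in polynomial time are closed under composition and
  bounded list recursion, and the only other steps, listing all sublists and all bit vectors, take
  time polynomial in their output. Everything is then polynomial in the doubly exponential list of
  all sets of vectors and the exponential list of letters.
\<close>

section \<open>Functions computable in polynomial time\<close>

text \<open>Vectors are determined from the right, by a letter and the vector of what follows it.
  Pulling back sets of vectors makes this an automaton that reads from the left: one exponential for
  the vectors, one for the sets.

  All three languages get one form: \<open>w\<close> is accepted iff no vector allowed for what
  follows \<open>w\<close> puts the start formula into the vector at the front. This is why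
  \<alpha>c and \<phi> enter negated and \<alpha>s does not: a bad prefix has no continuation
  satisfying \<alpha>s, a good prefix none violating \<alpha>c. For \<phi> only the empty vector may
  follow.

  Which vectors really belong to infinite words depends on every claimed \<open>U\<close> being
  fulfilled and every denied \<open>R\<close> being refuted at some point. The fixed point ignores
  both conditions; the one-sided soundness of its chains makes up for it.

  As for time, the exponential lists rule out bounds in the size of the input alone. All of them are
  therefore kept in one tree, the cost of the whole program is polynomial in the size of that tree,
  and this size is the only quantity that needs an explicit estimate.\<close>

definition poly_bounded :: "(nat \<Rightarrow> nat) \<Rightarrow> bool" where
  "poly_bounded f \<longleftrightarrow> (\<exists>c. \<forall>n. f n \<le> (n + 2) ^ c)"

text \<open>The base \<open>n + 2\<close> never drops below 2, so the constant itself can serve as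
  exponent.\<close>

lemma poly_bounded_const: "poly_bounded (\<lambda>_. k)"
  unfolding poly_bounded_def
proof (intro exI allI)
  fix n :: nat
  have "k \<le> 2 ^ k"
    by (simp add: less_imp_le)
  also have "\<dots> \<le> (n + 2) ^ k"
    by (rule power_mono) auto
  finally show "k \<le> (n + 2) ^ k" .
qed

lemma poly_bounded_id: "poly_bounded (\<lambda>n. n)"
  unfolding poly_bounded_def by (rule exI[of _ 1]) simp

lemma poly_bounded_mult:
  assumes "poly_bounded f" "poly_bounded g"
  shows "poly_bounded (\<lambda>n. f n * g n)"
proof -
  from assms obtain a b where "\<And>n. f n \<le> (n + 2) ^ a" "\<And>n. g n \<le> (n + 2) ^ b"
    unfolding poly_bounded_def by blast
  then have "\<And>n. f n * g n \<le> (n + 2) ^ (a + b)"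
    by (simp add: power_add mult_le_mono)
  then show ?thesis
    unfolding poly_bounded_def by blast
qed

text \<open>A sum of two positive numbers is at most twice their product, and one more power of
  \<open>n + 2\<close> pays for the factor 2.\<close>

lemma poly_bounded_add:
  assumes "poly_bounded f" "poly_bounded g"
  shows "poly_bounded (\<lambda>n. f n + g n)"
proof -
  from assms obtain a b where ab: "\<And>n. f n \<le> (n + 2) ^ a" "\<And>n. g n \<le> (n + 2) ^ b"
    unfolding poly_bounded_def by blast
  have "f n + g n \<le> (n + 2) ^ (a + b + 1)" for n
  proof -
    have *: "x + y \<le> 2 * (x * y)" if "1 \<le> x" "1 \<le> y" for x y :: nat
      using that by (cases x; cases y) auto
    have "f n + g n \<le> (n + 2) ^ a + (n + 2) ^ b"
      by (intro add_mono ab)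
    also have "\<dots> \<le> 2 * ((n + 2) ^ a * (n + 2) ^ b)"
      by (rule *) auto
    also have "\<dots> \<le> (n + 2) * ((n + 2) ^ a * (n + 2) ^ b)"
      by (rule mult_le_mono1) simp
    also have "\<dots> = (n + 2) ^ (a + b + 1)"
      by (simp add: power_add)
    finally show ?thesis .
  qed
  then show ?thesis
    unfolding poly_bounded_def by blast
qed

lemma poly_bounded_Suc: "poly_bounded f \<Longrightarrow> poly_bounded (\<lambda>n. Suc (f n))"
  using poly_bounded_add[OF _ poly_bounded_const[of 1]] by simp

lemma poly_bounded_power: "poly_bounded f \<Longrightarrow> poly_bounded (\<lambda>n. f n ^ k)"
  by (induction k) (simp_all add: poly_bounded_const poly_bounded_mult)

lemmas poly_bounded_intros =
  poly_bounded_const poly_bounded_id poly_bounded_add poly_bounded_mult poly_bounded_power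
  poly_bounded_Suc

lemma power_add2_mono: "m \<le> n \<Longrightarrow> (m + 2) ^ c \<le> (n + 2 :: nat) ^ c"
  by (simp add: power_mono)

text \<open>The program has to work under every \<open>d\<close>, the body that \<open>Call\<close>
  would invoke. Only then can it be placed inside the body of a later recursion without changing its
  meaning.\<close>

definition polytime :: "(tree \<Rightarrow> tree) \<Rightarrow> bool" where
  "polytime f \<longleftrightarrow> (\<exists>p c. \<forall>d x. \<exists>n \<le> (size x + 2) ^ c. exec d p x n (f x))"

lemma polytimeI:
  assumes "poly_bounded b" "\<And>d x. \<exists>n \<le> b (size x). exec d p x n (f x)"
  shows "polytime f"
proof -
  from assms(1) obtain c where "\<And>n. b n \<le> (n + 2) ^ c"
    unfolding poly_bounded_def by blast
  then show ?thesis
    unfolding polytime_def using assms(2) by (meson order_trans)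
qed

lemma polytimeE:
  assumes "polytime f"
  obtains p c where "\<And>d x. \<exists>n \<le> (size x + 2) ^ c. exec d p x n (f x)"
  using assms unfolding polytime_def by blast

lemma polytime_size:
  assumes "polytime f"
  obtains c where "\<And>x. size (f x) \<le> (size x + 2) ^ c"
  using assms exec_size by (metis order_trans polytimeE)

lemma polytime_id: "polytime (\<lambda>x. x)"
proof (rule polytimeI)
  show "\<exists>n \<le> Suc (size x). exec d Arg x n x" for d x
    using exec.Arg[of d x] by (auto simp: cost_def)
qed (intro poly_bounded_intros)

lemma polytime_const: "polytime (\<lambda>x. t)"
proof (rule polytimeI)
  show "\<exists>n \<le> Suc (size x) + size t. exec d (Quote t) x n t" for d x
    using exec.Quote[of d t x] by (auto simp: cost_def)
qed (intro poly_bounded_intros)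

text \<open>By \<open>exec_size\<close> the intermediate value is no larger than the cost of
  producing it, so the second program starts on an argument of polynomial size.\<close>

lemma polytime_comp:
  assumes "polytime f" "polytime g"
  shows "polytime (\<lambda>x. f (g x))"
proof -
  from assms obtain p c q k where
    p: "\<And>d x. \<exists>n \<le> (size x + 2) ^ c. exec d p x n (f x)" and
    q: "\<And>d x. \<exists>n \<le> (size x + 2) ^ k. exec d q x n (g x)"
    by (metis polytimeE)
  show ?thesis
  proof (rule polytimeI)
    fix d x
    obtain n where n: "n \<le> (size x + 2) ^ k" "exec d q x n (g x)"
      using q by blast
    obtain m where m: "m \<le> (size (g x) + 2) ^ c" "exec d p (g x) m (f (g x))"
      using p by blast
    have "m \<le> ((size x + 2) ^ k + 2) ^ c"
      using m(1) power_add2_mono[of "size (g x)" "(size x + 2) ^ k" c] n exec_size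
      by (meson order_trans)
    then show "\<exists>n \<le> Suc (size x) + (size x + 2) ^ k + ((size x + 2) ^ k + 2) ^ c.
        exec d (Seq q p) x n (f (g x))"
      using n(1) by (intro exI[of _ "cost x + n + m"] conjI exec.Seq[OF n(2) m(2)])
        (simp add: cost_def)
  qed (intro poly_bounded_intros)
qed

lemma polytime_left: "polytime f \<Longrightarrow> polytime (\<lambda>x. left (f x))"
proof (rule polytime_comp[where f = left], rule polytimeI)
  show "\<exists>n \<le> Suc (size x). exec d Left x n (left x)" for d x
    using exec.Left[of d x] by (auto simp: cost_def)
qed (intro poly_bounded_intros)

lemma polytime_right: "polytime f \<Longrightarrow> polytime (\<lambda>x. right (f x))"
proof (rule polytime_comp[where f = right], rule polytimeI)
  show "\<exists>n \<le> Suc (size x). exec d Right x n (right x)" for d x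
    using exec.Right[of d x] by (auto simp: cost_def)
qed (intro poly_bounded_intros)

lemma polytime_Node:
  assumes "polytime f" "polytime g"
  shows "polytime (\<lambda>x. Node (f x) (g x))"
proof -
  from assms obtain p c q k where
    p: "\<And>d x. \<exists>n \<le> (size x + 2) ^ c. exec d p x n (f x)" and
    q: "\<And>d x. \<exists>n \<le> (size x + 2) ^ k. exec d q x n (g x)"
    by (metis polytimeE)
  show ?thesis
  proof (rule polytimeI)
    fix d x
    obtain n where n: "n \<le> (size x + 2) ^ c" "exec d p x n (f x)"
      using p by blast
    obtain m where m: "m \<le> (size x + 2) ^ k" "exec d q x m (g x)"
      using q by blast
    show "\<exists>n \<le> Suc (size x) + (size x + 2) ^ c + (size x + 2) ^ k.
        exec d (Pair p q) x n (Node (f x) (g x))"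
      using n(1) m(1) by (intro exI[of _ "cost x + n + m"] conjI exec.Pair[OF n(2) m(2)])
        (simp add: cost_def)
  qed (intro poly_bounded_intros)
qed

abbreviation polytime_pred :: "(tree \<Rightarrow> bool) \<Rightarrow> bool" where
  "polytime_pred P \<equiv> polytime (\<lambda>x. enc_bool (P x))"

lemma polytime_pred_eq:
  assumes "polytime f" "polytime g"
  shows "polytime_pred (\<lambda>x. f x = g x)"
proof -
  from assms obtain p c q k where
    p: "\<And>d x. \<exists>n \<le> (size x + 2) ^ c. exec d p x n (f x)" and
    q: "\<And>d x. \<exists>n \<le> (size x + 2) ^ k. exec d q x n (g x)"
    by (metis polytimeE)
  show ?thesis
  proof (rule polytimeI)
    fix d x
    obtain n where n: "n \<le> (size x + 2) ^ c" "exec d p x n (f x)"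
      using p by blast
    obtain m where m: "m \<le> (size x + 2) ^ k" "exec d q x m (g x)"
      using q by blast
    show "\<exists>n \<le> Suc (size x) + (size x + 2) ^ c + (size x + 2) ^ k.
        exec d (Eq p q) x n (enc_bool (f x = g x))"
      using n(1) m(1) by (intro exI[of _ "cost x + n + m"] conjI exec.Eq[OF n(2) m(2)])
        (simp add: cost_def)
  qed (intro poly_bounded_intros)
qed

lemma enc_bool_simps [simp]: "enc_bool True = Node Leaf Leaf" "enc_bool False = Leaf"
  by (simp_all add: enc_bool_def)

lemma enc_bool_eq_Leaf [simp]: "enc_bool b = Leaf \<longleftrightarrow> \<not> b"
  by (simp add: enc_bool_def)

lemma polytime_if:
  assumes "polytime_pred P" "polytime f" "polytime g"
  shows "polytime (\<lambda>x. if P x then f x else g x)"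
proof -
  from assms obtain r l p c q k where
    r: "\<And>d x. \<exists>n \<le> (size x + 2) ^ l. exec d r x n (enc_bool (P x))" and
    p: "\<And>d x. \<exists>n \<le> (size x + 2) ^ c. exec d p x n (f x)" and
    q: "\<And>d x. \<exists>n \<le> (size x + 2) ^ k. exec d q x n (g x)"
    by (metis polytimeE)
  show ?thesis
  proof (rule polytimeI)
    fix d x
    obtain i where i: "i \<le> (size x + 2) ^ l" "exec d r x i (enc_bool (P x))"
      using r by blast
    obtain n where n: "n \<le> (size x + 2) ^ c" "exec d p x n (f x)"
      using p by blast
    obtain m where m: "m \<le> (size x + 2) ^ k" "exec d q x m (g x)"
      using q by blast
    show "\<exists>n \<le> Suc (size x) + (size x + 2) ^ l + (size x + 2) ^ c + (size x + 2) ^ k.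
        exec d (If r p q) x n (if P x then f x else g x)"
    proof (cases "P x")
      case True
      then show ?thesis
        using exec.If_True[OF i(2) _ n(2), of q] i(1) n(1)
        by (intro exI[of _ "cost x + i + n"]) (simp add: cost_def)
    next
      case False
      then show ?thesis
        using exec.If_False[OF _ m(2), of r i p] i n(1) m(1)
        by (intro exI[of _ "cost x + i + m"]) (simp add: cost_def)
    qed
  qed (intro poly_bounded_intros)
qed

lemma polytime_pred_if:
  assumes "polytime_pred P" "polytime_pred Q" "polytime_pred R"
  shows "polytime_pred (\<lambda>x. if P x then Q x else R x)"
  using polytime_if[OF assms] by (simp add: if_distrib)

lemma polytime_pred_const: "polytime_pred (\<lambda>x. b)"
  by (rule polytime_const)

lemma polytime_pred_not:
  assumes "polytime_pred P"
  shows "polytime_pred (\<lambda>x. \<not> P x)"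
  using polytime_pred_if[OF assms polytime_pred_const[of False] polytime_pred_const[of True]]
  by (rule back_subst[of polytime]) auto

lemma polytime_pred_conj:
  assumes "polytime_pred P" "polytime_pred Q"
  shows "polytime_pred (\<lambda>x. P x \<and> Q x)"
  using polytime_pred_if[OF assms polytime_pred_const[of False]]
  by (rule back_subst[of polytime]) auto

lemma polytime_pred_disj:
  assumes "polytime_pred P" "polytime_pred Q"
  shows "polytime_pred (\<lambda>x. P x \<or> Q x)"
  using polytime_pred_if[OF assms(1) polytime_pred_const[of True] assms(2)]
  by (rule back_subst[of polytime]) auto

lemmas polytime_basic =
  polytime_if polytime_pred_if polytime_pred_not polytime_pred_conj polytime_pred_disj
  polytime_pred_eq polytime_Node polytime_left polytime_right polytime_const polytime_id

text \<open>Programs take one argument. An operation with several arguments is treated as a function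
  of nested pairs, and these rules turn this form into one where each argument is an arbitrary
  polynomial-time function.\<close>

lemma polytime2:
  assumes "polytime (\<lambda>z. f (left z) (right z))" "polytime A" "polytime B"
  shows "polytime (\<lambda>x. f (A x) (B x))"
  using polytime_comp[OF assms(1) polytime_Node[OF assms(2,3)]] by simp

lemma polytime3:
  assumes "polytime (\<lambda>z. f (left z) (left (right z)) (right (right z)))"
    "polytime A" "polytime B" "polytime C"
  shows "polytime (\<lambda>x. f (A x) (B x) (C x))"
  using polytime_comp[OF assms(1) polytime_Node[OF assms(2) polytime_Node[OF assms(3,4)]]]
  by simp

lemma polytime4:
  assumes "polytime (\<lambda>z. f (left z) (left (right z)) (left (right (right z)))
      (right (right (right z))))"
    "polytime A" "polytime B" "polytime C" "polytime D"
  shows "polytime (\<lambda>x. f (A x) (B x) (C x) (D x))"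
  using polytime_comp[OF assms(1)
      polytime_Node[OF assms(2) polytime_Node[OF assms(3) polytime_Node[OF assms(4,5)]]]]
  by simp

section \<open>Trees as lists, and bounded recursion on trees\<close>

fun list_of :: "tree \<Rightarrow> tree list" where
  "list_of Leaf = []"
| "list_of (Node x t) = x # list_of t"

abbreviation elems :: "tree \<Rightarrow> tree set" where
  "elems t \<equiv> set (list_of t)"

lemma list_of_enc_list [simp]: "list_of (enc_list xs) = xs"
  by (induction xs) auto

lemma enc_list_list_of [simp]: "enc_list (list_of t) = t"
  by (induction t) auto

lemma enc_list_inject [simp]: "enc_list xs = enc_list ys \<longleftrightarrow> xs = ys"
  by (metis list_of_enc_list)

lemma list_of_inject: "list_of s = list_of t \<longleftrightarrow> s = t"
  by (metis enc_list_list_of)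

lemma size_elem: "a \<in> elems t \<Longrightarrow> size a < size t"
  by (induction t) auto

lemma length_list_of: "length (list_of t) \<le> size t"
  by (induction t) auto

text \<open>The bound \<open>N\<close> on the accumulators is a parameter because they are bounded by the input in
  \<open>polytime_foldr\<close> but only by the output in \<open>output_polytime_foldr\<close>.\<close>

lemma exec_foldr:
  assumes h: "polytime (\<lambda>z. h (left (left z)) (right (left z)) (right z))"
    and i: "polytime i"
  shows "\<exists>p c. \<forall>d x t N. size x + size t \<le> N \<longrightarrow>
    (\<forall>us vs. list_of t = us @ vs \<longrightarrow> size (foldr (h x) vs (i x)) \<le> N) \<longrightarrow>
    (\<exists>n \<le> (N + 2) ^ c. exec d p (Node x t) n (foldr (h x) (list_of t) (i x)))"
proof -
  have "polytime (\<lambda>w. h (left (left w)) (left (right (left w))) (right w))"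
  proof -
    have "polytime (\<lambda>w. Node (Node (left (left w)) (left (right (left w)))) (right w))"
      by (intro polytime_basic)
    from polytime_comp[OF h this] show ?thesis
      by simp
  qed
  then obtain p c where
    p: "\<And>d w. \<exists>n \<le> (size w + 2) ^ c.
      exec d p w n (h (left (left w)) (left (right (left w))) (right w))"
    by (rule polytimeE) blast
  obtain q k where q: "\<And>d x. \<exists>n \<le> (size x + 2) ^ k. exec d q x n (i x)"
    using i by (rule polytimeE) blast
  \<comment> \<open>The test \<open>Right\<close> asks whether the list is exhausted. If not, the
    whole argument \<open>Node x (Node a t)\<close> is paired with the result of the call on
    \<open>Node x t\<close>, and in this pair \<open>p\<close> finds \<open>x\<close>,
    \<open>a\<close> and the accumulator.\<close>
  define body where "body = If Right
    (Seq (Pair Arg (Seq (Pair Left (Seq Right Right)) Call)) p) (Seq Left q)"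
  \<comment> \<open>\<open>K N\<close> pays for one level of the recursion: a dozen steps on trees
    of size at most N + 1, for which 20 is a generous count, the initial value, and \<open>p\<close>
    on a pair of size at most 2 N + 2.\<close>
  define K where "K = (\<lambda>N :: nat. 20 * (N + 3) + (N + 2) ^ k + (2 * N + 4) ^ c)"
  have body: "\<exists>n \<le> (size t + 1) * K N.
      exec body body (Node x t) n (foldr (h x) (list_of t) (i x))"
    if "size x + size t \<le> N"
      "\<And>us vs. list_of t = us @ vs \<Longrightarrow> size (foldr (h x) vs (i x)) \<le> N" for x t N
    using that
  proof (induction t)
    case Leaf
    obtain n where n: "n \<le> (size x + 2) ^ k" "exec body q x n (i x)"
      using q by blast
    have "n \<le> (N + 2) ^ k"
      using n(1) power_add2_mono[of "size x" N k] Leaf.prems(1) by simp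
    moreover have "exec body body (Node x Leaf)
      (cost (Node x Leaf) + cost (Node x Leaf) + (cost (Node x Leaf) + cost (Node x Leaf) + n)) (i x)"
      using exec.Right[of body "Node x Leaf"] exec.Left[of body "Node x Leaf"] n(2)
      unfolding body_def by (intro exec.If_False exec.Seq) auto
    ultimately show ?case
      using Leaf.prems(1)
      by (intro exI[of _ "cost (Node x Leaf) + cost (Node x Leaf) +
          (cost (Node x Leaf) + cost (Node x Leaf) + n)"]) (simp add: K_def cost_def)
  next
    case (Node a t)
    let ?y = "foldr (h x) (list_of t) (i x)" and ?z = "Node x (Node a t)"
    have "\<exists>n \<le> (size t + 1) * K N. exec body body (Node x t) n ?y"
    proof (rule Node.IH(2))
      show "size x + size t \<le> N"
        using Node.prems(1) by simp
      show "size (foldr (h x) vs (i x)) \<le> N" if "list_of t = us @ vs" for us vs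
        using Node.prems(2)[of "a # us" vs] that by simp
    qed
    then obtain n where n: "n \<le> (size t + 1) * K N" "exec body body (Node x t) n ?y"
      by blast
    obtain m where m: "m \<le> (size (Node ?z ?y) + 2) ^ c" "exec body p (Node ?z ?y) m (h x a ?y)"
      using p[of "Node ?z ?y" body] by auto
    have "size ?y \<le> N"
      using Node.prems(2)[of "[a]" "list_of t"] by simp
    then have "size (Node ?z ?y) + 2 \<le> 2 * N + 4"
      using Node.prems(1) by simp
    then have "m \<le> (2 * N + 4) ^ c"
      using m(1) by (meson order_trans power_mono zero_le)
    define e1 where "e1 = cost ?z + cost ?z + (cost ?z + cost ?z + cost (Node a t))"
    define e2 where "e2 = cost ?z + e1 + (cost (Node x t) + n)"
    define e3 where "e3 = cost ?z + cost ?z + e2"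
    have "exec body (Pair Left (Seq Right Right)) ?z e1 (Node x t)"
      unfolding e1_def
      using exec.Pair[OF exec.Left[of body ?z] exec.Seq[OF exec.Right[of body ?z] exec.Right]]
      by simp
    then have "exec body (Pair Arg (Seq (Pair Left (Seq Right Right)) Call)) ?z e3 (Node ?z ?y)"
      unfolding e2_def e3_def by (intro exec.Pair exec.Arg exec.Seq[OF _ exec.Call[OF n(2)]])
    then have "exec body body ?z (cost ?z + cost ?z + (cost ?z + e3 + m)) (h x a ?y)"
      using exec.Right[of body ?z] m(2) unfolding body_def
      by (intro exec.If_True exec.Seq) (auto simp flip: body_def)
    moreover have "cost ?z + cost ?z + (cost ?z + e3 + m) \<le> (size (Node a t) + 1) * K N"
    proof -
      have "cost ?z + cost ?z + (cost ?z + e3 + m) \<le> 20 * (N + 3) + n + (2 * N + 4) ^ c"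
        using Node.prems(1) \<open>m \<le> (2 * N + 4) ^ c\<close>
        unfolding e1_def e2_def e3_def cost_def by simp
      also have "\<dots> \<le> K N + (size t + 1) * K N"
        using n(1) by (simp add: K_def)
      also have "\<dots> \<le> (size (Node a t) + 1) * K N"
        by (simp add: algebra_simps)
      finally show ?thesis .
    qed
    ultimately show ?case
      by auto
  qed
  have "poly_bounded (\<lambda>N. N + 2 + (N + 1) * K N)"
    unfolding K_def by (intro poly_bounded_intros)
  then obtain b where b: "\<And>N. N + 2 + (N + 1) * K N \<le> (N + 2) ^ b"
    unfolding poly_bounded_def by blast
  show ?thesis
  proof (rule exI[of _ "Rec body"], rule exI[of _ b], intro allI impI)
    fix d x t N
    assume *: "size x + size t \<le> N"
      "\<forall>us vs. list_of t = us @ vs \<longrightarrow> size (foldr (h x) vs (i x)) \<le> N"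
    have "\<exists>n \<le> (size t + 1) * K N.
        exec body body (Node x t) n (foldr (h x) (list_of t) (i x))"
      using *(1) by (rule body) (use *(2) in blast)
    then obtain n where n: "n \<le> (size t + 1) * K N"
      "exec body body (Node x t) n (foldr (h x) (list_of t) (i x))"
      by blast
    have "(size t + 1) * K N \<le> (N + 1) * K N"
      using *(1) by (intro mult_le_mono1) simp
    then have "cost (Node x t) + n \<le> N + 2 + (N + 1) * K N"
      using n(1) *(1) unfolding cost_def tree.size by linarith
    also note b
    finally show "\<exists>n \<le> (N + 2) ^ b.
        exec d (Rec body) (Node x t) n (foldr (h x) (list_of t) (i x))"
      using exec.Rec[OF n(2), of d] by blast
  qed
qed

text \<open>A step may enlarge the accumulator only by an amount polynomial in the fixed input and
  the list element. A step that could double the accumulator would lead to exponential size.\<close>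

lemma polytime_foldr:
  assumes h: "polytime (\<lambda>z. h (left (left z)) (right (left z)) (right z))"
    and L: "polytime L" and i: "polytime i"
    and size: "\<And>x a y. size (h x a y) \<le> size y + (size x + size a + 2) ^ k"
  shows "polytime (\<lambda>x. foldr (h x) (list_of (L x)) (i x))"
proof -
  obtain p c where p: "\<forall>d x t N. size x + size t \<le> N \<longrightarrow>
    (\<forall>us vs. list_of t = us @ vs \<longrightarrow> size (foldr (h x) vs (i x)) \<le> N) \<longrightarrow>
    (\<exists>n \<le> (N + 2) ^ c. exec d p (Node x t) n (foldr (h x) (list_of t) (i x)))"
    using exec_foldr[OF h i] by (elim exE)
  obtain l where l: "\<And>x. size (i x) \<le> (size x + 2) ^ l"
    using polytime_size[OF i] by blast
  define B where "B = (\<lambda>s :: nat. s + (s + 2) ^ l + s * (s + 2) ^ k)"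
  have bound: "size (foldr (h x) vs (i x)) \<le> B (size (Node x t))"
    if "list_of t = us @ vs" for x t us vs
  proof -
    have "size (foldr (h x) vs (i x)) \<le> size (i x) + length vs * (size x + size t + 2) ^ k"
      if "set vs \<subseteq> elems t" for vs
      using that
    proof (induction vs)
      case (Cons a vs)
      have "(size x + size a + 2) ^ k \<le> (size x + size t + 2) ^ k"
        using Cons.prems size_elem[of a t] by (intro power_mono) auto
      then show ?case
        using size[of x a "foldr (h x) vs (i x)"] Cons by simp
    qed simp
    then have "size (foldr (h x) vs (i x)) \<le> size (i x) + length vs * (size x + size t + 2) ^ k"
      using that by simp
    also have "\<dots> \<le> (size (Node x t) + 2) ^ l + size (Node x t) * (size (Node x t) + 2) ^ k"
    proof (intro add_mono mult_mono)
      show "size (i x) \<le> (size (Node x t) + 2) ^ l"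
        by (rule order_trans[OF l power_add2_mono]) simp
      show "length vs \<le> size (Node x t)"
        using that length_list_of[of t] by simp
    qed (auto intro: power_mono)
    finally show ?thesis
      by (simp add: B_def)
  qed
  have exec: "\<exists>n \<le> (B (size (Node x t)) + 2) ^ c.
      exec d p (Node x t) n (foldr (h x) (list_of t) (i x))" for d x t
    by (rule p[rule_format]) (simp add: B_def, rule bound)
  have "polytime (\<lambda>z. foldr (h (left z)) (list_of (right z)) (i (left z)))"
  proof (rule polytimeI)
    \<comment> \<open>Rebuilding the pair turns even \<open>Leaf\<close> into a \<open>Node\<close>,
      the shape that \<open>p\<close> expects. This can add one node, hence the bounds at
      \<open>size z + 1\<close>.\<close>
    let ?P = "Pair Left Right"
    fix d z
    define y where "y = Node (left z) (right z)"
    obtain n where n: "n \<le> (B (size y) + 2) ^ c"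
      "exec d p y n (foldr (h (left z)) (list_of (right z)) (i (left z)))"
      using exec[of "left z" "right z" d] unfolding y_def by blast
    have y: "exec d ?P z (cost z + cost z + cost z) y"
      unfolding y_def by (intro exec.Pair exec.Left exec.Right)
    have "size y \<le> size z + 1"
      unfolding y_def by (cases z) auto
    then have "(B (size y) + 2) ^ c \<le> (B (size z + 1) + 2) ^ c"
      unfolding B_def by (intro power_mono add_mono mult_mono) auto
    then have "cost z + (cost z + cost z + cost z) + n
        \<le> 4 * (size z + 1) + (B (size z + 1) + 2) ^ c"
      using n(1) by (simp add: cost_def)
    then show "\<exists>n \<le> 4 * (size z + 1) + (B (size z + 1) + 2) ^ c.
        exec d (Seq ?P p) z n (foldr (h (left z)) (list_of (right z)) (i (left z)))"
      using exec.Seq[OF y n(2)] by blast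
  next
    show "poly_bounded (\<lambda>n. 4 * (n + 1) + (B (n + 1) + 2) ^ c)"
      unfolding B_def by (intro poly_bounded_intros)
  qed
  then show ?thesis
    by (intro polytime2[where f = "\<lambda>x t. foldr (h x) (list_of t) (i x)", OF _ polytime_id L])
qed

text \<open>A tree with m inner nodes has m + 1 leaves, so recursion into both children makes 2 m +
  1 calls. The assumed bound on the values of \<open>F\<close> keeps the work in each call
  polynomial.\<close>

lemma polytime_tree_rec:
  assumes H: "polytime H" and Leaf: "F Leaf = c"
    and Node: "\<And>l r. F (Node l r) = H (Node (Node l r) (Node (F l) (F r)))"
    and size: "\<And>t. size (F t) \<le> (size t + 2) ^ k"
  shows "polytime F"
proof -
  obtain p b where p: "\<And>d x. \<exists>n \<le> (size x + 2) ^ b. exec d p x n (H x)"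
    using H by (rule polytimeE) blast
  define body where "body = If Arg
    (Seq (Pair Arg (Pair (Seq Left Call) (Seq Right Call))) p) (Quote c)"
  define K where "K = (\<lambda>N :: nat. 20 * (N + 3) + size c + (N + 4 + 2 * (N + 2) ^ k) ^ b)"
  have body: "\<exists>n \<le> (2 * size t + 1) * K N. exec body body t n (F t)" if "size t \<le> N" for t N
    using that
  proof (induction t)
    case Leaf
    have "exec body body Leaf (cost Leaf + cost Leaf + (cost Leaf + size c)) (F Leaf)"
      unfolding body_def assms(2) by (intro exec.If_False exec.Arg exec.Quote)
    moreover have "cost Leaf + cost Leaf + (cost Leaf + size c) \<le> (2 * size Leaf + 1) * K N"
      by (simp add: K_def cost_def)
    ultimately show ?case
      by blast
  next
    case (Node l r)
    let ?t = "Node l r"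
    let ?y = "Node ?t (Node (F l) (F r))"
    obtain n where n: "n \<le> (2 * size l + 1) * K N" "exec body body l n (F l)"
      using Node by force
    obtain m where m: "m \<le> (2 * size r + 1) * K N" "exec body body r m (F r)"
      using Node by force
    obtain j where j: "j \<le> (size ?y + 2) ^ b" "exec body p ?y j (F ?t)"
      using p[of ?y body] assms(3) by auto
    have "size (F l) \<le> (N + 2) ^ k"
      using Node.prems by (intro order_trans[OF size power_add2_mono]) auto
    moreover have "size (F r) \<le> (N + 2) ^ k"
      using Node.prems by (intro order_trans[OF size power_add2_mono]) auto
    ultimately have "size ?y + 2 \<le> N + 4 + 2 * (N + 2) ^ k"
      using Node.prems by simp
    then have j_le: "j \<le> (N + 4 + 2 * (N + 2) ^ k) ^ b"
      using j(1) by (meson order_trans power_mono zero_le)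
    define e where "e = cost ?t + cost ?t + (cost ?t +
      (cost ?t + cost ?t + (cost l + n)) + (cost ?t + cost ?t + (cost r + m)))"
    have "exec body (Seq Left Call) ?t (cost ?t + cost ?t + (cost l + n)) (F l)"
      using exec.Seq[OF exec.Left[of body ?t]] exec.Call[OF n(2)] by simp
    moreover have "exec body (Seq Right Call) ?t (cost ?t + cost ?t + (cost r + m)) (F r)"
      using exec.Seq[OF exec.Right[of body ?t]] exec.Call[OF m(2)] by simp
    ultimately have "exec body (Pair Arg (Pair (Seq Left Call) (Seq Right Call))) ?t e ?y"
      unfolding e_def by (intro exec.Pair exec.Arg)
    then have "exec body body ?t (cost ?t + cost ?t + (cost ?t + e + j)) (F ?t)"
      using exec.Arg[of body ?t] j(2) unfolding body_def
      by (intro exec.If_True exec.Seq) (auto simp flip: body_def)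
    moreover have "cost ?t + cost ?t + (cost ?t + e + j) \<le> (2 * size ?t + 1) * K N"
    proof -
      have "cost ?t + cost ?t + (cost ?t + e + j)
          \<le> 20 * (N + 3) + n + m + (N + 4 + 2 * (N + 2) ^ k) ^ b"
        using Node.prems j_le unfolding e_def cost_def by simp
      also have "\<dots> \<le> K N + (2 * size l + 1) * K N + (2 * size r + 1) * K N"
        using n(1) m(1) by (simp add: K_def)
      also have "\<dots> = (2 * size ?t + 1) * K N"
        by (simp add: algebra_simps)
      finally show ?thesis .
    qed
    ultimately show ?case
      by auto
  qed
  show ?thesis
  proof (rule polytimeI)
    fix d x
    obtain n where n: "n \<le> (2 * size x + 1) * K (size x)" "exec body body x n (F x)"
      using body by blast
    then show "\<exists>n \<le> size x + 1 + (2 * size x + 1) * K (size x). exec d (Rec body) x n (F x)"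
      using exec.Rec[OF n(2), of d] by (intro exI[of _ "cost x + n"]) (simp add: cost_def)
  next
    show "poly_bounded (\<lambda>n. n + 1 + (2 * n + 1) * K n)"
      unfolding K_def by (intro poly_bounded_intros)
  qed
qed

section \<open>List operations on trees\<close>

definition tree_map :: "(tree \<Rightarrow> tree) \<Rightarrow> tree \<Rightarrow> tree" where
  "tree_map f t = enc_list (map f (list_of t))"

definition tree_filter :: "(tree \<Rightarrow> bool) \<Rightarrow> tree \<Rightarrow> tree" where
  "tree_filter P t = enc_list (filter P (list_of t))"

definition tree_append :: "tree \<Rightarrow> tree \<Rightarrow> tree" where
  "tree_append s t = enc_list (list_of s @ list_of t)"

definition tree_concat :: "tree \<Rightarrow> tree" where
  "tree_concat t = enc_list (concat (map list_of (list_of t)))"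

lemma list_of_tree_simps [simp]:
  "list_of (tree_map f t) = map f (list_of t)"
  "list_of (tree_filter P t) = filter P (list_of t)"
  "list_of (tree_append s t) = list_of s @ list_of t"
  "list_of (tree_concat t) = concat (map list_of (list_of t))"
  by (simp_all add: tree_map_def tree_filter_def tree_append_def tree_concat_def)

lemma size_tree_filter: "size (tree_filter P t) \<le> size t"
  unfolding tree_filter_def by (induction t) auto

lemma size_tree_append: "size (tree_append s t) = size s + size t"
  unfolding tree_append_def by (induction s) auto

lemma polytime_tree_map:
  assumes f: "polytime (\<lambda>z. f (left z) (right z))" and L: "polytime L"
  shows "polytime (\<lambda>x. tree_map (f x) (L x))"
proof -
  obtain c where c: "\<And>z. size (f (left z) (right z)) \<le> (size z + 2) ^ c"
    using polytime_size[OF f] by blast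
  \<comment> \<open>With s the sum of the two sizes, the pair of \<open>x\<close> and
    \<open>a\<close> has size s + 1, which gives the base s + 3. The square of s + 2 exceeds it, and
    the additional factor s + 2 covers the new list cell.\<close>
  have "size (Node (f x a) y) \<le> size y + (size x + size a + 2) ^ (2 * c + 1)" for x a y
  proof -
    have "size (f x a) + 1 \<le> (size x + size a + 3) ^ c + 1"
      using c[of "Node x a"] by (simp add: numeral_3_eq_3)
    also have "\<dots> \<le> ((size x + size a + 2) ^ 2) ^ c + ((size x + size a + 2) ^ 2) ^ c"
      by (intro add_mono power_mono) (auto simp: power2_eq_square)
    also have "\<dots> \<le> (size x + size a + 2) * ((size x + size a + 2) ^ 2) ^ c"
      by (simp add: algebra_simps)
    also have "\<dots> = (size x + size a + 2) ^ (2 * c + 1)"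
      by (simp add: power_mult)
    finally show ?thesis
      by simp
  qed
  then have "polytime (\<lambda>x. foldr (\<lambda>a. Node (f x a)) (list_of (L x)) Leaf)"
    by (intro polytime_foldr polytime_basic polytime2[OF f] L)
  moreover have "foldr (\<lambda>a. Node (f x a)) l Leaf = enc_list (map (f x) l)" for x l
    by (induction l) auto
  ultimately show ?thesis
    by (simp add: tree_map_def)
qed

lemma polytime_tree_filter:
  assumes P: "polytime_pred (\<lambda>z. P (left z) (right z))" and L: "polytime L"
  shows "polytime (\<lambda>x. tree_filter (P x) (L x))"
proof -
  have "size (if P x a then Node a y else y) \<le> size y + (size x + size a + 2) ^ 1" for x a y
    by simp
  then have "polytime (\<lambda>x. foldr (\<lambda>a y. if P x a then Node a y else y) (list_of (L x)) Leaf)"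
    by (intro polytime_foldr polytime_basic polytime2[where f = "\<lambda>x a. enc_bool (P x a)", OF P] L)
  moreover have "foldr (\<lambda>a y. if P x a then Node a y else y) l Leaf = enc_list (filter (P x) l)"
    for x l
    by (induction l) auto
  ultimately show ?thesis
    by (simp add: tree_filter_def)
qed

lemma polytime_tree_append:
  assumes "polytime A" "polytime B"
  shows "polytime (\<lambda>x. tree_append (A x) (B x))"
proof -
  have "polytime (\<lambda>x. foldr (\<lambda>a y. Node a y) (list_of (A x)) (B x))"
    by (intro polytime_foldr[where k = 1] polytime_basic assms) simp
  moreover have "foldr Node l t = enc_list (l @ list_of t)" for l t
    by (induction l) auto
  ultimately show ?thesis
    by (simp add: tree_append_def)
qed

lemma polytime_tree_concat:
  assumes "polytime A"
  shows "polytime (\<lambda>x. tree_concat (A x))"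
proof -
  have "polytime (\<lambda>x. foldr (\<lambda>a y. tree_append a y) (list_of (A x)) Leaf)"
    by (intro polytime_foldr[where k = 1] polytime_basic polytime_tree_append assms)
      (simp add: size_tree_append)
  moreover have "foldr tree_append l Leaf = enc_list (concat (map list_of l))" for l
    by (induction l) (auto simp: tree_append_def)
  ultimately show ?thesis
    by (simp add: tree_concat_def)
qed

lemma polytime_pred_bex:
  assumes P: "polytime_pred (\<lambda>z. P (left z) (right z))" and L: "polytime L"
  shows "polytime_pred (\<lambda>x. \<exists>a\<in>elems (L x). P x a)"
proof -
  have "polytime_pred (\<lambda>x. tree_filter (P x) (L x) \<noteq> Leaf)"
    by (intro polytime_basic polytime_tree_filter P L)
  moreover have "tree_filter (P x) (L x) \<noteq> Leaf \<longleftrightarrow> (\<exists>a\<in>elems (L x). P x a)" for x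
    using list_of_inject[of "tree_filter (P x) (L x)" Leaf] by (auto simp: filter_empty_conv)
  ultimately show ?thesis
    by simp
qed

lemma polytime_pred_elem:
  assumes "polytime f" "polytime L"
  shows "polytime_pred (\<lambda>x. f x \<in> elems (L x))"
proof -
  have "polytime_pred (\<lambda>z. f (left z) = right z)"
    by (intro polytime_basic polytime_comp[OF assms(1)])
  from polytime_pred_bex[OF this assms(2)] show ?thesis
    by simp
qed

lemmas polytime_intros = polytime_tree_map polytime_tree_filter polytime_tree_append
  polytime_tree_concat polytime_pred_bex polytime_pred_elem polytime_basic

section \<open>The program\<close>

text \<open>The right measure for enumerations, whose output can be exponential in the
  input.\<close>

definition output_polytime :: "(tree \<Rightarrow> tree) \<Rightarrow> bool" where
  "output_polytime f \<longleftrightarrow>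
     (\<exists>p c. \<forall>d x. \<exists>n \<le> (size x + size (f x) + 2) ^ c. exec d p x n (f x))"

lemma output_polytimeI:
  assumes "poly_bounded b" "\<And>d x. \<exists>n \<le> b (size x + size (f x)). exec d p x n (f x)"
  shows "output_polytime f"
proof -
  from assms(1) obtain c where "\<And>n. b n \<le> (n + 2) ^ c"
    unfolding poly_bounded_def by blast
  then show ?thesis
    unfolding output_polytime_def using assms(2) by (meson order_trans)
qed

text \<open>As the accumulator never shrinks, every intermediate one is bounded by the final output.
  It may well double in each step, as it does when sublists are listed.\<close>

lemma output_polytime_foldr:
  assumes h: "polytime (\<lambda>z. h (left z) (right z))"
    and mono: "\<And>a y. size y \<le> size (h a y)"
  shows "output_polytime (\<lambda>t. foldr h (list_of t) i)"
proof -
  have "polytime (\<lambda>z. h (right (left z)) (right z))"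
    by (intro polytime2[OF h] polytime_basic)
  from exec_foldr[where h = "\<lambda>_. h", OF this polytime_const[of i]]
  obtain p c where p: "\<forall>d x t N. size x + size t \<le> N \<longrightarrow>
    (\<forall>us vs. list_of t = us @ vs \<longrightarrow> size (foldr h vs i) \<le> N) \<longrightarrow>
    (\<exists>n \<le> (N + 2) ^ c. exec d p (Node x t) n (foldr h (list_of t) i))"
    by (elim exE)
  have mono_append: "size (foldr h vs i) \<le> size (foldr h (us @ vs) i)" for us vs
    by (induction us) (auto intro: order_trans[OF _ mono])
  show ?thesis
  proof (rule output_polytimeI)
    fix d t
    let ?y = "foldr h (list_of t) i"
    have "\<exists>n \<le> (size t + size ?y + 2) ^ c. exec d p (Node Leaf t) n ?y"
    proof (rule p[rule_format])
      show "size Leaf + size t \<le> size t + size ?y"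
        by simp
      show "size (foldr h vs i) \<le> size t + size ?y" if "list_of t = us @ vs" for us vs
        using mono_append[of vs us] that by simp
    qed
    then obtain n where n: "n \<le> (size t + size ?y + 2) ^ c" "exec d p (Node Leaf t) n ?y"
      by blast
    let ?e = "cost t + (cost t + size Leaf) + cost t"
    have "exec d (Pair (Quote Leaf) Arg) t ?e (Node Leaf t)"
      by (intro exec.Pair exec.Quote exec.Arg)
    from exec.Seq[OF this n(2)]
    show "\<exists>n \<le> 4 * (size t + size ?y + 1) + (size t + size ?y + 2) ^ c.
        exec d (Seq (Pair (Quote Leaf) Arg) p) t n ?y"
      using n(1) by (intro exI[of _ "cost t + ?e + n"]) (simp add: cost_def)
  qed (intro poly_bounded_intros)
qed

text \<open>Keeping \<open>x\<close> in the result makes every stage size-increasing, which is what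
  composing stages demands, and leaves all earlier data accessible to later stages.\<close>

lemma output_polytime_extend:
  assumes "output_polytime f" "polytime g"
  shows "output_polytime (\<lambda>x. Node x (f (g x)))"
proof -
  from assms(1) obtain p c where
    p: "\<And>d x. \<exists>n \<le> (size x + size (f x) + 2) ^ c. exec d p x n (f x)"
    unfolding output_polytime_def by blast
  from assms(2) obtain q k where q: "\<And>d x. \<exists>n \<le> (size x + 2) ^ k. exec d q x n (g x)"
    by (rule polytimeE) blast
  show ?thesis
  proof (rule output_polytimeI)
    fix d x
    let ?N = "size x + size (Node x (f (g x)))"
    obtain n where n: "n \<le> (size x + 2) ^ k" "exec d q x n (g x)"
      using q by blast
    obtain m where m: "m \<le> (size (g x) + size (f (g x)) + 2) ^ c" "exec d p (g x) m (f (g x))"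
      using p by blast
    have n': "n \<le> (?N + 2) ^ k"
      using n(1) power_add2_mono[of "size x" ?N k] by simp
    have "size (g x) + size (f (g x)) + 2 \<le> (?N + 2) ^ k + ?N + 2"
      using exec_size[OF n(2)] n' by simp
    then have m': "m \<le> ((?N + 2) ^ k + ?N + 2) ^ c"
      using m(1) by (meson order_trans power_mono zero_le)
    have "exec d (Pair Arg (Seq q p)) x (cost x + cost x + (cost x + n + m)) (Node x (f (g x)))"
      by (intro exec.Pair exec.Arg exec.Seq[OF n(2) m(2)])
    moreover have "cost x + cost x + (cost x + n + m)
        \<le> 3 * (?N + 1) + (?N + 2) ^ k + ((?N + 2) ^ k + ?N + 2) ^ c"
      using add_mono[OF n' m'] by (simp add: cost_def)
    ultimately show "\<exists>n \<le> 3 * (?N + 1) + (?N + 2) ^ k + ((?N + 2) ^ k + ?N + 2) ^ c.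
        exec d (Pair Arg (Seq q p)) x n (Node x (f (g x)))"
      by blast
  qed (intro poly_bounded_intros)
qed

text \<open>The cost of \<open>f\<close> is measured by \<open>f x\<close>, which is not part of the
  final output. The growth condition on \<open>g\<close> ensures that the final output is at least
  as large.\<close>

lemma output_polytime_comp:
  assumes "output_polytime f" "output_polytime g" "\<And>y. size y \<le> size (g y)"
  shows "output_polytime (\<lambda>x. g (f x))"
proof -
  from assms(1) obtain p c where
    p: "\<And>d x. \<exists>n \<le> (size x + size (f x) + 2) ^ c. exec d p x n (f x)"
    unfolding output_polytime_def by blast
  from assms(2) obtain q k where
    q: "\<And>d x. \<exists>n \<le> (size x + size (g x) + 2) ^ k. exec d q x n (g x)"
    unfolding output_polytime_def by blast
  show ?thesis
  proof (rule output_polytimeI)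
    fix d x
    let ?N = "size x + size (g (f x))"
    obtain n where n: "n \<le> (size x + size (f x) + 2) ^ c" "exec d p x n (f x)"
      using p by blast
    obtain m where m: "m \<le> (size (f x) + size (g (f x)) + 2) ^ k" "exec d q (f x) m (g (f x))"
      using q by blast
    have "size x + size (f x) \<le> ?N"
      using assms(3)[of "f x"] by simp
    then have n': "n \<le> (?N + 2) ^ c"
      using n(1) power_add2_mono by (meson order_trans)
    have "size (f x) + size (g (f x)) \<le> 2 * ?N"
      using assms(3)[of "f x"] by simp
    then have m': "m \<le> (2 * ?N + 2) ^ k"
      using m(1) power_add2_mono by (meson order_trans)
    show "\<exists>n \<le> ?N + 1 + (?N + 2) ^ c + (2 * ?N + 2) ^ k. exec d (Seq p q) x n (g (f x))"
      using n' m' by (intro exI[of _ "cost x + n + m"] conjI exec.Seq[OF n(2) m(2)])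
        (simp add: cost_def)
  qed (intro poly_bounded_intros)
qed

text \<open>The final stage \<open>g\<close> may shrink its argument, so the bound keeps referring
  to \<open>f x\<close>, whose size is estimated separately.\<close>

lemma output_polytime_postcomp:
  assumes "output_polytime f" "polytime g"
  shows "\<exists>p c. \<forall>d x. \<exists>n \<le> (size x + size (f x) + 2) ^ c. exec d p x n (g (f x))"
proof -
  from assms(1) obtain p c where
    p: "\<And>d x. \<exists>n \<le> (size x + size (f x) + 2) ^ c. exec d p x n (f x)"
    unfolding output_polytime_def by blast
  from assms(2) obtain q k where q: "\<And>d x. \<exists>n \<le> (size x + 2) ^ k. exec d q x n (g x)"
    by (rule polytimeE) blast
  have "poly_bounded (\<lambda>N. N + 1 + (N + 2) ^ c + (N + 2) ^ k)"
    by (intro poly_bounded_intros)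
  then obtain b where b: "\<And>N :: nat. N + 1 + (N + 2) ^ c + (N + 2) ^ k \<le> (N + 2) ^ b"
    unfolding poly_bounded_def by blast
  show ?thesis
  proof (rule exI[of _ "Seq p q"], rule exI[of _ b], intro allI)
    fix d x
    let ?N = "size x + size (f x)"
    obtain n where n: "n \<le> (?N + 2) ^ c" "exec d p x n (f x)"
      using p by blast
    obtain m where m: "m \<le> (size (f x) + 2) ^ k" "exec d q (f x) m (g (f x))"
      using q by blast
    have m': "m \<le> (?N + 2) ^ k"
      using m(1) power_add2_mono[of "size (f x)" ?N k] by simp
    have "cost x + n + m \<le> ?N + 1 + (?N + 2) ^ c + (?N + 2) ^ k"
      using n(1) m' by (simp add: cost_def)
    also note b
    finally show "\<exists>n \<le> (?N + 2) ^ b. exec d (Seq p q) x n (g (f x))"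
      using exec.Seq[OF n(2) m(2)] by blast
  qed
qed

section \<open>Enumerations, closure and vectors as tree programs\<close>

definition all_sublists :: "tree \<Rightarrow> tree" where
  "all_sublists t =
     foldr (\<lambda>a y. tree_append (tree_map (Node a) y) y) (list_of t) (Node Leaf Leaf)"

definition all_bits :: "tree \<Rightarrow> tree" where
  "all_bits t = foldr (\<lambda>a y. tree_append (tree_map (Node (Node Leaf Leaf)) y)
     (tree_map (Node Leaf) y)) (list_of t) (Node Leaf Leaf)"

lemma output_polytime_all_sublists: "output_polytime all_sublists"
  unfolding all_sublists_def
  by (intro output_polytime_foldr polytime_intros) (simp add: size_tree_append)

lemma size_tree_map_Node: "size y \<le> size (tree_map (Node a) y)"
  unfolding tree_map_def by (induction y) auto

lemma output_polytime_all_bits: "output_polytime all_bits"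
  unfolding all_bits_def
  by (intro output_polytime_foldr polytime_intros)
    (simp add: size_tree_append size_tree_map_Node trans_le_add1)

text \<open>The left component of the result reads the tree as a formula, the right one reads it as a list
  of formulas. The tag 2 is that of propositions, whose argument is not a formula.\<close>

fun sub_rec :: "tree \<Rightarrow> tree" where
  "sub_rec Leaf = Node Leaf Leaf"
| "sub_rec (Node l r) =
     Node (if l = enc_nat 2 then Node (Node l r) Leaf else Node (Node l r) (right (sub_rec r)))
       (tree_append (left (sub_rec l)) (right (sub_rec r)))"

definition subformulas :: "tree \<Rightarrow> tree" where
  "subformulas t = left (sub_rec t)"

text \<open>A tree with m nodes yields at most m entries, each of them a subtree of size at most m
  that occupies one list cell.\<close>

lemma size_sub_rec:
  "size (left (sub_rec t)) \<le> size t * (size t + 1) \<and> size (right (sub_rec t)) \<le> size t * (size t + 1)"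
proof (induction t)
  case (Node l r)
  then show ?case
    by (auto simp: size_tree_append algebra_simps)
qed simp

lemma polytime_sub_rec: "polytime sub_rec"
proof (rule polytime_tree_rec)
  define H where "H = (\<lambda>z.
    Node (if left (left z) = enc_nat 2 then Node (left z) Leaf
          else Node (left z) (right (right (right z))))
      (tree_append (left (left (right z))) (right (right (right z)))))"
  show "polytime H"
    unfolding H_def by (intro polytime_intros)
  show "sub_rec (Node l r) = H (Node (Node l r) (Node (sub_rec l) (sub_rec r)))" for l r
    by (simp add: H_def)
  have "size (sub_rec t) = size (left (sub_rec t)) + size (right (sub_rec t)) + 1" for t
    by (cases t) auto
  then have "size (sub_rec t) \<le> 2 * (size t * (size t + 1)) + 1" for t
    using size_sub_rec[of t] by simp
  also have "2 * (size t * (size t + 1)) + 1 \<le> (size t + 2) ^ 3" for t :: tree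
    by (simp add: eval_nat_numeral algebra_simps)
  finally show "size (sub_rec t) \<le> (size t + 2) ^ 3" for t .
qed simp

lemma polytime_subformulas: "polytime A \<Longrightarrow> polytime (\<lambda>x. subformulas (A x))"
  unfolding subformulas_def by (intro polytime_left polytime_comp[OF polytime_sub_rec])

definition tree_not :: "tree \<Rightarrow> tree" where
  "tree_not t = Node (enc_nat 3) (Node t Leaf)"

lemma polytime_tree_not: "polytime A \<Longrightarrow> polytime (\<lambda>x. tree_not (A x))"
  unfolding tree_not_def by (intro polytime_intros)

abbreviation tree_tt :: tree where
  "tree_tt \<equiv> Node Leaf Leaf"

text \<open>The input is the list of the number of variables, \<alpha>s, \<alpha>c and \<phi>. The
  last two are negated because an automaton accepts when no admissible continuation makes its start
  formula true. \<open>TT\<close> is appended as the marker of nonempty suffixes.\<close>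

definition closure_tree :: "tree \<Rightarrow> tree" where
  "closure_tree x = tree_append (subformulas (left (right x)))
     (tree_append (subformulas (tree_not (left (right (right x)))))
        (tree_append (subformulas (tree_not (left (right (right (right x))))))
           (Node tree_tt Leaf)))"

lemma polytime_closure_tree: "polytime closure_tree"
  unfolding closure_tree_def
  by (intro polytime_intros polytime_subformulas polytime_tree_not)

definition bit_at :: "tree \<Rightarrow> tree \<Rightarrow> tree" where
  "bit_at i a = left (foldr (\<lambda>_ y. right y) (list_of i) a)"

lemma polytime_bit_at:
  assumes "polytime A" "polytime B"
  shows "polytime (\<lambda>x. bit_at (A x) (B x))"
proof -
  have "size (right y) \<le> size y + (size x + size a + 2) ^ 1" for x a y :: tree
    by (cases y) auto
  then show ?thesis
    unfolding bit_at_def by (intro polytime_intros polytime_foldr assms)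
qed

text \<open>\<open>V\<close> is the vector of the next suffix and \<open>W\<close> the part of the current vector computed so far.
  The formula \<open>TT\<close> marks nonempty suffixes: the vector of the empty word is the empty list, and every
  other vector contains \<open>TT\<close>.\<close>

definition holds_tree :: "tree \<Rightarrow> tree \<Rightarrow> tree \<Rightarrow> tree \<Rightarrow> bool" where
  "holds_tree a V W t =
    (if left t = enc_nat 0 then True
     else if left t = enc_nat 1 then False
     else if left t = enc_nat 2 then bit_at (left (right t)) a \<noteq> Leaf
     else if left t = enc_nat 3 then left (right t) \<notin> elems W
     else if left t = enc_nat 4 then left (right t) \<in> elems W \<and> left (right (right t)) \<in> elems W
     else if left t = enc_nat 5 then left (right t) \<in> elems W \<or> left (right (right t)) \<in> elems W
     else if left t = enc_nat 6 then tree_tt \<in> elems V \<and> left (right t) \<in> elems V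
     else if left t = enc_nat 7 then left (right (right t)) \<in> elems W \<or>
       left (right t) \<in> elems W \<and> tree_tt \<in> elems V \<and> t \<in> elems V
     else left (right (right t)) \<in> elems W \<and>
       (left (right t) \<in> elems W \<or> tree_tt \<notin> elems V \<or> t \<in> elems V))"

lemma polytime_holds_tree:
  assumes "polytime A" "polytime V" "polytime W" "polytime T"
  shows "polytime_pred (\<lambda>x. holds_tree (A x) (V x) (W x) (T x))"
  unfolding holds_tree_def by (intro polytime_intros polytime_bit_at assms)

text \<open>\<open>foldr\<close> works from the end of the closure. Operands stand behind the
  formulas built from them, so they have been decided and are recorded in \<open>W\<close> when
  their formula is reached.\<close>

definition step_tree :: "tree \<Rightarrow> tree \<Rightarrow> tree \<Rightarrow> tree" where
  "step_tree C a V = foldr (\<lambda>t W. if holds_tree a V W t then Node t W else W) (list_of C) Leaf"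

lemma polytime_step_tree:
  assumes "polytime C" "polytime A" "polytime V"
  shows "polytime (\<lambda>x. step_tree (C x) (A x) (V x))"
proof (rule polytime3[OF _ assms])
  show "polytime (\<lambda>z. step_tree (left z) (left (right z)) (right (right z)))"
    unfolding step_tree_def
    by (intro polytime_foldr[where k = 1] polytime_intros polytime_holds_tree) simp
qed

definition delta_tree :: "tree \<Rightarrow> tree \<Rightarrow> tree \<Rightarrow> tree \<Rightarrow> tree" where
  "delta_tree C Vs a S = tree_filter (\<lambda>V. step_tree C a V \<in> elems S) Vs"

lemma polytime_delta_tree:
  assumes "polytime C" "polytime Vs" "polytime A" "polytime S"
  shows "polytime (\<lambda>x. delta_tree (C x) (Vs x) (A x) (S x))"
proof (rule polytime4[OF _ assms])
  show "polytime (\<lambda>z. delta_tree (left z) (left (right z)) (left (right (right z)))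
      (right (right (right z))))"
    unfolding delta_tree_def by (intro polytime_intros polytime_step_tree)
qed

text \<open>The vectors without \<open>TT\<close> are included so that the automaton for finite traces, which starts
  with a negated formula, rejects the empty word.\<close>

definition start_tree :: "tree \<Rightarrow> tree \<Rightarrow> tree" where
  "start_tree Vs f = tree_filter (\<lambda>V. f \<in> elems V \<or> tree_tt \<notin> elems V) Vs"

lemma polytime_start_tree:
  assumes "polytime Vs" "polytime F"
  shows "polytime (\<lambda>x. start_tree (Vs x) (F x))"
proof (rule polytime2[OF _ assms])
  show "polytime (\<lambda>z. start_tree (left z) (right z))"
    unfolding start_tree_def by (intro polytime_intros)
qed

text \<open>\<open>right l\<close> drops the leading bit for \<open>end\<close>. Each letter over
  the variables thus occurs twice, which leaves the set of images unchanged.\<close>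

definition image_tree :: "tree \<Rightarrow> tree \<Rightarrow> tree \<Rightarrow> tree \<Rightarrow> tree" where
  "image_tree C Vs Ls R =
     tree_filter (\<lambda>V. \<exists>V'\<in>elems R. \<exists>l\<in>elems Ls. step_tree C (right l) V' = V) Vs"

lemma polytime_image_tree:
  assumes "polytime C" "polytime Vs" "polytime Ls" "polytime R"
  shows "polytime (\<lambda>x. image_tree (C x) (Vs x) (Ls x) (R x))"
proof (rule polytime4[OF _ assms])
  show "polytime (\<lambda>z. image_tree (left z) (left (right z)) (left (right (right z)))
      (right (right (right z))))"
    unfolding image_tree_def by (intro polytime_intros polytime_step_tree)
qed

text \<open>\<open>Vs\<close> also serves as the clock: a decreasing chain of its subsets is stationary after at most
  as many steps as it has members.\<close>

definition core_tree :: "tree \<Rightarrow> tree \<Rightarrow> tree \<Rightarrow> tree" where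
  "core_tree C Vs Ls = foldr (\<lambda>_ R. image_tree C Vs Ls R) (list_of Vs) Vs"

lemma polytime_core_tree:
  assumes "polytime C" "polytime Vs" "polytime Ls"
  shows "polytime (\<lambda>x. core_tree (C x) (Vs x) (Ls x))"
proof (rule polytime3[OF _ assms])
  \<comment> \<open>Every round filters \<open>Vs\<close> afresh, so the accumulator is bounded by
    the fixed argument no matter what the previous round produced.\<close>
  have "size (image_tree (left x) (left (right x)) (right (right x)) y)
      \<le> size y + (size x + size a + 2) ^ 1" for x a y :: tree
  proof -
    have "size (image_tree (left x) (left (right x)) (right (right x)) y) \<le> size (left (right x))"
      unfolding image_tree_def by (rule size_tree_filter)
    also have "\<dots> \<le> size x"
      by (cases x; cases "right x") auto
    finally show ?thesis
      by simp
  qed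
  then show "polytime (\<lambda>z. core_tree (left z) (left (right z)) (right (right z)))"
    unfolding core_tree_def by (intro polytime_foldr polytime_intros polytime_image_tree)
qed

text \<open>All data of the construction for the input \<open>x\<close>: from the inside outwards the closure, the
  letters, the truth vectors and the sets of truth vectors.\<close>

definition data_tree :: "tree \<Rightarrow> tree" where
  "data_tree x = (let y = Node x (closure_tree x);
      z = Node y (all_bits (Node Leaf (left x)));
      v = Node z (all_sublists (right y))
    in Node v (all_sublists (right v)))"

lemma output_polytime_data_tree: "output_polytime data_tree"
proof -
  have h1: "output_polytime (\<lambda>x. Node x (closure_tree x))"
  proof -
    from polytime_closure_tree obtain p c where
      p: "\<And>d x. \<exists>n \<le> (size x + 2) ^ c. exec d p x n (closure_tree x)"
      by (rule polytimeE) blast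
    then have "\<exists>n \<le> (size x + size (closure_tree x) + 2) ^ c. exec d p x n (closure_tree x)" for d x
      by (meson order_trans power_add2_mono le_add1)
    then have "output_polytime closure_tree"
      unfolding output_polytime_def by blast
    from output_polytime_extend[OF this polytime_id] show ?thesis .
  qed
  have h2: "output_polytime (\<lambda>y. Node y (all_bits (Node Leaf (left (left y)))))"
    by (rule output_polytime_extend[OF output_polytime_all_bits]) (intro polytime_intros)
  have h3: "output_polytime (\<lambda>z. Node z (all_sublists (right (left z))))"
    by (rule output_polytime_extend[OF output_polytime_all_sublists]) (intro polytime_intros)
  have h4: "output_polytime (\<lambda>v. Node v (all_sublists (right v)))"
    by (rule output_polytime_extend[OF output_polytime_all_sublists]) (intro polytime_intros)
  from output_polytime_comp[OF output_polytime_comp[OF output_polytime_comp[OF h1 h2] h3] h4]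
  show ?thesis
    unfolding data_tree_def by (simp add: Let_def)
qed

section \<open>The product automaton computed from the data\<close>

abbreviation (input) data_input :: "tree \<Rightarrow> tree" where
  "data_input e \<equiv> left (left (left (left e)))"

abbreviation (input) data_closure :: "tree \<Rightarrow> tree" where
  "data_closure e \<equiv> right (left (left (left e)))"

abbreviation (input) data_letters :: "tree \<Rightarrow> tree" where
  "data_letters e \<equiv> right (left (left e))"

abbreviation (input) data_vectors :: "tree \<Rightarrow> tree" where
  "data_vectors e \<equiv> right (left e)"

abbreviation (input) data_sets :: "tree \<Rightarrow> tree" where
  "data_sets e \<equiv> right e"

definition data_delta :: "tree \<Rightarrow> tree \<Rightarrow> tree \<Rightarrow> tree" where
  "data_delta e a q = delta_tree (data_closure e) (data_vectors e) a q"

definition data_core :: "tree \<Rightarrow> tree" where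
  "data_core e = core_tree (data_closure e) (data_vectors e) (data_letters e)"

definition disjoint_tree :: "tree \<Rightarrow> tree \<Rightarrow> bool" where
  "disjoint_tree q R \<longleftrightarrow> \<not> (\<exists>V\<in>elems q. V \<in> elems R)"

definition star_tree :: "tree \<Rightarrow> tree \<Rightarrow> tree \<Rightarrow> tree" where
  "star_tree e a q =
     (if q = Leaf then Leaf
      else if disjoint_tree (data_delta e a (left q)) (data_core e) then Leaf
      else Node (data_delta e a (left q)) Leaf)"

definition live_tree :: "tree \<Rightarrow> tree \<Rightarrow> tree \<Rightarrow> tree" where
  "live_tree s c g = Node Leaf (Node s (Node c (Node g Leaf)))"

definition top_tree :: tree where
  "top_tree = Node (enc_nat 1) Leaf"

definition bot_tree :: tree where
  "bot_tree = Node (enc_nat 2) Leaf"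

text \<open>\<open>Node Leaf Leaf\<close> elsewhere stands for a true bit, the number 1 or the
  formula \<open>TT\<close>. In the acceptance test here it is the list whose only member is the
  empty vector, the one vector that can follow the last letter of a finite trace.\<close>

definition spec_step_tree :: "tree \<Rightarrow> tree \<Rightarrow> tree \<Rightarrow> tree" where
  "spec_step_tree e p l =
     (if left p = Leaf then
        if left l = Leaf then
          live_tree (star_tree e (right l) (left (right p)))
            (star_tree e (right l) (left (right (right p))))
            (data_delta e (right l) (left (right (right (right p)))))
        else if disjoint_tree (data_delta e (right l) (left (right (right (right p))))) (Node Leaf Leaf)
          then top_tree else bot_tree
      else if left p = enc_nat 1 \<and> left l = Leaf then top_tree else bot_tree)"

definition option_tree :: "tree \<Rightarrow> tree" where
  "option_tree Q = Node Leaf (tree_map (\<lambda>q. Node q Leaf) Q)"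

definition states_tree :: "tree \<Rightarrow> tree" where
  "states_tree e = Node top_tree (Node bot_tree
     (tree_concat (tree_map (\<lambda>s. tree_concat (tree_map (\<lambda>c.
        tree_map (\<lambda>g. live_tree s c g) (data_sets e)) (option_tree (data_sets e))))
          (option_tree (data_sets e)))))"

definition table_tree :: "tree \<Rightarrow> tree" where
  "table_tree e = tree_concat (tree_map (\<lambda>p. tree_map (\<lambda>l.
     Node p (Node l (Node (spec_step_tree e p l) Leaf))) (data_letters e)) (states_tree e))"

definition init_tree :: "tree \<Rightarrow> tree" where
  "init_tree e = live_tree
     (Node (start_tree (data_vectors e) (left (right (data_input e)))) Leaf)
     (Node (start_tree (data_vectors e) (tree_not (left (right (right (data_input e)))))) Leaf)
     (start_tree (data_vectors e) (tree_not (left (right (right (right (data_input e)))))))"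

definition accepting_tree :: "tree \<Rightarrow> tree" where
  "accepting_tree e = tree_filter (\<lambda>p. left p = enc_nat 1 \<or>
     left p = Leaf \<and> (left (right p) = Leaf \<or> left (right (right p)) \<noteq> Leaf)) (states_tree e)"

definition aut_tree :: "tree \<Rightarrow> tree" where
  "aut_tree e = Node (data_letters e) (Node (states_tree e) (Node (table_tree e)
     (Node (init_tree e) (Node (accepting_tree e) Leaf))))"

lemma polytime_data_delta:
  assumes "polytime E" "polytime A" "polytime Q"
  shows "polytime (\<lambda>x. data_delta (E x) (A x) (Q x))"
  unfolding data_delta_def by (intro polytime_delta_tree polytime_intros assms)

lemma polytime_data_core: "polytime E \<Longrightarrow> polytime (\<lambda>x. data_core (E x))"
  unfolding data_core_def by (intro polytime_core_tree polytime_intros)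

lemma polytime_disjoint_tree:
  assumes "polytime A" "polytime B"
  shows "polytime_pred (\<lambda>x. disjoint_tree (A x) (B x))"
proof (rule polytime2[where f = "\<lambda>a b. enc_bool (disjoint_tree a b)", OF _ assms])
  show "polytime_pred (\<lambda>z. disjoint_tree (left z) (right z))"
    unfolding disjoint_tree_def by (intro polytime_intros)
qed

lemma polytime_star_tree:
  assumes "polytime E" "polytime A" "polytime Q"
  shows "polytime (\<lambda>x. star_tree (E x) (A x) (Q x))"
  unfolding star_tree_def
  by (intro polytime_intros polytime_disjoint_tree polytime_data_delta polytime_data_core assms)

lemma polytime_live_tree:
  assumes "polytime S" "polytime C" "polytime G"
  shows "polytime (\<lambda>x. live_tree (S x) (C x) (G x))"
  unfolding live_tree_def by (intro polytime_intros assms)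

lemma polytime_spec_step_tree:
  assumes "polytime E" "polytime P" "polytime L"
  shows "polytime (\<lambda>x. spec_step_tree (E x) (P x) (L x))"
  unfolding spec_step_tree_def
  by (intro polytime_intros polytime_live_tree polytime_star_tree polytime_disjoint_tree
      polytime_data_delta assms)

lemma polytime_states_tree: "polytime E \<Longrightarrow> polytime (\<lambda>x. states_tree (E x))"
  by (rule polytime_comp[of states_tree], unfold states_tree_def option_tree_def)
    (intro polytime_intros polytime_live_tree)

lemma polytime_aut_tree: "polytime aut_tree"
  unfolding aut_tree_def table_tree_def init_tree_def accepting_tree_def
  by (intro polytime_intros polytime_states_tree polytime_spec_step_tree polytime_live_tree
      polytime_start_tree polytime_tree_not)

section \<open>Truth vectors\<close>

lemma enc_nat_0 [simp]: "enc_nat 0 = Leaf"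
  by (simp add: enc_nat_def)

lemma enc_nat_inject [simp]: "enc_nat m = enc_nat n \<longleftrightarrow> m = n"
  by (auto simp: enc_nat_def dest: arg_cong[of _ _ length])

lemma enc_nat_eq_Leaf [simp]: "enc_nat n = Leaf \<longleftrightarrow> n = 0" "Leaf = enc_nat n \<longleftrightarrow> n = 0"
  using enc_nat_inject[of n 0] enc_nat_inject[of 0 n] by (simp_all del: enc_nat_inject)

lemma list_of_enc_nat [simp]: "list_of (enc_nat n) = replicate n Leaf"
  by (simp add: enc_nat_def)

lemma enc_bool_inject [simp]: "enc_bool a = enc_bool b \<longleftrightarrow> a = b"
  by (simp add: enc_bool_def)

lemma bit_at_enc_list:
  assumes "i < length xs"
  shows "bit_at (enc_nat i) (enc_list xs) = xs ! i"
proof -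
  have right_enc: "right (enc_list ys) = enc_list (tl ys)" for ys
    by (cases ys) auto
  have "foldr (\<lambda>_ y. right y) (replicate i Leaf) (enc_list xs) = enc_list (drop i xs)"
    by (induction i) (auto simp: right_enc drop_Suc tl_drop)
  then show ?thesis
    using assms by (simp add: bit_at_def flip: Cons_nth_drop_Suc)
qed

lemma list_of_all_sublists: "list_of (all_sublists t) = map enc_list (subseqs (list_of t))"
  unfolding all_sublists_def by (induction t) (auto simp: Let_def)

lemma elems_all_sublists: "V \<in> elems (all_sublists t) \<longleftrightarrow> list_of V \<in> set (subseqs (list_of t))"
  by (auto simp: list_of_all_sublists image_iff intro: bexI[of _ "list_of V"])

lemma filter_in_subseqs: "filter P xs \<in> set (subseqs xs)"
  by (induction xs) (auto simp: Let_def)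

lemma tree_filter_in_all_sublists: "tree_filter P t \<in> elems (all_sublists t)"
  by (simp add: elems_all_sublists filter_in_subseqs)

lemma elems_all_bits:
  "elems (all_bits (enc_nat n)) = {enc_list (map enc_bool bs) | bs. length bs = n}"
proof (induction n)
  case 0
  then show ?case
    by (auto simp: all_bits_def)
next
  case (Suc n)
  have "elems (all_bits (enc_nat (Suc n))) =
      Node (enc_bool True) ` elems (all_bits (enc_nat n)) \<union>
      Node (enc_bool False) ` elems (all_bits (enc_nat n))"
    by (simp add: all_bits_def)
  also have "\<dots> = {enc_list (map enc_bool bs) | bs. length bs = Suc n}"
    unfolding Suc
  proof (intro equalityI subsetI)
    fix t
    assume "t \<in> {enc_list (map enc_bool bs) | bs. length bs = Suc n}"
    then obtain b bs where t: "t = Node (enc_bool b) (enc_list (map enc_bool bs))" "length bs = n"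
      by (auto simp: length_Suc_conv)
    then show "t \<in> Node (enc_bool True) ` {enc_list (map enc_bool bs) | bs. length bs = n} \<union>
      Node (enc_bool False) ` {enc_list (map enc_bool bs) | bs. length bs = n}"
      by (cases b) auto
  next
    fix t
    assume "t \<in> Node (enc_bool True) ` {enc_list (map enc_bool bs) | bs. length bs = n} \<union>
      Node (enc_bool False) ` {enc_list (map enc_bool bs) | bs. length bs = n}"
    then obtain b bs where "t = Node (enc_bool b) (enc_list (map enc_bool bs))" "length bs = n"
      by blast
    then have "t = enc_list (map enc_bool (b # bs))" "length (b # bs) = Suc n"
      by auto
    then show "t \<in> {enc_list (map enc_bool bs) | bs. length bs = Suc n}"
      by blast
  qed
  finally show ?case .
qed

section \<open>Formula closures and the local equations of vectors\<close>

fun children :: "'a ltl \<Rightarrow> 'a ltl set" where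
  "children TT = {}"
| "children FF = {}"
| "children (Prop p) = {}"
| "children (Not \<psi>) = {\<psi>}"
| "children (And \<psi> \<chi>) = {\<psi>, \<chi>}"
| "children (Or \<psi> \<chi>) = {\<psi>, \<chi>}"
| "children (Next \<psi>) = {\<psi>}"
| "children (Until \<psi> \<chi>) = {\<psi>, \<chi>}"
| "children (Release \<psi> \<chi>) = {\<psi>, \<chi>}"

fun subs :: "'a ltl \<Rightarrow> 'a ltl list" where
  "subs TT = [TT]"
| "subs FF = [FF]"
| "subs (Prop p) = [Prop p]"
| "subs (Not \<psi>) = Not \<psi> # subs \<psi>"
| "subs (And \<psi> \<chi>) = And \<psi> \<chi> # subs \<psi> @ subs \<chi>"
| "subs (Or \<psi> \<chi>) = Or \<psi> \<chi> # subs \<psi> @ subs \<chi>"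
| "subs (Next \<psi>) = Next \<psi> # subs \<psi>"
| "subs (Until \<psi> \<chi>) = Until \<psi> \<chi> # subs \<psi> @ subs \<chi>"
| "subs (Release \<psi> \<chi>) = Release \<psi> \<chi> # subs \<psi> @ subs \<chi>"

text \<open>A topological order in which every occurrence precedes its operands. Repetitions are
  allowed, since the subformulas of the three given formulas may overlap.\<close>

fun children_follow :: "'a ltl list \<Rightarrow> bool" where
  "children_follow [] = True"
| "children_follow (\<psi> # fs) = (children \<psi> \<subseteq> set fs \<and> children_follow fs)"

lemma self_in_subs: "\<psi> \<in> set (subs \<psi>)"
  by (cases \<psi>) auto

lemma children_follow_subs: "children_follow fs \<Longrightarrow> children_follow (subs \<psi> @ fs)"
  by (induction \<psi> arbitrary: fs) (auto simp: self_in_subs)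

lemma children_in: "children_follow fs \<Longrightarrow> \<psi> \<in> set fs \<Longrightarrow> children \<psi> \<subseteq> set fs"
  by (induction fs) auto

lemma vars_subs: "\<chi> \<in> set (subs \<psi>) \<Longrightarrow> vars \<chi> \<subseteq> vars \<psi>"
  by (induction \<psi>) auto

lemma length_subs: "length (subs \<psi>) = fsize \<psi>"
  by (induction \<psi>) auto

lemma subformulas_enc_ltl: "subformulas (enc_ltl \<nu> \<psi>) = enc_list (map (enc_ltl \<nu>) (subs \<psi>))"
  by (induction \<psi>) (auto simp: subformulas_def tree_append_def)

lemma holds_tree_enc_ltl:
  "holds_tree a V W (enc_ltl \<nu> TT) \<longleftrightarrow> True"
  "holds_tree a V W (enc_ltl \<nu> FF) \<longleftrightarrow> False"
  "holds_tree a V W (enc_ltl \<nu> (Prop p)) \<longleftrightarrow> bit_at (enc_nat (\<nu> p)) a \<noteq> Leaf"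
  "holds_tree a V W (enc_ltl \<nu> (Not \<psi>)) \<longleftrightarrow> enc_ltl \<nu> \<psi> \<notin> elems W"
  "holds_tree a V W (enc_ltl \<nu> (And \<psi> \<chi>)) \<longleftrightarrow> enc_ltl \<nu> \<psi> \<in> elems W \<and> enc_ltl \<nu> \<chi> \<in> elems W"
  "holds_tree a V W (enc_ltl \<nu> (Or \<psi> \<chi>)) \<longleftrightarrow> enc_ltl \<nu> \<psi> \<in> elems W \<or> enc_ltl \<nu> \<chi> \<in> elems W"
  "holds_tree a V W (enc_ltl \<nu> (Next \<psi>)) \<longleftrightarrow> tree_tt \<in> elems V \<and> enc_ltl \<nu> \<psi> \<in> elems V"
  "holds_tree a V W (enc_ltl \<nu> (Until \<psi> \<chi>)) \<longleftrightarrow> enc_ltl \<nu> \<chi> \<in> elems W \<or>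
     enc_ltl \<nu> \<psi> \<in> elems W \<and> tree_tt \<in> elems V \<and> enc_ltl \<nu> (Until \<psi> \<chi>) \<in> elems V"
  "holds_tree a V W (enc_ltl \<nu> (Release \<psi> \<chi>)) \<longleftrightarrow> enc_ltl \<nu> \<chi> \<in> elems W \<and>
     (enc_ltl \<nu> \<psi> \<in> elems W \<or> tree_tt \<notin> elems V \<or> enc_ltl \<nu> (Release \<psi> \<chi>) \<in> elems V)"
  by (simp_all add: holds_tree_def)

lemma holds_tree_cong:
  assumes "\<And>\<chi>. \<chi> \<in> children \<psi> \<Longrightarrow> enc_ltl \<nu> \<chi> \<in> elems W \<longleftrightarrow> enc_ltl \<nu> \<chi> \<in> elems W'"
  shows "holds_tree a V W (enc_ltl \<nu> \<psi>) \<longleftrightarrow> holds_tree a V W' (enc_ltl \<nu> \<psi>)"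
  using assms by (cases \<psi>) (simp_all only: holds_tree_enc_ltl children.simps, auto)

lemma list_of_step_tree_in_subseqs: "list_of (step_tree C a V) \<in> set (subseqs (list_of C))"
  unfolding step_tree_def by (induction C) (auto simp: Let_def)

lemma set_subseqs_subset: "xs \<in> set (subseqs ys) \<Longrightarrow> set xs \<subseteq> set ys"
  by (metis Pow_iff image_eqI subseqs_powset)

text \<open>\<open>step_tree\<close> decides each formula against a partial vector. Formulas added
  later do not change the status of its operands, so the partial vector may be replaced by the
  finished one, which yields the local truth equations.\<close>

lemma step_tree_iff_holds:
  assumes "children_follow fs" "\<psi> \<in> set fs"
  shows "enc_ltl \<nu> \<psi> \<in> elems (step_tree (enc_list (map (enc_ltl \<nu>) fs)) a V) \<longleftrightarrow>
    holds_tree a V (step_tree (enc_list (map (enc_ltl \<nu>) fs)) a V) (enc_ltl \<nu> \<psi>)"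
  using assms
proof (induction fs arbitrary: \<psi>)
  case (Cons \<chi> fs)
  define W where "W = step_tree (enc_list (map (enc_ltl \<nu>) fs)) a V"
  define W' where "W' = step_tree (enc_list (map (enc_ltl \<nu>) (\<chi> # fs))) a V"
  have W': "W' = (if holds_tree a V W (enc_ltl \<nu> \<chi>) then Node (enc_ltl \<nu> \<chi>) W else W)"
    by (simp add: W_def W'_def step_tree_def)
  have IH: "enc_ltl \<nu> \<phi> \<in> elems W \<longleftrightarrow> holds_tree a V W (enc_ltl \<nu> \<phi>)" if "\<phi> \<in> set fs" for \<phi>
    using Cons.IH[of \<phi>] Cons.prems that by (simp add: W_def)
  have same: "enc_ltl \<nu> \<phi> \<in> elems W' \<longleftrightarrow> enc_ltl \<nu> \<phi> \<in> elems W" if "\<phi> \<in> set fs" for \<phi>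
    using IH[OF that] by (auto simp: W')
  have cong: "holds_tree a V W' (enc_ltl \<nu> \<phi>) \<longleftrightarrow> holds_tree a V W (enc_ltl \<nu> \<phi>)"
    if "\<phi> \<in> set (\<chi> # fs)" for \<phi>
    using that Cons.prems(1) children_in[of fs \<phi>] by (intro holds_tree_cong same) auto
  have "enc_ltl \<nu> \<psi> \<in> elems W' \<longleftrightarrow> holds_tree a V W (enc_ltl \<nu> \<psi>)"
  proof (cases "\<psi> \<in> set fs")
    case True
    then show ?thesis
      using IH same by simp
  next
    case False
    then have "\<psi> = \<chi>"
      using Cons.prems by simp
    \<comment> \<open>The code of \<chi> may already be present as the code of another formula,
      since the numbering is not assumed injective here. As \<open>holds_tree\<close> sees only
      codes, the induction hypothesis for that formula suffices.\<close>
    moreover have "holds_tree a V W (enc_ltl \<nu> \<chi>)" if "enc_ltl \<nu> \<chi> \<in> elems W"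
    proof -
      have "elems W \<subseteq> enc_ltl \<nu> ` set fs"
        using set_subseqs_subset[OF list_of_step_tree_in_subseqs[of _ a V]] unfolding W_def by force
      with that obtain \<phi> where "\<phi> \<in> set fs" "enc_ltl \<nu> \<phi> = enc_ltl \<nu> \<chi>"
        by force
      then show ?thesis
        using IH[of \<phi>] that by simp
    qed
    ultimately show ?thesis
      by (auto simp: W')
  qed
  with cong[OF Cons.prems(2)] show ?case
    unfolding W'_def by simp
qed simp

text \<open>Uniqueness of the solution of the local equations: an assignment \<open>T\<close> of
  truth values to codes that satisfies them is the one computed. \<open>gs\<close> stays the full
  closure while the induction runs through the suffixes \<open>fs\<close>.\<close>

lemma step_tree_eq_filter:
  assumes "children_follow fs" "set fs \<subseteq> set gs"
    and "\<And>\<psi>. \<psi> \<in> set fs \<Longrightarrow> T (enc_ltl \<nu> \<psi>) \<longleftrightarrow>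
      holds_tree a V (enc_list (filter T (map (enc_ltl \<nu>) gs))) (enc_ltl \<nu> \<psi>)"
  shows "step_tree (enc_list (map (enc_ltl \<nu>) fs)) a V = enc_list (filter T (map (enc_ltl \<nu>) fs))"
  using assms
proof (induction fs)
  case Nil
  then show ?case
    by (simp add: step_tree_def)
next
  case (Cons \<chi> fs)
  let ?W = "enc_list (filter T (map (enc_ltl \<nu>) fs))"
  have "step_tree (enc_list (map (enc_ltl \<nu>) fs)) a V = ?W"
    using Cons.prems by (intro Cons.IH) auto
  moreover have "holds_tree a V ?W (enc_ltl \<nu> \<chi>) \<longleftrightarrow>
      holds_tree a V (enc_list (filter T (map (enc_ltl \<nu>) gs))) (enc_ltl \<nu> \<chi>)"
    using Cons.prems(1,2) by (intro holds_tree_cong) auto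
  then have "holds_tree a V ?W (enc_ltl \<nu> \<chi>) \<longleftrightarrow> T (enc_ltl \<nu> \<chi>)"
    using Cons.prems(3)[of \<chi>] by simp
  ultimately show ?case
    by (simp add: step_tree_def)
qed

lemma sat_Until_unfold:
  "sat u i (Until \<psi> \<chi>) \<longleftrightarrow> sat u i \<chi> \<or> sat u i \<psi> \<and> sat u (Suc i) (Until \<psi> \<chi>)"
proof
  assume "sat u i (Until \<psi> \<chi>)"
  then obtain j where j: "i \<le> j" "sat u j \<chi>" "\<forall>k. i \<le> k \<and> k < j \<longrightarrow> sat u k \<psi>"
    by auto
  then show "sat u i \<chi> \<or> sat u i \<psi> \<and> sat u (Suc i) (Until \<psi> \<chi>)"
    by (cases "i = j") (auto intro!: exI[of _ j])
next
  assume "sat u i \<chi> \<or> sat u i \<psi> \<and> sat u (Suc i) (Until \<psi> \<chi>)"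
  then show "sat u i (Until \<psi> \<chi>)"
  proof
    assume "sat u i \<psi> \<and> sat u (Suc i) (Until \<psi> \<chi>)"
    then obtain j where j: "Suc i \<le> j" "sat u j \<chi>" "\<forall>k. Suc i \<le> k \<and> k < j \<longrightarrow> sat u k \<psi>"
      and "sat u i \<psi>"
      by auto
    then have "\<forall>k. i \<le> k \<and> k < j \<longrightarrow> sat u k \<psi>"
      by (metis Suc_leI order_le_less)
    with j show ?thesis
      by (auto intro!: exI[of _ j])
  qed auto
qed

lemma sat_Release_unfold:
  "sat u i (Release \<psi> \<chi>) \<longleftrightarrow> sat u i \<chi> \<and> (sat u i \<psi> \<or> sat u (Suc i) (Release \<psi> \<chi>))"
  using sat_Until_unfold[of u i "Not \<psi>" "Not \<chi>"] by auto

lemma satf_Until_unfold: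
  assumes "i < length w"
  shows "satf w i (Until \<psi> \<chi>) \<longleftrightarrow>
    satf w i \<chi> \<or> satf w i \<psi> \<and> Suc i < length w \<and> satf w (Suc i) (Until \<psi> \<chi>)"
proof
  assume "satf w i (Until \<psi> \<chi>)"
  then obtain j where "i \<le> j" "j < length w" "satf w j \<chi>" "\<forall>k. i \<le> k \<and> k < j \<longrightarrow> satf w k \<psi>"
    by auto
  then show "satf w i \<chi> \<or> satf w i \<psi> \<and> Suc i < length w \<and> satf w (Suc i) (Until \<psi> \<chi>)"
    by (cases "i = j") (auto intro!: exI[of _ j])
next
  assume "satf w i \<chi> \<or> satf w i \<psi> \<and> Suc i < length w \<and> satf w (Suc i) (Until \<psi> \<chi>)"
  then show "satf w i (Until \<psi> \<chi>)"
  proof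
    assume "satf w i \<psi> \<and> Suc i < length w \<and> satf w (Suc i) (Until \<psi> \<chi>)"
    then obtain j where j: "Suc i \<le> j" "j < length w" "satf w j \<chi>"
      "\<forall>k. Suc i \<le> k \<and> k < j \<longrightarrow> satf w k \<psi>" and "satf w i \<psi>"
      by auto
    then have "\<forall>k. i \<le> k \<and> k < j \<longrightarrow> satf w k \<psi>"
      by (metis Suc_leI order_le_less)
    with j show ?thesis
      by (auto intro!: exI[of _ j])
  qed (use assms in auto)
qed

lemma satf_Release_unfold:
  assumes "i < length w"
  shows "satf w i (Release \<psi> \<chi>) \<longleftrightarrow>
    satf w i \<chi> \<and> (satf w i \<psi> \<or> \<not> Suc i < length w \<or> satf w (Suc i) (Release \<psi> \<chi>))"
  using satf_Until_unfold[OF assms, of "Not \<psi>" "Not \<chi>"] by auto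

lemma enc_ltl_inject:
  assumes "inj_on \<nu> P" "vars \<psi> \<subseteq> P" "vars \<chi> \<subseteq> P" "enc_ltl \<nu> \<psi> = enc_ltl \<nu> \<chi>"
  shows "\<psi> = \<chi>"
  using assms(2-)
proof (induction \<psi> arbitrary: \<chi>)
  case (Prop p)
  then show ?case
    using assms(1) by (cases \<chi>) (auto simp: inj_on_def)
next
  case TT
  then show ?case by (cases \<chi>) auto
next
  case FF
  then show ?case by (cases \<chi>) auto
next
  case (Not \<psi>)
  then show ?case by (cases \<chi>) auto
next
  case (And \<psi>1 \<psi>2)
  then show ?case by (cases \<chi>) auto
next
  case (Or \<psi>1 \<psi>2)
  then show ?case by (cases \<chi>) auto
next
  case (Next \<psi>)
  then show ?case by (cases \<chi>) auto
next
  case (Until \<psi>1 \<psi>2)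
  then show ?case by (cases \<chi>) auto
next
  case (Release \<psi>1 \<psi>2)
  then show ?case by (cases \<chi>) auto
qed

text \<open>The closure is abstract so that a single instance, with one list of vectors and one
  transition function, serves all three components.\<close>

locale truth_vectors =
  fixes P :: "'a set" and \<nu> :: "'a \<Rightarrow> nat" and fs :: "'a ltl list"
  assumes finite_P: "finite P"
    and bij: "bij_betw \<nu> P {..<card P}"
    and follow: "children_follow fs"
    and TT_in: "TT \<in> set fs"
    and vars_fs: "\<psi> \<in> set fs \<Longrightarrow> vars \<psi> \<subseteq> P"
begin

abbreviation E :: "'a ltl \<Rightarrow> tree" where
  "E \<equiv> enc_ltl \<nu>"

definition bits :: "'a set \<Rightarrow> tree" where
  "bits a = enc_list (map (\<lambda>i. enc_bool (i \<in> \<nu> ` a)) [0..<card P])"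

definition C :: tree where "C = enc_list (map E fs)"

definition Vs :: tree where "Vs = all_sublists C"

definition Qs :: tree where "Qs = all_sublists Vs"

definition Ls :: tree where "Ls = all_bits (enc_nat (Suc (card P)))"

definition step :: "'a set \<Rightarrow> tree \<Rightarrow> tree" where
  "step a V = step_tree C (bits a) V"

definition core :: tree where "core = core_tree C Vs Ls"

lemma inj: "inj_on \<nu> P"
  using bij by (rule bij_betw_imp_inj_on)

lemma E_TT: "E TT = tree_tt"
  by simp

lemma enc_letter_eq: "enc_letter (card P) \<nu> \<theta> = Node (enc_bool (None \<in> \<theta>)) (bits (strip \<theta>))"
  by (simp add: enc_letter_def bits_def comp_def)

lemma bit_at_bits:
  assumes "p \<in> P" "a \<subseteq> P"
  shows "bit_at (enc_nat (\<nu> p)) (bits a) \<noteq> Leaf \<longleftrightarrow> p \<in> a"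
proof -
  have "\<nu> p < card P"
    using bij assms(1) by (auto simp: bij_betw_def)
  then have "bit_at (enc_nat (\<nu> p)) (bits a) = enc_bool (\<nu> p \<in> \<nu> ` a)"
    by (simp add: bits_def bit_at_enc_list)
  then show ?thesis
    using inj assms by (auto simp: inj_on_image_mem_iff)
qed

lemma step_iff_holds:
  "\<psi> \<in> set fs \<Longrightarrow> E \<psi> \<in> elems (step a V) \<longleftrightarrow> holds_tree (bits a) V (step a V) (E \<psi>)"
  unfolding step_def C_def by (rule step_tree_iff_holds[OF follow])

lemma tt_in_step: "tree_tt \<in> elems (step a V)"
  using step_iff_holds[OF TT_in, unfolded holds_tree_enc_ltl(1)] E_TT by simp

lemma step_simps:
  "tree_tt \<in> elems (step a V)"
  "FF \<in> set fs \<Longrightarrow> E FF \<notin> elems (step a V)"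
  "Prop p \<in> set fs \<Longrightarrow> a \<subseteq> P \<Longrightarrow> E (Prop p) \<in> elems (step a V) \<longleftrightarrow> p \<in> a"
  "Not \<psi> \<in> set fs \<Longrightarrow> E (Not \<psi>) \<in> elems (step a V) \<longleftrightarrow> E \<psi> \<notin> elems (step a V)"
  "And \<psi> \<chi> \<in> set fs \<Longrightarrow> E (And \<psi> \<chi>) \<in> elems (step a V) \<longleftrightarrow>
     E \<psi> \<in> elems (step a V) \<and> E \<chi> \<in> elems (step a V)"
  "Or \<psi> \<chi> \<in> set fs \<Longrightarrow> E (Or \<psi> \<chi>) \<in> elems (step a V) \<longleftrightarrow>
     E \<psi> \<in> elems (step a V) \<or> E \<chi> \<in> elems (step a V)"
  "Next \<psi> \<in> set fs \<Longrightarrow> E (Next \<psi>) \<in> elems (step a V) \<longleftrightarrow>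
     tree_tt \<in> elems V \<and> E \<psi> \<in> elems V"
  "Until \<psi> \<chi> \<in> set fs \<Longrightarrow> E (Until \<psi> \<chi>) \<in> elems (step a V) \<longleftrightarrow> E \<chi> \<in> elems (step a V) \<or>
     E \<psi> \<in> elems (step a V) \<and> tree_tt \<in> elems V \<and> E (Until \<psi> \<chi>) \<in> elems V"
  "Release \<psi> \<chi> \<in> set fs \<Longrightarrow> E (Release \<psi> \<chi>) \<in> elems (step a V) \<longleftrightarrow>
     E \<chi> \<in> elems (step a V) \<and>
     (E \<psi> \<in> elems (step a V) \<or> tree_tt \<notin> elems V \<or> E (Release \<psi> \<chi>) \<in> elems V)"
  using tt_in_step vars_fs[of "Prop p"] bit_at_bits
  by (simp_all only: step_iff_holds holds_tree_enc_ltl) auto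

lemma children_fs: "\<psi> \<in> set fs \<Longrightarrow> children \<psi> \<subseteq> set fs"
  using follow by (rule children_in)

lemma step_in_Vs: "step a V \<in> elems Vs"
  by (simp add: Vs_def elems_all_sublists step_def list_of_step_tree_in_subseqs)

text \<open>On finite traces vectors are exact for all formulas: the recursion starts at the empty
  vector, where nothing can be postponed any further. \<open>TT\<close> belongs to a vector exactly
  at positions inside the word, and this supplies the finite-trace reading of \<open>Next\<close>,
  \<open>Until\<close> and \<open>Release\<close>.\<close>

lemma satf_iff_vector:
  assumes "w \<in> lists (Pow P)" "i < length w" "\<psi> \<in> set fs"
  shows "E \<psi> \<in> elems (foldr step (drop i w) Leaf) \<longleftrightarrow> satf w i \<psi>"
proof -
  define v where "v i = foldr step (drop i w) Leaf" for i
  have v: "v i = step (w ! i) (v (Suc i))" if "i < length w" for i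
    using that by (simp add: v_def flip: Cons_nth_drop_Suc)
  have tt: "tree_tt \<in> elems (v i) \<longleftrightarrow> i < length w" for i
    using v[of i] step_simps(1) by (cases "i < length w") (auto simp: v_def)
  have wP: "w ! i \<subseteq> P" if "i < length w" for i
    using assms(1) that by (metis Pow_iff in_lists_conv_set nth_mem)
  have "E \<psi> \<in> elems (v i) \<longleftrightarrow> satf w i \<psi>"
    using assms(2,3)
  proof (induction \<psi> arbitrary: i)
    case TT
    then show ?case using tt[of i] by simp
  next
    case FF
    then show ?case using step_simps(2) by (simp add: v del: enc_ltl.simps)
  next
    case (Prop p)
    then show ?case using step_simps(3) wP by (simp add: v del: enc_ltl.simps)
  next
    case (Not \<psi>)
    then show ?case using children_fs[of "Not \<psi>"] step_simps(4)[of \<psi> "w ! i" "v (Suc i)"]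
      by (simp add: v[symmetric] del: enc_ltl.simps)
  next
    case (And \<psi> \<chi>)
    then show ?case using children_fs[of "And \<psi> \<chi>"] step_simps(5)[of \<psi> \<chi> "w ! i" "v (Suc i)"]
      by (simp add: v[symmetric] del: enc_ltl.simps)
  next
    case (Or \<psi> \<chi>)
    then show ?case using children_fs[of "Or \<psi> \<chi>"] step_simps(6)[of \<psi> \<chi> "w ! i" "v (Suc i)"]
      by (simp add: v[symmetric] del: enc_ltl.simps)
  next
    case (Next \<psi>)
    then show ?case using children_fs[of "Next \<psi>"] step_simps(7)[of \<psi> "w ! i" "v (Suc i)"] tt
      by (auto simp add: v[symmetric] simp del: enc_ltl.simps)
  next
    case (Until \<psi> \<chi>)
    have sub: "\<psi> \<in> set fs" "\<chi> \<in> set fs"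
      using children_fs[OF Until.prems(2)] by auto
    \<comment> \<open>The unfolding refers to the same formula one position later, so the structural
      induction contains an induction on the number of remaining positions.\<close>
    from Until.prems(1) show ?case
    proof (induction "length w - i" arbitrary: i)
      case (Suc n)
      then have "Suc i < length w \<Longrightarrow>
          E (Until \<psi> \<chi>) \<in> elems (v (Suc i)) \<longleftrightarrow> satf w (Suc i) (Until \<psi> \<chi>)"
        by (metis Suc_diff_Suc diff_Suc_1)
      then show ?case
        using step_simps(8)[OF Until.prems(2), of "w ! i" "v (Suc i)"] tt[of "Suc i"]
          Until.IH(1)[OF Suc.prems sub(1)] Until.IH(2)[OF Suc.prems sub(2)]
        unfolding satf_Until_unfold[OF Suc.prems] v[OF Suc.prems, symmetric] by blast
    qed simp
  next
    case (Release \<psi> \<chi>)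
    have sub: "\<psi> \<in> set fs" "\<chi> \<in> set fs"
      using children_fs[OF Release.prems(2)] by auto
    from Release.prems(1) show ?case
    proof (induction "length w - i" arbitrary: i)
      case (Suc n)
      then have "Suc i < length w \<Longrightarrow>
          E (Release \<psi> \<chi>) \<in> elems (v (Suc i)) \<longleftrightarrow> satf w (Suc i) (Release \<psi> \<chi>)"
        by (metis Suc_diff_Suc diff_Suc_1)
      then show ?case
        using step_simps(9)[OF Release.prems(2), of "w ! i" "v (Suc i)"] tt[of "Suc i"]
          Release.IH(1)[OF Suc.prems sub(1)] Release.IH(2)[OF Suc.prems sub(2)]
        unfolding satf_Release_unfold[OF Suc.prems] v[OF Suc.prems, symmetric] by blast
    qed simp
  qed
  then show ?thesis
    by (simp add: v_def)
qed

section \<open>Infinite chains of vectors\<close>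

definition chain :: "'a set word \<Rightarrow> (nat \<Rightarrow> tree) \<Rightarrow> bool" where
  "chain u v \<longleftrightarrow> (\<forall>i. u i \<subseteq> P \<and> v i = step (u i) (v (Suc i)))"

lemma chainD:
  assumes "chain u v"
  shows "u i \<subseteq> P" "step (u i) (v (Suc i)) = v i"
  using assms unfolding chain_def by metis+

lemma chain_tt: "chain u v \<Longrightarrow> tree_tt \<in> elems (v i)"
  unfolding chain_def using step_simps(1) by metis

text \<open>A true \<open>U\<close> has a witness at finite distance, and membership travels back
  from there. A claimed \<open>R\<close> is handed on as long as its left operand fails, so it
  forces its right operand at every position up to the release. The converses can fail: a chain may
  claim a \<open>U\<close> forever without a witness, or deny forever an \<open>R\<close> that
  holds.\<close>

lemma chain_safe_cosafe:
  assumes chain: "chain u v" and "\<psi> \<in> set fs"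
  shows "(safe \<psi> \<longrightarrow> E \<psi> \<in> elems (v i) \<longrightarrow> sat u i \<psi>) \<and>
    (cosafe \<psi> \<longrightarrow> sat u i \<psi> \<longrightarrow> E \<psi> \<in> elems (v i))"
  using assms(2)
proof (induction \<psi> arbitrary: i)
  note u = chainD(1)[OF chain] and v = chainD(2)[OF chain]
  note tt = chain_tt[OF chain]
  {
    case TT
    then show ?case using tt by simp
  next
    case FF
    then show ?case using step_simps(2)[of "u i" "v (Suc i)"] v by simp
  next
    case (Prop p)
    then show ?case using step_simps(3)[of p "u i" "v (Suc i)"] u by (simp add: v)
  next
    case (Not \<psi>)
    show ?case
    proof (cases "\<exists>p. \<psi> = Prop p")
      case True
      then obtain p where p: "\<psi> = Prop p"
        by blast
      then show ?thesis
        using step_simps(4)[of \<psi> "u i" "v (Suc i)"] step_simps(3)[of p "u i" "v (Suc i)"]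
          Not.prems children_fs[OF Not.prems] u[of i] by (simp add: v del: enc_ltl.simps)
    qed simp
  next
    case (And \<psi> \<chi>)
    then show ?case using children_fs[of "And \<psi> \<chi>"] step_simps(5)[of \<psi> \<chi> "u i" "v (Suc i)"]
      by (simp add: v del: enc_ltl.simps)
  next
    case (Or \<psi> \<chi>)
    then show ?case using children_fs[of "Or \<psi> \<chi>"] step_simps(6)[of \<psi> \<chi> "u i" "v (Suc i)"]
      by (auto simp add: v simp del: enc_ltl.simps)
  next
    case (Next \<psi>)
    then show ?case using children_fs[of "Next \<psi>"] step_simps(7)[of \<psi> "u i" "v (Suc i)"] tt
      by (simp add: v del: enc_ltl.simps)
  next
    case (Until \<psi> \<chi>)
    have sub: "\<psi> \<in> set fs" "\<chi> \<in> set fs"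
      using children_fs[OF Until.prems] by auto
    have "E (Until \<psi> \<chi>) \<in> elems (v i)"
      if co: "cosafe \<psi>" "cosafe \<chi>" and "i \<le> j" "sat u j \<chi>" "\<forall>k. i \<le> k \<and> k < j \<longrightarrow> sat u k \<psi>" for j
      using that(3-5)
    proof (induction "j - i" arbitrary: i)
      case 0
      then show ?case
        using step_simps(8)[OF Until.prems, of "u i" "v (Suc i)"] Until.IH(2)[OF sub(2)] co
        unfolding v by auto
    next
      case (Suc n)
      then have "E (Until \<psi> \<chi>) \<in> elems (v (Suc i))"
        by auto
      moreover have "E \<psi> \<in> elems (v i)"
        using Suc Until.IH(1)[OF sub(1)] co by auto
      ultimately show ?case
        using step_simps(8)[OF Until.prems, of "u i" "v (Suc i)"] tt unfolding v by blast
    qed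
    then show ?case
      by (simp del: enc_ltl.simps) blast
  next
    case (Release \<psi> \<chi>)
    have sub: "\<psi> \<in> set fs" "\<chi> \<in> set fs"
      using children_fs[OF Release.prems] by auto
    have "sat u j \<chi> \<or> (\<exists>k. i \<le> k \<and> k < j \<and> sat u k \<psi>)"
      if "safe \<psi>" "safe \<chi>" "E (Release \<psi> \<chi>) \<in> elems (v i)" "i \<le> j" for j
    proof (rule disjCI)
      assume no: "\<not> (\<exists>k. i \<le> k \<and> k < j \<and> sat u k \<psi>)"
      have "E (Release \<psi> \<chi>) \<in> elems (v (i + n))" if "i + n \<le> j" for n
        using that
      proof (induction n)
        case (Suc n)
        then have "E \<psi> \<notin> elems (v (i + n))"
          using no Release.IH(1)[OF sub(1), of "i + n"] \<open>safe \<psi>\<close> by auto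
        then show ?case
          using Suc step_simps(9)[OF Release.prems, of "u (i + n)" "v (Suc (i + n))"] tt
          unfolding v by auto
      qed (use \<open>E (Release \<psi> \<chi>) \<in> elems (v i)\<close> in simp)
      from this[of "j - i"] \<open>i \<le> j\<close> have "E (Release \<psi> \<chi>) \<in> elems (v j)"
        by simp
      then have "E \<chi> \<in> elems (v j)"
        using step_simps(9)[OF Release.prems, of "u j" "v (Suc j)"] unfolding v by blast
      then show "sat u j \<chi>"
        using Release.IH(2)[OF sub(2)] \<open>safe \<chi>\<close> by blast
    qed
    then show ?case
      by (simp del: enc_ltl.simps)
  }
qed

text \<open>The true vectors of a word satisfy the local equations, by the unfolding laws of
  \<open>U\<close> and \<open>R\<close>, so they form one of its chains.\<close>

lemma chain_exists:
  assumes "\<And>i. u i \<subseteq> P"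
  shows "\<exists>v. chain u v \<and> (\<forall>\<psi>\<in>set fs. E \<psi> \<in> elems (v 0) \<longleftrightarrow> sat u 0 \<psi>)"
proof -
  \<comment> \<open>The filter needs a predicate on codes. Restricting to formulas over
    \<open>P\<close> makes decoding unambiguous.\<close>
  define T where "T i t \<longleftrightarrow> (\<exists>\<psi>. vars \<psi> \<subseteq> P \<and> t = E \<psi> \<and> sat u i \<psi>)" for i t
  define v where "v i = enc_list (filter (T i) (map E fs))" for i
  have T: "T i (E \<psi>) \<longleftrightarrow> sat u i \<psi>" if "\<psi> \<in> set fs" for i \<psi>
    using enc_ltl_inject[OF inj] vars_fs[OF that] unfolding T_def by metis
  have mem: "E \<psi> \<in> elems (v i) \<longleftrightarrow> sat u i \<psi>" if "\<psi> \<in> set fs" for i \<psi>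
    using that T[OF that] by (auto simp: v_def)
  have tt: "tree_tt \<in> elems (v i)" for i
    using mem[OF TT_in] by simp
  have "step (u i) (v (Suc i)) = v i" for i
    unfolding step_def C_def v_def[of i]
  proof (rule step_tree_eq_filter[OF follow order_refl])
    fix \<psi>
    assume \<psi>: "\<psi> \<in> set fs"
    have ch: "E \<chi> \<in> elems (v i) \<longleftrightarrow> sat u i \<chi>" "E \<chi> \<in> elems (v (Suc i)) \<longleftrightarrow> sat u (Suc i) \<chi>"
      if "\<chi> \<in> children \<psi>" for \<chi>
      using mem children_fs[OF \<psi>] that by auto
    have "holds_tree (bits (u i)) (v (Suc i)) (v i) (E \<psi>) \<longleftrightarrow> sat u i \<psi>"
    proof (cases \<psi>)
      case (Prop p)
      then have "p \<in> P"
        using vars_fs[OF \<psi>] by simp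
      then show ?thesis
        using bit_at_bits assms Prop by (simp add: holds_tree_enc_ltl del: enc_ltl.simps)
    next
      case (Until \<psi>1 \<psi>2)
      then show ?thesis
        using ch mem[OF \<psi>] tt sat_Until_unfold[of u i \<psi>1 \<psi>2]
        by (simp only: holds_tree_enc_ltl) auto
    next
      case (Release \<psi>1 \<psi>2)
      then show ?thesis
        using ch mem[OF \<psi>] tt sat_Release_unfold[of u i \<psi>1 \<psi>2]
        by (simp only: holds_tree_enc_ltl) auto
    qed (use ch tt in \<open>simp_all add: holds_tree_enc_ltl del: enc_ltl.simps\<close>)
    then show "T i (E \<psi>) \<longleftrightarrow> holds_tree (bits (u i)) (v (Suc i))
        (enc_list (filter (T i) (map E fs))) (E \<psi>)"
      using T[OF \<psi>] by (simp add: v_def)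
  qed
  with assms have "chain u v"
    by (simp add: chain_def)
  then show ?thesis
    using mem[of _ 0] by (intro exI[of _ v]) blast
qed

lemma elems_Ls: "elems Ls = enc_letter (card P) \<nu> ` Pow (ext P)"
proof (intro equalityI subsetI)
  fix t
  assume "t \<in> enc_letter (card P) \<nu> ` Pow (ext P)"
  then obtain \<theta> where "t = enc_letter (card P) \<nu> \<theta>"
    by blast
  then have "t = enc_list (map enc_bool ((None \<in> \<theta>) # map (\<lambda>i. i \<in> \<nu> ` strip \<theta>) [0..<card P]))"
    by (simp add: enc_letter_def)
  then show "t \<in> elems Ls"
    unfolding Ls_def elems_all_bits
    by (intro CollectI exI[of _ "(None \<in> \<theta>) # map (\<lambda>i. i \<in> \<nu> ` strip \<theta>) [0..<card P]"]) simp
next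
  fix t
  assume "t \<in> elems Ls"
  then obtain b cs where t: "t = Node (enc_bool b) (enc_list (map enc_bool cs))"
    and len: "length cs = card P"
    unfolding Ls_def elems_all_bits by (auto simp: length_Suc_conv)
  define a where "a = {p \<in> P. cs ! \<nu> p}"
  define \<theta> where "\<theta> = (if b then {None} else {}) \<union> Some ` a"
  have "strip \<theta> = a" "None \<in> \<theta> \<longleftrightarrow> b"
    by (auto simp: strip_def \<theta>_def)
  moreover have "i \<in> \<nu> ` a \<longleftrightarrow> cs ! i" if "i < card P" for i
  proof -
    from that bij obtain p where "p \<in> P" "i = \<nu> p"
      unfolding bij_betw_def by blast
    then show ?thesis
      using inj by (auto simp: a_def inj_on_def)
  qed
  then have "bits a = enc_list (map enc_bool cs)"
    unfolding bits_def by (auto simp: len intro: nth_equalityI)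
  ultimately have "t = enc_letter (card P) \<nu> \<theta>"
    by (simp add: t enc_letter_eq)
  moreover have "\<theta> \<in> Pow (ext P)"
    by (auto simp: \<theta>_def ext_def a_def)
  ultimately show "t \<in> enc_letter (card P) \<nu> ` Pow (ext P)"
    by blast
qed

lemma inj_enc_letter: "inj_on (enc_letter (card P) \<nu>) (Pow (ext P))"
proof (rule inj_onI)
  fix \<theta> \<theta>'
  assume "\<theta> \<in> Pow (ext P)" "\<theta>' \<in> Pow (ext P)"
    and eq: "enc_letter (card P) \<nu> \<theta> = enc_letter (card P) \<nu> \<theta>'"
  then have P: "strip \<theta> \<subseteq> P" "strip \<theta>' \<subseteq> P"
    by (auto simp: strip_def ext_def)
  have "\<forall>i<card P. i \<in> \<nu> ` strip \<theta> \<longleftrightarrow> i \<in> \<nu> ` strip \<theta>'"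
    using eq by (simp add: enc_letter_eq bits_def)
  moreover have "\<nu> ` strip \<theta> \<subseteq> {..<card P}" "\<nu> ` strip \<theta>' \<subseteq> {..<card P}"
    using P bij by (auto simp: bij_betw_def)
  ultimately have "\<nu> ` strip \<theta> = \<nu> ` strip \<theta>'"
    by blast
  then have "strip \<theta> = strip \<theta>'"
    using inj P by (simp add: inj_on_image_eq_iff)
  moreover have "None \<in> \<theta> \<longleftrightarrow> None \<in> \<theta>'"
    using eq by (simp add: enc_letter_eq)
  ultimately have "x \<in> \<theta> \<longleftrightarrow> x \<in> \<theta>'" for x
    by (cases x) (auto simp: strip_def)
  then show "\<theta> = \<theta>'"
    by blast
qed

lemma letter_bits: "l \<in> elems Ls \<Longrightarrow> \<exists>a \<subseteq> P. right l = bits a"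
proof -
  assume "l \<in> elems Ls"
  then obtain \<theta> where "\<theta> \<subseteq> ext P" "right l = bits (strip \<theta>)"
    by (auto simp: elems_Ls enc_letter_eq)
  moreover from this(1) have "strip \<theta> \<subseteq> P"
    by (auto simp: strip_def ext_def)
  ultimately show ?thesis
    by blast
qed

lemma bits_letter:
  assumes "a \<subseteq> P"
  shows "\<exists>l\<in>elems Ls. right l = bits a"
proof -
  have "strip (Some ` a) = a" "Some ` a \<in> Pow (ext P)"
    using assms by (auto simp: strip_def ext_def)
  then show ?thesis
    unfolding elems_Ls by (auto simp: enc_letter_eq intro: bexI[of _ "Some ` a"])
qed

section \<open>The greatest fixed point of the image\<close>

definition step_image :: "tree \<Rightarrow> tree" where
  "step_image R = image_tree C Vs Ls R"

lemma elems_step_image: "V \<in> elems (step_image R) \<longleftrightarrow> (\<exists>V'\<in>elems R. \<exists>a \<subseteq> P. step a V' = V)"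
proof
  show "V \<in> elems (step_image R) \<Longrightarrow> \<exists>V'\<in>elems R. \<exists>a \<subseteq> P. step a V' = V"
  proof -
    assume "V \<in> elems (step_image R)"
    then obtain V' l where "V' \<in> elems R" "l \<in> elems Ls" "step_tree C (right l) V' = V"
      by (auto simp: step_image_def image_tree_def)
    then show ?thesis
      using letter_bits[of l] unfolding step_def by metis
  qed
next
  assume "\<exists>V'\<in>elems R. \<exists>a \<subseteq> P. step a V' = V"
  then obtain V' a where "V' \<in> elems R" "a \<subseteq> P" "step a V' = V"
    by blast
  moreover from this obtain l where "l \<in> elems Ls" "right l = bits a"
    using bits_letter by blast
  ultimately show "V \<in> elems (step_image R)"
    using step_in_Vs[of a V']
    unfolding step_image_def image_tree_def step_def list_of_tree_simps set_filter mem_Collect_eq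
    by metis
qed

lemma core_funpow: "core = (step_image ^^ length (list_of Vs)) Vs"
proof -
  have "foldr (\<lambda>_. f) xs y = (f ^^ length xs) y" for f :: "tree \<Rightarrow> tree" and xs :: "tree list" and y
    by (induction xs) auto
  then show ?thesis
    by (simp add: core_def core_tree_def step_image_def[abs_def])
qed

lemma step_image_mono: "elems R \<subseteq> elems S \<Longrightarrow> elems (step_image R) \<subseteq> elems (step_image S)"
  unfolding subset_iff elems_step_image by blast

lemma funpow_image_antimono: "elems ((step_image ^^ Suc n) Vs) \<subseteq> elems ((step_image ^^ n) Vs)"
proof (induction n)
  case 0
  then show ?case
    by (auto simp: elems_step_image step_in_Vs)
next
  case (Suc n)
  then show ?case
    using step_image_mono by simp
qed

text \<open>Each round that is not yet stationary removes at least one vector. The invariant records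
  this: before stationarity, the number of vectors left plus the number of rounds is at most the
  length of \<open>Vs\<close>.\<close>

lemma image_core: "elems (step_image core) = elems core"
proof -
  have "elems (step_image ((step_image ^^ n) Vs)) = elems ((step_image ^^ n) Vs) \<or>
      card (elems ((step_image ^^ n) Vs)) + n \<le> length (list_of Vs)" for n
  proof (induction n)
    case 0
    then show ?case
      by (simp add: card_length)
  next
    case (Suc n)
    let ?R = "(step_image ^^ n) Vs"
    show ?case
    proof (cases "elems (step_image ?R) = elems ?R")
      case True
      then have "elems (step_image (step_image ?R)) = elems (step_image ?R)"
        by (intro equalityI step_image_mono) auto
      then show ?thesis
        by simp
    next
      case False
      then have "elems (step_image ?R) \<subset> elems ?R"
        using funpow_image_antimono[of n] by auto
      then have "card (elems (step_image ?R)) < card (elems ?R)"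
        by (intro psubset_card_mono) auto
      with False Suc.IH show ?thesis
        by simp
    qed
  qed
  from this[of "length (list_of Vs)"] consider "elems (step_image core) = elems core" |
    "card (elems core) = 0"
    unfolding core_funpow by fastforce
  then show ?thesis
  proof cases
    \<comment> \<open>When the rounds use up the whole count, no vector is left, and the empty set
      is its own image.\<close>
    case 2
    then have "elems core = {}"
      by simp
    then show ?thesis
      unfolding set_eq_iff elems_step_image by simp
  qed
qed

lemma core_subset: "elems core \<subseteq> elems Vs"
  by (metis elems_step_image image_core step_in_Vs subsetI)

lemma chain_in_core:
  assumes "chain u v"
  shows "v i \<in> elems core"
proof -
  have "v i \<in> elems ((step_image ^^ n) Vs)" for n
  proof (induction n arbitrary: i)
    case 0
    then show ?case
      using step_in_Vs chainD(2)[OF assms] by (metis funpow_0)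
  next
    case (Suc n)
    then show ?case
      using chainD[OF assms, of i] Suc[of "Suc i"] unfolding funpow.simps comp_def elems_step_image by blast
  qed
  then show ?thesis
    by (simp add: core_funpow)
qed

text \<open>Since \<open>core\<close> is contained in its own image, each member is
  \<open>step a y\<close> for a letter \<open>a\<close> and another member \<open>y\<close>.
  Repeating this choice spells out an infinite word together with a chain for it.\<close>

lemma core_chain:
  assumes "V \<in> elems core"
  obtains u v where "chain u v" "v 0 = V"
proof -
  \<comment> \<open>Dependent choice returns only a sequence satisfying a predicate, so the
    prescribed start \<open>V\<close> is made part of the predicate at 0.\<close>
  have "\<exists>f. \<forall>n. (f n \<in> elems core \<and> (n = 0 \<longrightarrow> f n = V)) \<and>
      (\<exists>a \<subseteq> P. f n = step a (f (Suc n)))"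
  proof (rule dependent_nat_choice)
    show "\<exists>x. x \<in> elems core \<and> (0 = (0 :: nat) \<longrightarrow> x = V)"
      using assms by blast
    fix x n
    assume "x \<in> elems core \<and> ((n :: nat) = 0 \<longrightarrow> x = V)"
    then have "x \<in> elems (step_image core)"
      using image_core by simp
    then show "\<exists>y. (y \<in> elems core \<and> (Suc n = 0 \<longrightarrow> y = V)) \<and> (\<exists>a \<subseteq> P. x = step a y)"
      unfolding elems_step_image by auto
  qed
  then obtain f where "f 0 = V" "\<forall>n. \<exists>a \<subseteq> P. f n = step a (f (Suc n))"
    by blast
  moreover from this(2) obtain u where "\<forall>n. u n \<subseteq> P \<and> f n = step (u n) (f (Suc n))"
    by metis
  then have "chain u f"
    unfolding chain_def by blast
  ultimately show thesis
    by (intro that)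
qed

lemma foldr_step_chain:
  assumes "chain (w \<frown> u) v"
  shows "v 0 = foldr step w (v (length w))"
proof -
  have "v i = foldr step (drop i w) (v (length w))" if "i \<le> length w" for i
    using that
  proof (induction rule: inc_induct)
    case (step i)
    then show ?case
      using chainD(2)[OF assms, of i] by (simp flip: Cons_nth_drop_Suc)
  qed simp
  from this[of 0] show ?thesis
    by simp
qed

lemma range_conc:
  assumes "w \<in> lists (Pow P)" "range u \<subseteq> Pow P"
  shows "(w \<frown> u) i \<subseteq> P"
proof (cases "i < length w")
  case True
  then have "w ! i \<in> Pow P"
    using assms(1) by (metis in_lists_conv_set nth_mem)
  with True show ?thesis
    by simp
qed (use assms(2) in auto)

text \<open>A chain that starts in \<open>V\<close> extends to the left through \<open>w\<close>,
  because vectors are computed backwards.\<close>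

lemma core_word_chain:
  assumes "V \<in> elems core" "w \<in> lists (Pow P)"
  obtains u v where "range u \<subseteq> Pow P" "chain (w \<frown> u) v" "v 0 = foldr step w V"
proof -
  obtain u v where uv: "chain u v" "v 0 = V"
    using core_chain[OF assms(1)] by blast
  define v' where "v' i = (if i < length w then foldr step (drop i w) V else v (i - length w))" for i
  have "chain (w \<frown> u) v'"
    unfolding chain_def
  proof (intro allI conjI)
    fix i
    show "(w \<frown> u) i \<subseteq> P"
      using range_conc[OF assms(2)] chainD(1)[OF uv(1)] by blast
    show "v' i = step ((w \<frown> u) i) (v' (Suc i))"
    proof (cases "i < length w")
      case True
      have "v' (Suc i) = foldr step (drop (Suc i) w) V"
      proof (cases "Suc i < length w")
        case False
        with True have "Suc i = length w"
          by simp
        with uv(2) show ?thesis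
          by (simp add: v'_def)
      qed (simp add: v'_def)
      then show ?thesis
        using True by (simp add: v'_def flip: Cons_nth_drop_Suc)
    next
      case False
      then show ?thesis
        using chainD(2)[OF uv(1), of "i - length w"] by (simp add: v'_def Suc_diff_le)
    qed
  qed
  moreover have "v' 0 = foldr step w V"
    using uv(2) by (auto simp: v'_def)
  moreover have "range u \<subseteq> Pow P"
    using chainD(1)[OF uv(1)] by blast
  ultimately show thesis
    using that by blast
qed

section \<open>The three component automata\<close>

definition component :: "tree \<Rightarrow> tree \<Rightarrow> ('a set, tree) aut" where
  "component f R =
     \<lparr> alphabet = Pow P,
       states = elems Qs,
       trans = (\<lambda>q a. delta_tree C Vs (bits a) q),
       init = start_tree Vs f,
       accepting = {q \<in> elems Qs. disjoint_tree q R} \<rparr>"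

lemma delta_in_Qs: "delta_tree C Vs a q \<in> elems Qs"
  unfolding Qs_def delta_tree_def by (rule tree_filter_in_all_sublists)

lemma start_in_Qs: "start_tree Vs f \<in> elems Qs"
  unfolding Qs_def start_tree_def by (rule tree_filter_in_all_sublists)

lemma det_component: "det_aut (component f R)"
  using finite_P by (auto simp: det_aut_def component_def start_in_Qs delta_in_Qs)

text \<open>Pulling back along the letters from left to right is pulling back along the composed
  map, which applies the last letter first; hence \<open>foldl\<close> on one side and
  \<open>foldr\<close> on the other. All computed vectors lie in \<open>Vs\<close>, so filtering in
  between loses nothing.\<close>

lemma foldl_delta:
  "foldl (\<lambda>q a. delta_tree C Vs (bits a) q) (start_tree Vs f) w =
     tree_filter (\<lambda>V. f \<in> elems (foldr step w V) \<or> tree_tt \<notin> elems (foldr step w V)) Vs"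
proof (induction w rule: rev_induct)
  case (snoc a w)
  then show ?case
    using step_in_Vs
    by (auto simp: delta_tree_def tree_filter_def step_def intro!: filter_cong)
qed (simp add: start_tree_def)

lemma component_language:
  assumes "elems R \<subseteq> elems Vs"
  shows "dfa_language (component f R) =
    {w \<in> lists (Pow P). \<forall>V\<in>elems R. f \<notin> elems (foldr step w V) \<and> tree_tt \<in> elems (foldr step w V)}"
proof -
  let ?q = "\<lambda>w. foldl (\<lambda>q a. delta_tree C Vs (bits a) q) (start_tree Vs f) w"
  have "?q w \<in> elems Qs" for w
    by (cases w rule: rev_cases) (auto simp: start_in_Qs delta_in_Qs)
  moreover have "disjoint_tree (?q w) R \<longleftrightarrow>
      (\<forall>V\<in>elems R. f \<notin> elems (foldr step w V) \<and> tree_tt \<in> elems (foldr step w V))" for w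
    using assms unfolding foldl_delta disjoint_tree_def by auto
  ultimately show ?thesis
    by (simp add: dfa_language_def component_def)
qed

lemma foldr_step_core:
  assumes "w \<in> lists (Pow P)"
  shows "(\<exists>V\<in>elems core. Q (foldr step w V)) \<longleftrightarrow>
    (\<exists>u v. range u \<subseteq> Pow P \<and> chain (w \<frown> u) v \<and> Q (v 0))"
proof
  assume "\<exists>V\<in>elems core. Q (foldr step w V)"
  then show "\<exists>u v. range u \<subseteq> Pow P \<and> chain (w \<frown> u) v \<and> Q (v 0)"
    using core_word_chain[OF _ assms] by metis
next
  assume "\<exists>u v. range u \<subseteq> Pow P \<and> chain (w \<frown> u) v \<and> Q (v 0)"
  then show "\<exists>V\<in>elems core. Q (foldr step w V)"
    using foldr_step_chain chain_in_core by metis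
qed

lemma core_language:
  "dfa_language (component f core) =
    {w \<in> lists (Pow P). \<forall>u v. range u \<subseteq> Pow P \<longrightarrow> chain (w \<frown> u) v \<longrightarrow> f \<notin> elems (v 0)}"
proof -
  have "(\<forall>V\<in>elems core. f \<notin> elems (foldr step w V) \<and> tree_tt \<in> elems (foldr step w V)) \<longleftrightarrow>
      (\<forall>u v. range u \<subseteq> Pow P \<longrightarrow> chain (w \<frown> u) v \<longrightarrow> f \<notin> elems (v 0))"
    if w: "w \<in> lists (Pow P)" for w
  proof -
    have "tree_tt \<in> elems (v 0)" if "chain (w \<frown> u) v" for u v
      using that by (rule chain_tt)
    then show ?thesis
      using foldr_step_core[OF w, of "\<lambda>V. \<not> (f \<notin> elems V \<and> tree_tt \<in> elems V)"] by metis
  qed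
  then show ?thesis
    unfolding component_language[OF core_subset] by (intro Collect_cong conj_cong refl)
qed

text \<open>If no chain claims \<alpha> at the front, no continuation satisfies it, as true vectors
  form a chain. Conversely a chain that claims the safe formula \<alpha> is right about it, so
  spurious chains cannot prevent acceptance of a bad prefix.\<close>

lemma bad_prefix_component:
  assumes "\<alpha> \<in> set fs" "safe \<alpha>"
  shows "bad_prefix_dfa P \<alpha> (component (E \<alpha>) core)"
proof -
  have "(\<forall>u v. range u \<subseteq> Pow P \<longrightarrow> chain (w \<frown> u) v \<longrightarrow> E \<alpha> \<notin> elems (v 0)) \<longleftrightarrow>
      (\<forall>u. range u \<subseteq> Pow P \<longrightarrow> \<not> sat (w \<frown> u) 0 \<alpha>)" if w: "w \<in> lists (Pow P)" for w
  proof (intro iffI allI impI)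
    fix u :: "'a set word"
    assume A: "\<forall>u v. range u \<subseteq> Pow P \<longrightarrow> chain (w \<frown> u) v \<longrightarrow> E \<alpha> \<notin> elems (v 0)"
      and u: "range u \<subseteq> Pow P"
    obtain v where "chain (w \<frown> u) v" "E \<alpha> \<in> elems (v 0) \<longleftrightarrow> sat (w \<frown> u) 0 \<alpha>"
      using chain_exists[of "w \<frown> u", OF range_conc[OF w u]] assms(1) by auto
    with A u show "\<not> sat (w \<frown> u) 0 \<alpha>"
      by blast
  next
    fix u v
    assume "\<forall>u. range u \<subseteq> Pow P \<longrightarrow> \<not> sat (w \<frown> u) 0 \<alpha>" "range u \<subseteq> Pow P" "chain (w \<frown> u) v"
    then show "E \<alpha> \<notin> elems (v 0)"
      using chain_safe_cosafe[of "w \<frown> u" v \<alpha> 0] assms by blast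
  qed
  then have "dfa_language (component (E \<alpha>) core) = {w. bad_prefix P \<alpha> w}"
    unfolding core_language bad_prefix_def by (intro Collect_cong conj_cong refl)
  then show ?thesis
    by (simp add: bad_prefix_dfa_def det_component) (simp add: component_def)
qed

text \<open>\<open>Not \<alpha>\<close> need not be a safe formula syntactically, but within a chain
  it is just the absence of \<alpha>. Co-safety of \<alpha> then shows that a chain without \<alpha>
  refutes it.\<close>

lemma good_prefix_component:
  assumes "Not \<alpha> \<in> set fs" "cosafe \<alpha>"
  shows "good_prefix_dfa P \<alpha> (component (E (Not \<alpha>)) core)"
proof -
  have \<alpha>: "\<alpha> \<in> set fs"
    using children_fs[OF assms(1)] by simp
  have neg: "E (Not \<alpha>) \<notin> elems (v 0) \<longleftrightarrow> E \<alpha> \<in> elems (v 0)" if "chain u v" for u v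
    using step_simps(4)[OF assms(1), of "u 0" "v (Suc 0)"] chainD(2)[OF that, of 0] by simp
  have "(\<forall>u v. range u \<subseteq> Pow P \<longrightarrow> chain (w \<frown> u) v \<longrightarrow> E (Not \<alpha>) \<notin> elems (v 0)) \<longleftrightarrow>
      (\<forall>u. range u \<subseteq> Pow P \<longrightarrow> sat (w \<frown> u) 0 \<alpha>)" if w: "w \<in> lists (Pow P)" for w
  proof (intro iffI allI impI)
    fix u :: "'a set word"
    assume A: "\<forall>u v. range u \<subseteq> Pow P \<longrightarrow> chain (w \<frown> u) v \<longrightarrow> E (Not \<alpha>) \<notin> elems (v 0)"
      and u: "range u \<subseteq> Pow P"
    obtain v where "chain (w \<frown> u) v" "E \<alpha> \<in> elems (v 0) \<longleftrightarrow> sat (w \<frown> u) 0 \<alpha>"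
      using chain_exists[of "w \<frown> u", OF range_conc[OF w u]] \<alpha> by auto
    with A u neg show "sat (w \<frown> u) 0 \<alpha>"
      by blast
  next
    fix u v
    assume "\<forall>u. range u \<subseteq> Pow P \<longrightarrow> sat (w \<frown> u) 0 \<alpha>" "range u \<subseteq> Pow P" "chain (w \<frown> u) v"
    then show "E (Not \<alpha>) \<notin> elems (v 0)"
      using chain_safe_cosafe[of "w \<frown> u" v \<alpha> 0] \<alpha> assms(2) neg by blast
  qed
  then have "dfa_language (component (E (Not \<alpha>)) core) = {w. good_prefix P \<alpha> w}"
    unfolding core_language good_prefix_def by (intro Collect_cong conj_cong refl)
  then show ?thesis
    by (simp add: good_prefix_dfa_def det_component del: enc_ltl.simps) (simp add: component_def)
qed

text \<open>Exactness on finite traces makes the negated start formula equivalent to violating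
  \<phi>. The vector of the empty word lacks \<open>TT\<close>, so it belongs to the start set and
  the empty word is rejected.\<close>

lemma ltlf_component:
  assumes "Not \<phi> \<in> set fs"
  shows "ltlf_dfa P \<phi> (component (E (Not \<phi>)) (Node Leaf Leaf))"
proof -
  have "Leaf \<in> elems Vs"
    using filter_in_subseqs[of "\<lambda>_. False" "list_of C"] by (simp add: Vs_def elems_all_sublists)
  then have "dfa_language (component (E (Not \<phi>)) (Node Leaf Leaf)) =
    {w \<in> lists (Pow P). E (Not \<phi>) \<notin> elems (foldr step w Leaf) \<and> tree_tt \<in> elems (foldr step w Leaf)}"
    by (subst component_language) auto
  also have "\<dots> = {w \<in> lists (Pow P). w \<noteq> [] \<and> satf w 0 \<phi>}"
  proof (rule Collect_cong, rule conj_cong[OF refl])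
    fix w
    assume w: "w \<in> lists (Pow P)"
    show "E (Not \<phi>) \<notin> elems (foldr step w Leaf) \<and> tree_tt \<in> elems (foldr step w Leaf) \<longleftrightarrow>
        w \<noteq> [] \<and> satf w 0 \<phi>"
    proof (cases w)
      case (Cons a w')
      then have "E (Not \<phi>) \<in> elems (foldr step w Leaf) \<longleftrightarrow> \<not> satf w 0 \<phi>"
        using satf_iff_vector[OF w _ assms, of 0] by simp
      then show ?thesis
        using Cons tt_in_step by simp
    qed simp
  qed
  finally show ?thesis
    by (simp add: ltlf_dfa_def det_component del: enc_ltl.simps) (simp add: component_def)
qed

end

section \<open>The written-out automaton\<close>

text \<open>The program outputs lists of codes, while \<open>encodes_aut\<close> asks for lists of
  the coded objects. Injective codes can be decoded entry by entry.\<close>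

lemma list_with_image:
  assumes "inj_on f A" "f ` A = set ys"
  shows "\<exists>xs. map f xs = ys \<and> set xs = A"
proof (intro exI conjI)
  have "inv_into A f y \<in> A \<and> f (inv_into A f y) = y" if "y \<in> set ys" for y
    using that assms(2) by (metis f_inv_into_f inv_into_into)
  then show "map f (map (inv_into A f) ys) = ys"
    by (auto intro: map_idI)
  show "set (map (inv_into A f) ys) = A"
    using assms by (force simp flip: assms(2))
qed

lemma enc_option_inject: "enc_option a = enc_option b \<longleftrightarrow> a = b"
  by (cases a; cases b) auto

lemma inj_enc_pstate: "inj enc_pstate"
proof (rule injI)
  show "p = q" if "enc_pstate p = enc_pstate q" for p q
    using that by (cases p; cases q) (auto simp: enc_option_inject)
qed

lemma enc_option_eq_Leaf: "enc_option q = Leaf \<longleftrightarrow> q = None"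
  by (cases q) auto

context truth_vectors
begin

text \<open>The states of the components are the very trees that the program handles, so only
  letters and product states have to be translated. The core of the argument is that the computed
  transition commutes with these codes.\<close>

lemma encodes_aut_tree:
  fixes e :: tree and \<alpha>s \<alpha>c \<phi> :: "'a ltl"
  defines "S \<equiv> spec_aut P (component (E \<alpha>s) core) (component (E (Not \<alpha>c)) core)
    (component (E (Not \<phi>)) (Node Leaf Leaf))"
  assumes input: "data_input e = enc_list [enc_nat (card P), E \<alpha>s, E \<alpha>c, E \<phi>]"
    and C: "data_closure e = C" and Ls: "data_letters e = Ls"
    and Vs: "data_vectors e = Vs" and Qs: "data_sets e = Qs"
  shows "encodes_aut (enc_letter (card P) \<nu>) enc_pstate S (aut_tree e)"
proof -
  let ?el = "enc_letter (card P) \<nu>"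
  have core: "data_core e = core"
    unfolding data_core_def core_def using C Vs Ls by simp
  have delta: "data_delta e a q = delta_tree C Vs a q" for a q
    unfolding data_delta_def using C Vs by simp
  define I where "I = insert None (Some ` elems Qs)"
  have option: "elems (option_tree (data_sets e)) = enc_option ` I"
    by (simp add: option_tree_def Qs image_image I_def)
  have states_S: "states S = {Live qs qc qg | qs qc qg. qs \<in> I \<and> qc \<in> I \<and> qg \<in> elems Qs} \<union> {Top, Bot}"
    by (simp add: S_def spec_aut_def live_states_def component_def I_def)
  have alphabet_S: "alphabet S = Pow (ext P)"
    by (simp add: S_def spec_aut_def)
  have states: "enc_pstate ` states S = elems (states_tree e)"
  proof -
    have Live: "enc_pstate (Live qs qc qg) = live_tree (enc_option qs) (enc_option qc) qg" for qs qc qg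
      by (simp add: live_tree_def)
    have "enc_pstate ` {Live qs qc qg | qs qc qg. qs \<in> I \<and> qc \<in> I \<and> qg \<in> elems Qs} =
        {live_tree s c g | s c g. s \<in> enc_option ` I \<and> c \<in> enc_option ` I \<and> g \<in> elems Qs}"
    proof (intro equalityI subsetI)
      fix t
      assume "t \<in> {live_tree s c g | s c g. s \<in> enc_option ` I \<and> c \<in> enc_option ` I \<and> g \<in> elems Qs}"
      then obtain qs qc qg where "t = enc_pstate (Live qs qc qg)" "qs \<in> I" "qc \<in> I" "qg \<in> elems Qs"
        unfolding Live by blast
      then show "t \<in> enc_pstate ` {Live qs qc qg | qs qc qg. qs \<in> I \<and> qc \<in> I \<and> qg \<in> elems Qs}"
        by blast
    qed (auto simp: live_tree_def)
    then have "enc_pstate ` states S = {top_tree, bot_tree} \<union>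
        {live_tree s c g | s c g. s \<in> enc_option ` I \<and> c \<in> enc_option ` I \<and> g \<in> elems Qs}"
      unfolding states_S image_Un by (simp add: top_tree_def bot_tree_def Un_commute)
    also have "\<dots> = elems (states_tree e)"
      unfolding option[symmetric] by (auto simp: states_tree_def Qs)
    finally show ?thesis .
  qed
  have star: "star_tree e (bits a) (enc_option q) = enc_option (star (component f core) q a)" for f q a
    using delta_in_Qs
    by (cases q) (auto simp: star_tree_def delta core component_def)
  \<comment> \<open>The empty list is \<open>Leaf\<close>, and the wrapping by
    \<open>enc_option\<close> is what distinguishes an empty set of vectors from
    \<open>None\<close>.\<close>
  have step: "spec_step_tree e (enc_pstate p) (?el \<theta>) = enc_pstate (trans S p \<theta>)" for p \<theta>
    unfolding spec_step_tree_def S_def spec_aut_def enc_letter_eq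
    using delta_in_Qs star delta
    by (cases p) (auto simp: live_tree_def top_tree_def bot_tree_def component_def)
  have table: "(\<lambda>(q, l, q'). enc_list [enc_pstate q, ?el l, enc_pstate q']) `
      {(q, l, trans S q l) | q l. q \<in> states S \<and> l \<in> alphabet S} = elems (table_tree e)"
  proof -
    have "elems (table_tree e) = {Node p (Node l (Node (spec_step_tree e p l) Leaf)) | p l.
        p \<in> enc_pstate ` states S \<and> l \<in> ?el ` alphabet S}"
      unfolding states alphabet_S elems_Ls[symmetric] by (auto simp: table_tree_def Ls)
    also have "\<dots> = {Node (enc_pstate p) (Node (?el l) (Node (enc_pstate (trans S p l)) Leaf)) | p l.
        p \<in> states S \<and> l \<in> alphabet S}"
      by (auto simp flip: step)
    also have "\<dots> = (\<lambda>(q, l, q'). enc_list [enc_pstate q, ?el l, enc_pstate q']) `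
        {(q, l, trans S q l) | q l. q \<in> states S \<and> l \<in> alphabet S}"
      by (auto simp: image_iff) blast
    finally show ?thesis ..
  qed
  have inj_table: "inj_on (\<lambda>(q, l, q'). enc_list [enc_pstate q, ?el l, enc_pstate q'])
      {(q, l, trans S q l) | q l. q \<in> states S \<and> l \<in> alphabet S}"
    using inj_enc_letter inj_enc_pstate unfolding alphabet_S by (auto simp: inj_on_def)
  have accepting: "enc_pstate ` accepting S = elems (accepting_tree e)"
  proof -
    have "accepting S = {p \<in> states S. left (enc_pstate p) = enc_nat 1 \<or> left (enc_pstate p) = Leaf \<and>
        (left (right (enc_pstate p)) = Leaf \<or> left (right (right (enc_pstate p))) \<noteq> Leaf)}"
    proof (rule set_eqI)
      show "p \<in> accepting S \<longleftrightarrow> p \<in> {p \<in> states S. left (enc_pstate p) = enc_nat 1 \<or>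
        left (enc_pstate p) = Leaf \<and>
        (left (right (enc_pstate p)) = Leaf \<or> left (right (right (enc_pstate p))) \<noteq> Leaf)}" for p
        by (cases p) (auto simp: S_def spec_aut_def enc_option_eq_Leaf)
    qed
    then show ?thesis
      unfolding accepting_tree_def list_of_tree_simps set_filter states[symmetric] by blast
  qed
  have init: "enc_pstate (init S) = init_tree e"
    using input
    by (simp add: S_def spec_aut_def init_tree_def live_tree_def component_def Vs tree_not_def)
  obtain ls where ls: "map ?el ls = list_of Ls" "set ls = alphabet S"
    using list_with_image[OF inj_enc_letter elems_Ls[symmetric]] alphabet_S by auto
  obtain qs where qs: "map enc_pstate qs = list_of (states_tree e)" "set qs = states S"
    using list_with_image[OF inj_on_subset[OF inj_enc_pstate] states] by auto
  obtain ts where ts: "map (\<lambda>(q, l, q'). enc_list [enc_pstate q, ?el l, enc_pstate q']) ts =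
      list_of (table_tree e)"
    "set ts = {(q, l, trans S q l) | q l. q \<in> states S \<and> l \<in> alphabet S}"
    using list_with_image[OF inj_table table] by auto
  obtain as where as: "map enc_pstate as = list_of (accepting_tree e)" "set as = accepting S"
    using list_with_image[OF inj_on_subset[OF inj_enc_pstate] accepting] by auto
  have "aut_tree e = enc_list [enc_list (map ?el ls), enc_list (map enc_pstate qs),
      enc_list (map (\<lambda>(q, l, q'). enc_list [enc_pstate q, ?el l, enc_pstate q']) ts),
      enc_pstate (init S), enc_list (map enc_pstate as)]"
    unfolding ls(1) qs(1) ts(1) as(1) init by (simp add: aut_tree_def Ls)
  then show ?thesis
    unfolding encodes_aut_def using ls(2) qs(2) ts(2) as(2) by blast
qed

end

section \<open>Size of the data\<close>

lemma size_enc_list_le: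
  assumes "\<And>x. x \<in> set xs \<Longrightarrow> size x \<le> b"
  shows "size (enc_list xs) \<le> length xs * (b + 1)"
  using assms
proof (induction xs)
  case (Cons a xs)
  then have "size a \<le> b" "size (enc_list xs) \<le> length xs * (b + 1)"
    by simp_all
  then show ?case
    by simp
qed simp

lemma size_enc_nat [simp]: "size (enc_nat n) = n"
  unfolding enc_nat_def by (induction n) auto

lemma size_subseq: "xs \<in> set (subseqs ys) \<Longrightarrow> size (enc_list xs) \<le> size (enc_list ys)"
  by (induction ys arbitrary: xs) (auto simp: Let_def le_SucI trans_le_add2)

lemma length_all_sublists: "length (list_of (all_sublists t)) = 2 ^ length (list_of t)"
  by (simp add: list_of_all_sublists length_subseqs)

lemma size_all_sublists: "size (all_sublists t) \<le> 2 ^ length (list_of t) * (size t + 1)"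
proof -
  have "size V \<le> size t" if "V \<in> elems (all_sublists t)" for V
    using that size_subseq[of "list_of V" "list_of t"] by (simp add: elems_all_sublists)
  then show ?thesis
    using size_enc_list_le[of "list_of (all_sublists t)" "size t"] by (simp add: length_all_sublists)
qed

lemma size_all_bits: "size (all_bits (enc_nat n)) \<le> 2 ^ n * (2 * n + 1)"
proof -
  have "size V \<le> 2 * n" if V: "V \<in> elems (all_bits (enc_nat n))" for V
  proof -
    obtain bs where "V = enc_list (map enc_bool bs)" "length bs = n"
      using V by (auto simp: elems_all_bits)
    moreover have "size (enc_bool b) \<le> 1" for b
      by (simp add: enc_bool_def)
    then have "size (enc_list (map enc_bool bs)) \<le> length (map enc_bool bs) * (1 + 1)"
      by (intro size_enc_list_le) auto
    ultimately show ?thesis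
      by simp
  qed
  moreover have "length (list_of (all_bits (enc_nat n))) = 2 ^ n"
    by (induction n) (auto simp: all_bits_def)
  ultimately show ?thesis
    using size_enc_list_le[of "list_of (all_bits (enc_nat n))" "2 * n"] by simp
qed

text \<open>11 is the largest tag, 8, plus the three list cells of a binary operator;
  \<open>k\<close> pays for the number of a variable.\<close>

lemma size_enc_ltl:
  assumes "\<And>p. p \<in> vars \<psi> \<Longrightarrow> \<nu> p < k"
  shows "size (enc_ltl \<nu> \<psi>) \<le> (k + 11) * fsize \<psi>"
  using assms
proof (induction \<psi>)
  case (Prop p)
  then show ?case
    by (auto simp: less_imp_le_nat intro: order_trans)
qed (auto simp: algebra_simps intro: add_mono)

lemma fsize_subs: "\<chi> \<in> set (subs \<psi>) \<Longrightarrow> fsize \<chi> \<le> fsize \<psi>"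
  by (induction \<psi>) auto

lemma fsize_pos: "fsize \<psi> \<ge> 1"
  by (induction \<psi>) auto

definition closure_list :: "'a ltl \<Rightarrow> 'a ltl \<Rightarrow> 'a ltl \<Rightarrow> 'a ltl list" where
  "closure_list \<alpha>s \<alpha>c \<phi> = subs \<alpha>s @ subs (Not \<alpha>c) @ subs (Not \<phi>) @ [TT]"

lemma closure_tree_enc:
  "closure_tree (enc_list [enc_nat k, enc_ltl \<nu> \<alpha>s, enc_ltl \<nu> \<alpha>c, enc_ltl \<nu> \<phi>]) =
     enc_list (map (enc_ltl \<nu>) (closure_list \<alpha>s \<alpha>c \<phi>))"
proof -
  have "tree_not (enc_ltl \<nu> \<psi>) = enc_ltl \<nu> (Not \<psi>)" for \<psi>
    by (simp add: tree_not_def)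
  then show ?thesis
    by (simp add: closure_tree_def closure_list_def subformulas_enc_ltl tree_append_def
        del: enc_ltl.simps subs.simps) simp
qed

text \<open>Every part is estimated by a power of one large number \<open>Z\<close>: at most the
  second for the letters, third for the input, fourth for the closure, fifth for the vectors and
  seventh for their sets. The eighth covers the sum.\<close>

lemma size_data_tree:
  fixes \<alpha>s \<alpha>c \<phi> :: "'a ltl" and k :: nat
  assumes \<nu>: "\<And>p. p \<in> P \<Longrightarrow> \<nu> p < k"
    and vars: "vars \<alpha>s \<subseteq> P" "vars \<alpha>c \<subseteq> P" "vars \<phi> \<subseteq> P"
  defines "x \<equiv> enc_list [enc_nat k, enc_ltl \<nu> \<alpha>s, enc_ltl \<nu> \<alpha>c, enc_ltl \<nu> \<phi>]"
    and "s \<equiv> fsize \<alpha>s + fsize \<alpha>c + fsize \<phi>"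
  shows "size x + size (data_tree x) + 2 \<le> (2 ^ k * 2 ^ (2 ^ (s + 3))) ^ 8"
proof -
  \<comment> \<open>The closure has s + 3 entries: the subformulas, two negations and
    \<open>TT\<close>. Its sublists are the vectors, and sublists of these are the states, so the
    second factor counts the sets. The first counts the letters up to the bit for
    \<open>end\<close>.\<close>
  define Z :: nat where "Z = 2 ^ k * 2 ^ (2 ^ (s + 3))"
  define C where "C = closure_tree x"
  define Vs where "Vs = all_sublists C"
  \<comment> \<open>The slack of 16 lets a sum of several powers of \<open>Z\<close> fit below the
    next power.\<close>
  have D: "16 \<le> (2 :: nat) ^ (2 ^ (s + 3))"
  proof -
    have "(2 :: nat) ^ 4 \<le> 2 ^ (2 ^ (s + 3))"
      by (intro power_increasing) (auto simp: power_add)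
    then show ?thesis
      by simp
  qed
  have K: "k + 1 \<le> (2 :: nat) ^ k"
    by (simp add: Suc_leI)
  have ZK: "16 * 2 ^ k \<le> Z"
    unfolding Z_def using mult_le_mono2[OF D, of "2 ^ k"] by (simp add: mult.commute)
  have ZD: "2 ^ (2 ^ (s + 3)) \<le> Z"
    unfolding Z_def by simp
  have Z: "16 \<le> Z" "k + 11 \<le> Z" "2 ^ (k + 1) \<le> Z" "2 * (k + 1) + 1 \<le> Z"
    using ZK K by simp_all
  have "2 ^ (s + 3) \<le> (2 :: nat) ^ (2 ^ (s + 3))"
    by (simp add: less_imp_le)
  then have Z': "2 ^ (s + 3) \<le> Z"
    using ZD by (rule order_trans)
  have "s + 3 \<le> 2 ^ (s + 3)"
    by (simp add: less_imp_le)
  then have Z'': "s + 3 \<le> Z"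
    using Z' by (rule order_trans)
  have enc: "size (enc_ltl \<nu> \<psi>) \<le> Z * fsize \<psi>" if "vars \<psi> \<subseteq> P" for \<psi>
    using size_enc_ltl[of \<psi> \<nu> k] \<nu> that mult_le_mono1[OF Z(2), of "fsize \<psi>"]
    by (meson order_trans subsetD)
  have x: "size x \<le> Z * Z + Z"
  proof -
    have "size x \<le> k + Z * s + 4"
      using enc[OF vars(1)] enc[OF vars(2)] enc[OF vars(3)]
      by (simp add: x_def s_def algebra_simps)
    also have "\<dots> \<le> Z + Z * Z"
    proof -
      have "Z * s \<le> Z * Z"
        using Z'' by (intro mult_le_mono2) simp
      with Z(2) show ?thesis
        by linarith
    qed
    finally show ?thesis
      by simp
  qed
  have C_eq: "C = enc_list (map (enc_ltl \<nu>) (closure_list \<alpha>s \<alpha>c \<phi>))"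
    unfolding C_def x_def by (rule closure_tree_enc)
  have length_C: "length (list_of C) = s + 3"
    by (simp add: C_eq closure_list_def length_subs s_def)
  have C: "size C \<le> Z * (Z * Z + 1)"
  proof -
    have "size t \<le> Z * Z" if t: "t \<in> elems C" for t
    proof -
      obtain \<psi> where "\<psi> \<in> set (closure_list \<alpha>s \<alpha>c \<phi>)" "t = enc_ltl \<nu> \<psi>"
        using t by (auto simp: C_eq)
      moreover from this(1) have "vars \<psi> \<subseteq> P" "fsize \<psi> \<le> s + 3"
        using vars vars_subs[of \<psi>] fsize_subs[of \<psi>]
        by (fastforce simp: closure_list_def s_def)+
      moreover from this(2) have "Z * fsize \<psi> \<le> Z * Z"
        using Z'' by (intro mult_le_mono2) simp
      ultimately show ?thesis
        using enc[of \<psi>] by (metis order_trans)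
    qed
    then have "size C \<le> (s + 3) * (Z * Z + 1)"
      using size_enc_list_le[of "list_of C" "Z * Z"] length_C by simp
    also have "\<dots> \<le> Z * (Z * Z + 1)"
      using Z'' by (rule mult_le_mono1)
    finally show ?thesis .
  qed
  have Vs: "size Vs \<le> Z * (size C + 1)"
    using size_all_sublists[of C] mult_le_mono1[OF Z', of "size C + 1"]
    unfolding Vs_def length_C by (rule order_trans)
  have Qs: "size (all_sublists Vs) \<le> Z * (size Vs + 1)"
    using size_all_sublists[of Vs] mult_le_mono1[OF ZD, of "size Vs + 1"]
    unfolding Vs_def length_all_sublists length_C by (rule order_trans)
  have Ls: "size (all_bits (enc_nat (k + 1))) \<le> Z * Z"
    using size_all_bits[of "k + 1"] mult_le_mono[OF Z(3,4)] by (rule order_trans)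
  have "data_tree x = Node (Node (Node (Node x C) (all_bits (enc_nat (k + 1)))) Vs) (all_sublists Vs)"
  proof -
    have "Node Leaf (left x) = enc_nat (k + 1)"
      by (simp add: x_def enc_nat_def)
    then show ?thesis
      by (simp add: data_tree_def C_def Vs_def Let_def)
  qed
  then have "size x + size (data_tree x) + 2 =
      2 * size x + size C + size (all_bits (enc_nat (k + 1))) + size Vs + size (all_sublists Vs) + 6"
    by simp
  also have "\<dots> \<le> Z ^ 8"
  proof -
    have Z_power: "16 * Z ^ n \<le> Z ^ Suc n" for n
      using mult_le_mono1[OF Z(1), of "Z ^ n"] by simp
    have ge: "1 \<le> Z ^ n" for n
      using Z(1) by (simp add: Suc_leI)
    have powers: "16 * Z ^ 2 \<le> Z ^ 3" "16 * Z ^ 3 \<le> Z ^ 4" "16 * Z ^ 4 \<le> Z ^ 5"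
      "16 * Z ^ 5 \<le> Z ^ 6" "16 * Z ^ 6 \<le> Z ^ 7" "16 * Z ^ 7 \<le> Z ^ 8"
      using Z_power[of 2] Z_power[of 3] Z_power[of 4] Z_power[of 5] Z_power[of 6] Z_power[of 7]
      by (simp_all add: numeral_eq_Suc)
    have "size x + 1 \<le> Z ^ 3"
      using x Z_power[of 2] Z_power[of 1] Z(1) by (simp add: power2_eq_square numeral_eq_Suc)
    moreover have c: "size C + 1 \<le> Z ^ 4"
      using C Z_power[of 3] Z_power[of 2] Z_power[of 1] Z(1)
      by (simp add: power2_eq_square numeral_eq_Suc algebra_simps)
    moreover have v: "size Vs \<le> Z ^ 5"
      using Vs mult_le_mono2[OF c, of Z] by (simp add: numeral_eq_Suc)
    moreover have "size (all_sublists Vs) \<le> Z ^ 7"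
    proof -
      have "size Vs + 1 \<le> Z ^ 6"
        using v powers(4) ge[of 5] by linarith
      from mult_le_mono2[OF this, of Z] Qs show ?thesis
        by (simp add: numeral_eq_Suc)
    qed
    moreover have "size (all_bits (enc_nat (k + 1))) \<le> Z ^ 2"
      using Ls by (simp add: power2_eq_square)
    ultimately show ?thesis
      using powers ge[of 2] by linarith
  qed
  finally show ?thesis
    unfolding Z_def .
qed

text \<open>All constants move into the innermost exponent: a sum s + b is below a power of s once s
  is at least 3, which holds for the total size of three formulas.\<close>

lemma double_exponential_bound:
  fixes s k c :: nat
  assumes "3 \<le> s"
  shows "((2 ^ k * 2 ^ (2 ^ (s + 3))) ^ 8) ^ c \<le> 2 ^ ((8 * c + 4) * k) * (2 :: nat) ^ (2 ^ (s ^ (8 * c + 4)))"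
proof -
  have "((2 ^ k * 2 ^ (2 ^ (s + 3))) ^ 8) ^ c = 2 ^ (8 * c * k) * (2 :: nat) ^ (8 * c * 2 ^ (s + 3))"
    by (simp add: power_mult_distrib ac_simps flip: power_mult)
  also have "\<dots> \<le> 2 ^ ((8 * c + 4) * k) * 2 ^ (2 ^ (s ^ (8 * c + 4)))"
  proof (intro mult_le_mono power_increasing)
    \<comment> \<open>The exponent 8 c + 4 arises here: with e = 8 c + 3, the sum s + e is at most s
      (e + 1), and e + 1 is at most s to the power e.\<close>
    have "s + (8 * c + 3) \<le> s * (8 * c + 4)"
    proof -
      have "8 * c + 3 \<le> s * (8 * c + 3)"
        using assms by simp
      then show ?thesis
        by (simp add: algebra_simps)
    qed
    also have "\<dots> \<le> s * s ^ (8 * c + 3)"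
    proof (rule mult_le_mono2)
      have "8 * c + 4 \<le> 2 ^ (8 * c + 3)"
        using less_exp[of "8 * c + 3"] by linarith
      also have "\<dots> \<le> s ^ (8 * c + 3)"
        using assms by (intro power_mono) auto
      finally show "8 * c + 4 \<le> s ^ (8 * c + 3)" .
    qed
    finally have s: "s + 8 * c + 3 \<le> s ^ (8 * c + 4)"
      by (simp add: numeral_eq_Suc)
    have "8 * c * 2 ^ (s + 3) \<le> 2 ^ (8 * c) * (2 :: nat) ^ (s + 3)"
      by (intro mult_le_mono1) (simp add: less_imp_le)
    also have "\<dots> = 2 ^ (s + 8 * c + 3)"
      by (simp add: power_add)
    also have "\<dots> \<le> 2 ^ (s ^ (8 * c + 4))"
      using s by (intro power_increasing) auto
    finally show "8 * c * 2 ^ (s + 3) \<le> (2 :: nat) ^ (s ^ (8 * c + 4))" .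
  qed auto
  finally show ?thesis .
qed

section \<open>The language of the automaton\<close>

lemma prefix_Suc_snoc: "prefix (Suc n) u = prefix n u @ [u n]"
  by (simp add: subsequence_def)

lemma map_prefix: "map f (prefix n u) = prefix n (f \<circ> u)"
  by (simp add: subsequence_def)

lemma prefix_in_lists: "range u \<subseteq> A \<Longrightarrow> prefix n u \<in> lists A"
  by (auto simp: subsequence_def image_subset_iff)

lemma prefix_in_dfa_language:
  "range u \<subseteq> alphabet A \<Longrightarrow>
     prefix n u \<in> dfa_language A \<longleftrightarrow> foldl (trans A) (init A) (prefix n u) \<in> accepting A"
  by (simp add: dfa_language_def prefix_in_lists)

section \<open>Properties settled by a finite prefix\<close>

definition determined :: "('b word \<Rightarrow> bool) \<Rightarrow> 'b word \<Rightarrow> bool" where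
  "determined R u \<longleftrightarrow> (\<exists>n. \<forall>u'. (\<forall>j<n. u' j = u j) \<longrightarrow> R u')"

lemma determinedI: "(\<And>u'. (\<forall>j<n. u' j = u j) \<Longrightarrow> R u') \<Longrightarrow> determined R u"
  unfolding determined_def by blast

lemma determined_mono:
  assumes "determined R u" "\<And>u'. R u' \<Longrightarrow> S u'"
  shows "determined S u"
  using assms unfolding determined_def by blast

lemma determined_conj:
  assumes "determined R u" "determined S u"
  shows "determined (\<lambda>u. R u \<and> S u) u"
proof -
  from assms obtain m n where "\<And>u'. (\<forall>j<m. u' j = u j) \<Longrightarrow> R u'" "\<And>u'. (\<forall>j<n. u' j = u j) \<Longrightarrow> S u'"
    unfolding determined_def by blast
  then show ?thesis
    by (intro determinedI[of "max m n"]) auto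
qed

lemma determined_all_less:
  fixes m :: nat
  assumes "\<And>k. k < m \<Longrightarrow> determined (R k) u"
  shows "determined (\<lambda>u. \<forall>k<m. R k u) u"
  using assms
proof (induction m)
  case 0
  then show ?case
    by (intro determinedI) auto
next
  case (Suc m)
  then have "determined (\<lambda>u. (\<forall>k<m. R k u) \<and> R m u) u"
    by (intro determined_conj) auto
  then show ?case
    by (rule determined_mono) (auto simp: less_Suc_eq)
qed

text \<open>\<open>determined R u\<close> says that \<open>u\<close> is an interior point of
  \<open>R\<close> in the prefix topology: safe formulas define closed sets, co-safe formulas open
  ones. A violated \<open>R\<close> or a satisfied \<open>U\<close> has a witness position, and only
  finitely many conditions at or before it are needed, each settled by some finite prefix.\<close>

lemma determined_safe_cosafe:
  "(safe \<psi> \<longrightarrow> \<not> sat u i \<psi> \<longrightarrow> determined (\<lambda>u. \<not> sat u i \<psi>) u) \<and>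
   (cosafe \<psi> \<longrightarrow> sat u i \<psi> \<longrightarrow> determined (\<lambda>u. sat u i \<psi>) u)"
proof (induction \<psi> arbitrary: i)
  case (Prop p)
  then show ?case
    by (auto intro: determinedI[of "Suc i"])
next
  case (Not \<psi>)
  then show ?case
    by (auto intro: determinedI[of "Suc i"])
next
  case (And \<psi> \<chi>)
  have "determined (\<lambda>u. \<not> sat u i (And \<psi> \<chi>)) u" if "determined (\<lambda>u. \<not> sat u i \<psi>) u"
    using that by (rule determined_mono) simp
  moreover have "determined (\<lambda>u. \<not> sat u i (And \<psi> \<chi>)) u" if "determined (\<lambda>u. \<not> sat u i \<chi>) u"
    using that by (rule determined_mono) simp
  moreover have "determined (\<lambda>u. sat u i (And \<psi> \<chi>)) u"
    if "determined (\<lambda>u. sat u i \<psi>) u" "determined (\<lambda>u. sat u i \<chi>) u"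
    using determined_conj[OF that] by simp
  ultimately show ?case
    using And by fastforce
next
  case (Or \<psi> \<chi>)
  have "determined (\<lambda>u. sat u i (Or \<psi> \<chi>)) u" if "determined (\<lambda>u. sat u i \<psi>) u"
    using that by (rule determined_mono) simp
  moreover have "determined (\<lambda>u. sat u i (Or \<psi> \<chi>)) u" if "determined (\<lambda>u. sat u i \<chi>) u"
    using that by (rule determined_mono) simp
  moreover have "determined (\<lambda>u. \<not> sat u i (Or \<psi> \<chi>)) u"
    if "determined (\<lambda>u. \<not> sat u i \<psi>) u" "determined (\<lambda>u. \<not> sat u i \<chi>) u"
    using determined_conj[OF that] by simp
  ultimately show ?case
    using Or by fastforce
next
  case (Until \<psi> \<chi>)
  have "determined (\<lambda>u. sat u i (Until \<psi> \<chi>)) u"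
    if co: "cosafe \<psi>" "cosafe \<chi>" and j: "i \<le> j" "sat u j \<chi>" "\<forall>k. i \<le> k \<and> k < j \<longrightarrow> sat u k \<psi>" for j
  proof -
    have "determined (\<lambda>u. i \<le> k \<longrightarrow> sat u k \<psi>) u" if "k < j" for k
      using that j Until.IH(1)[of k] co by (cases "i \<le> k") (auto intro: determinedI)
    then have "determined (\<lambda>u. \<forall>k<j. i \<le> k \<longrightarrow> sat u k \<psi>) u"
      by (rule determined_all_less)
    moreover have "determined (\<lambda>u. sat u j \<chi>) u"
      using Until.IH(2)[of j] co j by blast
    ultimately have "determined (\<lambda>u. (\<forall>k<j. i \<le> k \<longrightarrow> sat u k \<psi>) \<and> sat u j \<chi>) u"
      by (rule determined_conj)
    then show ?thesis
      by (rule determined_mono) (use j(1) in auto)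
  qed
  then show ?case
    by auto
next
  case (Release \<psi> \<chi>)
  have "determined (\<lambda>u. \<not> sat u i (Release \<psi> \<chi>)) u"
    if co: "safe \<psi>" "safe \<chi>" and j: "i \<le> j" "\<not> sat u j \<chi>" "\<forall>k. i \<le> k \<and> k < j \<longrightarrow> \<not> sat u k \<psi>" for j
  proof -
    have "determined (\<lambda>u. i \<le> k \<longrightarrow> \<not> sat u k \<psi>) u" if "k < j" for k
      using that j Release.IH(1)[of k] co by (cases "i \<le> k") (auto intro: determinedI)
    then have "determined (\<lambda>u. \<forall>k<j. i \<le> k \<longrightarrow> \<not> sat u k \<psi>) u"
      by (rule determined_all_less)
    moreover have "determined (\<lambda>u. \<not> sat u j \<chi>) u"
      using Release.IH(2)[of j] co j by blast
    ultimately have "determined (\<lambda>u. (\<forall>k<j. i \<le> k \<longrightarrow> \<not> sat u k \<psi>) \<and> \<not> sat u j \<chi>) u"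
      by (rule determined_conj)
    then show ?thesis
      by (rule determined_mono) (use j(1) in auto)
  qed
  then show ?case
    by auto
qed (auto intro: determinedI)

lemma determined_prefix:
  assumes "determined R u"
  shows "\<exists>n. \<forall>m\<ge>n. \<forall>v. R (prefix m u \<frown> v)"
proof -
  obtain n where n: "\<And>u'. (\<forall>j<n. u' j = u j) \<Longrightarrow> R u'"
    using assms unfolding determined_def by blast
  have "R (prefix m u \<frown> v)" if "n \<le> m" for m v
    using that by (intro n) (auto simp: subsequence_def conc_def)
  then show ?thesis
    by blast
qed

text \<open>Openness makes all prefixes from some length on bad, which is the form needed to see the
  flag of the automaton set. In the other direction, \<open>u\<close> itself extends its
  prefix.\<close>

lemma bad_prefix_iff:
  assumes "safe \<alpha>" "range u \<subseteq> Pow P"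
  shows "\<not> sat u 0 \<alpha> \<Longrightarrow> \<exists>n. \<forall>m\<ge>n. bad_prefix P \<alpha> (prefix m u)"
    and "bad_prefix P \<alpha> (prefix m u) \<Longrightarrow> \<not> sat u 0 \<alpha>"
proof -
  assume "\<not> sat u 0 \<alpha>"
  then have "determined (\<lambda>u. \<not> sat u 0 \<alpha>) u"
    using determined_safe_cosafe assms(1) by blast
  from determined_prefix[OF this] obtain n where "\<forall>m\<ge>n. \<forall>v. \<not> sat (prefix m u \<frown> v) 0 \<alpha>" ..
  then show "\<exists>n. \<forall>m\<ge>n. bad_prefix P \<alpha> (prefix m u)"
    using prefix_in_lists[OF assms(2)] unfolding bad_prefix_def by (intro exI[of _ n]) simp
next
  assume "bad_prefix P \<alpha> (prefix m u)"
  moreover have "range (suffix m u) \<subseteq> Pow P"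
    using assms(2) by auto
  ultimately have "\<not> sat (prefix m u \<frown> suffix m u) 0 \<alpha>"
    unfolding bad_prefix_def by blast
  then show "\<not> sat u 0 \<alpha>"
    by simp
qed

lemma good_prefix_iff:
  assumes "cosafe \<alpha>" "range u \<subseteq> Pow P"
  shows "sat u 0 \<alpha> \<Longrightarrow> \<exists>n. \<forall>m\<ge>n. good_prefix P \<alpha> (prefix m u)"
    and "good_prefix P \<alpha> (prefix m u) \<Longrightarrow> sat u 0 \<alpha>"
proof -
  assume "sat u 0 \<alpha>"
  then have "determined (\<lambda>u. sat u 0 \<alpha>) u"
    using determined_safe_cosafe assms(1) by blast
  from determined_prefix[OF this] obtain n where "\<forall>m\<ge>n. \<forall>v. sat (prefix m u \<frown> v) 0 \<alpha>" ..
  then show "\<exists>n. \<forall>m\<ge>n. good_prefix P \<alpha> (prefix m u)"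
    using prefix_in_lists[OF assms(2)] unfolding good_prefix_def by (intro exI[of _ n]) simp
next
  assume "good_prefix P \<alpha> (prefix m u)"
  moreover have "range (suffix m u) \<subseteq> Pow P"
    using assms(2) by auto
  ultimately have "sat (prefix m u \<frown> suffix m u) 0 \<alpha>"
    unfolding good_prefix_def by blast
  then show "sat u 0 \<alpha>"
    by simp
qed

text \<open>\<open>star\<close> inspects the state after a letter, never the initial one, so the
  range starts at 1. If already the empty word is bad or good, the flag is set one letter later, a
  delay without effect on Buechi acceptance.\<close>

lemma foldl_star:
  "foldl (star A) (Some (init A)) (prefix n u) =
     (if \<exists>m\<in>{1..n}. foldl (trans A) (init A) (prefix m u) \<in> accepting A then None
      else Some (foldl (trans A) (init A) (prefix n u)))"
proof (induction n)
  case (Suc n)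
  have "{1..Suc n} = insert (Suc n) {1..n}"
    by auto
  with Suc show ?case
    by (auto simp: prefix_Suc_snoc)
qed (simp add: subsequence_def)

lemma foldl_star_None_eventually:
  assumes "\<And>m. n \<le> m \<Longrightarrow> foldl (trans A) (init A) (prefix m u) \<in> accepting A"
  shows "\<forall>m\<ge>Suc n. foldl (star A) (Some (init A)) (prefix m u) = None"
proof (intro allI impI)
  fix m
  assume "Suc n \<le> m"
  then have "\<exists>m\<in>{1..m}. foldl (trans A) (init A) (prefix m u) \<in> accepting A"
    using assms[of m] by (intro bexI[of _ m]) auto
  then show "foldl (star A) (Some (init A)) (prefix m u) = None"
    unfolding foldl_star by simp
qed

lemma star_in_states:
  assumes "det_aut A" "a \<in> alphabet A" "q \<in> insert None (Some ` states A)"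
  shows "star A q a \<in> insert None (Some ` states A)"
  using assms by (cases q) (auto simp: det_aut_def)

lemma foldl_star_not_None:
  assumes "\<And>m. foldl (trans A) (init A) (prefix m u) \<notin> accepting A"
  shows "foldl (star A) (Some (init A)) (prefix m u) \<noteq> None"
  using assms by (auto simp: foldl_star)

lemma det_spec_aut:
  assumes "finite P" "det_aut As" "det_aut Ac" "det_aut Ag"
    and alphabet: "alphabet As = Pow P" "alphabet Ac = Pow P" "alphabet Ag = Pow P"
  shows "det_aut (spec_aut P As Ac Ag)"
proof -
  let ?I = "\<lambda>A. insert None (Some ` states A)"
  have "live_states As Ac Ag = (\<lambda>(qs, qc, qg). Live qs qc qg) ` (?I As \<times> ?I Ac \<times> states Ag)"
    by (auto simp: live_states_def image_iff)
  then have "finite (live_states As Ac Ag)"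
    using assms by (auto simp: det_aut_def)
  moreover have "finite (Pow (ext P))"
    using assms(1) by (simp add: ext_def)
  moreover have "spec_trans As Ac Ag p \<theta> \<in> live_states As Ac Ag \<union> {Top, Bot}"
    if "p \<in> live_states As Ac Ag \<union> {Top, Bot}" "\<theta> \<in> Pow (ext P)" for p \<theta>
  proof -
    have "strip \<theta> \<in> Pow P"
      using that(2) by (auto simp: strip_def ext_def)
    show ?thesis
    proof (cases p)
      case (Live qs qc qg)
      then have q: "qs \<in> ?I As" "qc \<in> ?I Ac" "qg \<in> states Ag"
        using that(1) by (auto simp: live_states_def)
      moreover have "star As qs (strip \<theta>) \<in> ?I As" "star Ac qc (strip \<theta>) \<in> ?I Ac"
        using star_in_states[OF assms(2) _ q(1)] star_in_states[OF assms(3) _ q(2)] alphabet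
          \<open>strip \<theta> \<in> Pow P\<close> by simp_all
      moreover have "trans Ag qg (strip \<theta>) \<in> states Ag"
        using q assms(4) alphabet(3) \<open>strip \<theta> \<in> Pow P\<close> by (auto simp: det_aut_def)
      ultimately show ?thesis
        unfolding Live live_states_def by simp
    qed auto
  qed
  ultimately show ?thesis
    using assms(2-4) unfolding det_aut_def spec_aut_def by (auto simp: live_states_def)
qed

lemma run_in_states:
  assumes "det_aut A" "range \<pi> \<subseteq> alphabet A"
  shows "run A \<pi> n \<in> states A"
  using assms by (induction n) (auto simp: det_aut_def)

lemma run_spec_aut_live:
  assumes "\<forall>i<n. None \<notin> \<pi> i"
  shows "run (spec_aut P As Ac Ag) \<pi> n =
    Live (foldl (star As) (Some (init As)) (prefix n (strip \<circ> \<pi>)))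
      (foldl (star Ac) (Some (init Ac)) (prefix n (strip \<circ> \<pi>)))
      (foldl (trans Ag) (init Ag) (prefix n (strip \<circ> \<pi>)))"
  using assms
proof (induction n)
  case (Suc n)
  then show ?case
    by (simp add: prefix_Suc_snoc) (simp add: spec_aut_def)
qed (simp add: subsequence_def spec_aut_def)

text \<open>Without \<open>end\<close> both flags are latches, so acceptance is eventually constant.
  It fails in the limit only if the good flag gets set and the bad flag never does, that is, if
  \<alpha>c and \<alpha>s both hold. With \<open>end\<close>, the run leaves the product at the
  first occurrence and only \<open>Top\<close> and \<open>Bot\<close> matter.\<close>

lemma buchi_language_spec_aut:
  assumes "finite P" "safe \<alpha>s" "cosafe \<alpha>c"
    and As: "bad_prefix_dfa P \<alpha>s As" and Ac: "good_prefix_dfa P \<alpha>c Ac" and Ag: "ltlf_dfa P \<phi> Ag"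
  shows "det_aut (spec_aut P As Ac Ag)"
    and "buchi_language (spec_aut P As Ac Ag) =
      {\<pi>. range \<pi> \<subseteq> Pow (ext P) \<and>
        ((\<exists>n. {i. None \<in> \<pi> i} = {n} \<and> satf (map strip (prefix (Suc n) \<pi>)) 0 \<phi>) \<or>
         ((\<forall>i. None \<notin> \<pi> i) \<and> \<not> sat (strip \<circ> \<pi>) 0 (And \<alpha>s \<alpha>c)))}"
proof -
  let ?S = "spec_aut P As Ac Ag"
  show det: "det_aut ?S"
    using assms by (intro det_spec_aut) (auto simp: bad_prefix_dfa_def good_prefix_dfa_def ltlf_dfa_def)
  have *: "(\<exists>\<^sub>\<infinity>n. run ?S \<pi> n \<in> accepting ?S) \<longleftrightarrow>
      (\<exists>n. {i. None \<in> \<pi> i} = {n} \<and> satf (map strip (prefix (Suc n) \<pi>)) 0 \<phi>) \<or>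
      ((\<forall>i. None \<notin> \<pi> i) \<and> \<not> sat (strip \<circ> \<pi>) 0 (And \<alpha>s \<alpha>c))"
    if \<pi>: "range \<pi> \<subseteq> Pow (ext P)" for \<pi>
  proof -
    define \<sigma> where "\<sigma> = strip \<circ> \<pi>"
    have \<sigma>: "range \<sigma> \<subseteq> Pow P"
      using \<pi> by (fastforce simp: \<sigma>_def strip_def ext_def)
    show ?thesis
    proof (cases "\<forall>i. None \<notin> \<pi> i")
      case True
      let ?qs = "\<lambda>n. foldl (star As) (Some (init As)) (prefix n \<sigma>)"
      let ?qc = "\<lambda>n. foldl (star Ac) (Some (init Ac)) (prefix n \<sigma>)"
      have "run ?S \<pi> n \<in> accepting ?S \<longleftrightarrow> ?qs n = None \<or> ?qc n \<noteq> None" for n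
        using run_in_states[OF det, of \<pi> n] \<pi> run_spec_aut_live[of n \<pi> P As Ac Ag] True
        by (auto simp: spec_aut_def \<sigma>_def)
      moreover have "(\<exists>\<^sub>\<infinity>n. ?qs n = None \<or> ?qc n \<noteq> None) \<longleftrightarrow> \<not> (sat \<sigma> 0 \<alpha>s \<and> sat \<sigma> 0 \<alpha>c)"
      proof -
        have bad: "foldl (trans As) (init As) (prefix n \<sigma>) \<in> accepting As \<longleftrightarrow>
            bad_prefix P \<alpha>s (prefix n \<sigma>)" for n
          using prefix_in_dfa_language[of \<sigma> As n] \<sigma> As by (simp add: bad_prefix_dfa_def)
        have good: "foldl (trans Ac) (init Ac) (prefix n \<sigma>) \<in> accepting Ac \<longleftrightarrow>
            good_prefix P \<alpha>c (prefix n \<sigma>)" for n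
          using prefix_in_dfa_language[of \<sigma> Ac n] \<sigma> Ac by (simp add: good_prefix_dfa_def)
        consider "\<not> sat \<sigma> 0 \<alpha>s" | "\<not> sat \<sigma> 0 \<alpha>c" | "sat \<sigma> 0 \<alpha>s" "sat \<sigma> 0 \<alpha>c"
          by blast
        then show ?thesis
        proof cases
          case 1
          then obtain n where "\<forall>m\<ge>n. bad_prefix P \<alpha>s (prefix m \<sigma>)"
            using bad_prefix_iff(1)[OF assms(2) \<sigma>] by blast
          then have "\<forall>m\<ge>Suc n. ?qs m = None"
            using bad by (intro foldl_star_None_eventually) auto
          then have "\<exists>\<^sub>\<infinity>n. ?qs n = None"
            unfolding INFM_nat_le by (metis max.cobounded1 max.cobounded2)
          then have "\<exists>\<^sub>\<infinity>n. ?qs n = None \<or> ?qc n \<noteq> None"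
            by (rule INFM_mono) simp
          with 1 show ?thesis
            by simp
        next
          case 2
          then have "?qc n \<noteq> None" for n
            using good_prefix_iff(2)[OF assms(3) \<sigma>] good by (intro foldl_star_not_None) blast
          then have "\<exists>\<^sub>\<infinity>n. ?qs n = None \<or> ?qc n \<noteq> None"
            by (auto simp: INFM_nat_le)
          with 2 show ?thesis
            by simp
        next
          case 3
          then obtain n where "\<forall>m\<ge>n. good_prefix P \<alpha>c (prefix m \<sigma>)"
            using good_prefix_iff(1)[OF assms(3) \<sigma>] by blast
          then have "\<forall>m\<ge>Suc n. ?qc m = None"
            using good by (intro foldl_star_None_eventually) auto
          moreover have "?qs n \<noteq> None" for n
            using bad_prefix_iff(2)[OF assms(2) \<sigma>] bad 3(1) by (intro foldl_star_not_None) blast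
          ultimately have "\<forall>m\<ge>Suc n. \<not> (?qs m = None \<or> ?qc m \<noteq> None)"
            by simp
          then have "\<not> (\<exists>\<^sub>\<infinity>n. ?qs n = None \<or> ?qc n \<noteq> None)"
            unfolding INFM_nat_le by (metis order_refl)
          with 3 show ?thesis
            by simp
        qed
      qed
      ultimately show ?thesis
        using True by (auto simp: \<sigma>_def)
    next
      case False
      define n where "n = (LEAST i. None \<in> \<pi> i)"
      have n: "None \<in> \<pi> n" and before: "\<forall>i<n. None \<notin> \<pi> i"
        using False unfolding n_def by (auto intro: LeastI dest: not_less_Least)
      have "foldl (trans Ag) (init Ag) (prefix (Suc n) \<sigma>) \<in> accepting Ag \<longleftrightarrow>
          satf (prefix (Suc n) \<sigma>) 0 \<phi>"
        using prefix_in_dfa_language[of \<sigma> Ag "Suc n"] prefix_in_lists[OF \<sigma>, of "Suc n"] \<sigma> Ag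
        by (auto simp: ltlf_dfa_def)
      then have run_n: "run ?S \<pi> (Suc n) = (if satf (prefix (Suc n) \<sigma>) 0 \<phi> then Top else Bot)"
        using run_spec_aut_live[OF before, of P As Ac Ag] n
        by (simp add: prefix_Suc_snoc \<sigma>_def) (simp add: spec_aut_def)
      \<comment> \<open>\<open>Top\<close> is lost at the next \<open>end\<close> and never
        regained, so the state records whether \<phi> held at the first \<open>end\<close> and
        \<open>end\<close> has been absent since.\<close>
      have run_after: "run ?S \<pi> (Suc n + m) =
          (if satf (prefix (Suc n) \<sigma>) 0 \<phi> \<and> (\<forall>i. n < i \<and> i < Suc n + m \<longrightarrow> None \<notin> \<pi> i) then Top else Bot)"
        for m
      proof (induction m)
        case 0
        then show ?case
          using run_n by auto
      next
        case (Suc m)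
        let ?before = "\<lambda>m. \<forall>i. n < i \<and> i < Suc n + m \<longrightarrow> None \<notin> \<pi> i"
        have trans: "trans ?S = spec_trans As Ac Ag"
          by (simp add: spec_aut_def)
        have "run ?S \<pi> (Suc n + Suc m) = trans ?S (run ?S \<pi> (Suc n + m)) (\<pi> (Suc n + m))"
          by simp
        also have "\<dots> = (if satf (prefix (Suc n) \<sigma>) 0 \<phi> \<and> ?before m \<and> None \<notin> \<pi> (Suc n + m)
            then Top else Bot)"
          unfolding Suc.IH trans by simp
        also have "?before m \<and> None \<notin> \<pi> (Suc n + m) \<longleftrightarrow> ?before (Suc m)"
          by (auto simp: less_Suc_eq dest: spec[of _ "Suc (n + m)"])
        finally show ?case .
      qed
      have acc: "Top \<in> accepting ?S" "Bot \<notin> accepting ?S"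
        by (simp_all add: spec_aut_def)
      have "{i. None \<in> \<pi> i} = {n} \<longleftrightarrow> (\<forall>i>n. None \<notin> \<pi> i)"
        using n before by (auto simp: set_eq_iff) (metis linorder_neqE_nat)
      moreover have "(\<exists>\<^sub>\<infinity>n. run ?S \<pi> n \<in> accepting ?S) \<longleftrightarrow>
          satf (prefix (Suc n) \<sigma>) 0 \<phi> \<and> (\<forall>i>n. None \<notin> \<pi> i)"
      proof
        assume "satf (prefix (Suc n) \<sigma>) 0 \<phi> \<and> (\<forall>i>n. None \<notin> \<pi> i)"
        then have "run ?S \<pi> (Suc n + m) \<in> accepting ?S" for m
          using run_after[of m] acc by simp
        then have "run ?S \<pi> m \<in> accepting ?S" if "m \<ge> Suc n" for m
          using that by (metis le_add_diff_inverse)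
        then show "\<exists>\<^sub>\<infinity>n. run ?S \<pi> n \<in> accepting ?S"
          unfolding INFM_nat_le by (metis max.cobounded1 max.cobounded2)
      next
        assume inf: "\<exists>\<^sub>\<infinity>n. run ?S \<pi> n \<in> accepting ?S"
        have "satf (prefix (Suc n) \<sigma>) 0 \<phi> \<and> None \<notin> \<pi> i" if "i > n" for i
        proof -
          obtain k where "k \<ge> Suc i" "run ?S \<pi> k \<in> accepting ?S"
            using inf unfolding INFM_nat_le by blast
          moreover define m where "m = k - Suc n"
          ultimately have "k = Suc n + m" "run ?S \<pi> (Suc n + m) \<noteq> Bot"
            using that acc by auto
          then show ?thesis
            using run_after[of m] that \<open>k \<ge> Suc i\<close> by (metis Suc_le_lessD)
        qed
        \<comment> \<open>The claim about \<phi> does not depend on \<open>i\<close>; the instance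
          \<open>Suc n\<close> provides some position after \<open>n\<close> from which to read it
          off.\<close>
        from this this[of "Suc n"] show "satf (prefix (Suc n) \<sigma>) 0 \<phi> \<and> (\<forall>i>n. None \<notin> \<pi> i)"
          by blast
      qed
      moreover have "{i. None \<in> \<pi> i} = {k} \<Longrightarrow> k = n" for k
        using n by (metis mem_Collect_eq singletonD)
      ultimately show ?thesis
        using False by (auto simp: map_prefix \<sigma>_def)
    qed
  qed
  have "alphabet ?S = Pow (ext P)"
    by (simp add: spec_aut_def)
  then show "buchi_language ?S = {\<pi>. range \<pi> \<subseteq> Pow (ext P) \<and>
      ((\<exists>n. {i. None \<in> \<pi> i} = {n} \<and> satf (map strip (prefix (Suc n) \<pi>)) 0 \<phi>) \<or>
       ((\<forall>i. None \<notin> \<pi> i) \<and> \<not> sat (strip \<circ> \<pi>) 0 (And \<alpha>s \<alpha>c)))}"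
    unfolding buchi_language_def using * by (intro Collect_cong conj_cong) simp_all
qed

section \<open>The theorem\<close>

text \<open>The alphabet is written out in full, and \<open>P\<close> may contain variables that
  occur in none of the formulas. The factor exponential in \<open>card P\<close> accounts for them;
  the other factor depends on the formulas alone.\<close>

lemma spec_aut_construction:
  "\<exists>M c. \<forall>(P :: 'a set) \<nu> \<alpha>s \<alpha>c \<phi>.
     finite P \<and> bij_betw \<nu> P {..<card P} \<and>
     safe \<alpha>s \<and> vars \<alpha>s \<subseteq> P \<and> cosafe \<alpha>c \<and> vars \<alpha>c \<subseteq> P \<and> vars \<phi> \<subseteq> P \<longrightarrow>
       (\<exists>(As :: ('a set, tree) aut) (Ac :: ('a set, tree) aut) (Ag :: ('a set, tree) aut) t.
          bad_prefix_dfa P \<alpha>s As \<and> good_prefix_dfa P \<alpha>c Ac \<and> ltlf_dfa P \<phi> Ag \<and>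
          encodes_aut (enc_letter (card P) \<nu>) enc_pstate (spec_aut P As Ac Ag) t \<and>
          computes_within M
            (enc_list [enc_nat (card P), enc_ltl \<nu> \<alpha>s, enc_ltl \<nu> \<alpha>c, enc_ltl \<nu> \<phi>])
            (2 ^ (c * card P) * 2 ^ (2 ^ ((fsize \<alpha>s + fsize \<alpha>c + fsize \<phi>) ^ c)))
            t)"
proof -
  obtain M c where M: "\<forall>d x. \<exists>n \<le> (size x + size (data_tree x) + 2) ^ c.
      exec d M x n (aut_tree (data_tree x))"
    using output_polytime_postcomp[OF output_polytime_data_tree polytime_aut_tree] by (elim exE)
  show ?thesis
  \<comment> \<open>The exponent comes from \<open>double_exponential_bound\<close>: the data has
    size at most an eighth power, and the program adds the power \<open>c\<close>.\<close>
  proof (rule exI[of _ M], rule exI[of _ "8 * c + 4"], intro allI impI, elim conjE)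
    fix P :: "'a set" and \<nu> \<alpha>s \<alpha>c \<phi>
    assume fin: "finite P" and bij: "bij_betw \<nu> P {..<card P}"
      and \<alpha>s: "safe \<alpha>s" "vars \<alpha>s \<subseteq> P" and \<alpha>c: "cosafe \<alpha>c" "vars \<alpha>c \<subseteq> P" and \<phi>: "vars \<phi> \<subseteq> P"
    define x where "x = enc_list [enc_nat (card P), enc_ltl \<nu> \<alpha>s, enc_ltl \<nu> \<alpha>c, enc_ltl \<nu> \<phi>]"
    define s where "s = fsize \<alpha>s + fsize \<alpha>c + fsize \<phi>"
    interpret truth_vectors P \<nu> "closure_list \<alpha>s \<alpha>c \<phi>"
    proof
      show "children_follow (closure_list \<alpha>s \<alpha>c \<phi>)"
        unfolding closure_list_def by (intro children_follow_subs) simp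
      show "TT \<in> set (closure_list \<alpha>s \<alpha>c \<phi>)"
        by (simp add: closure_list_def)
      show "vars \<psi> \<subseteq> P" if "\<psi> \<in> set (closure_list \<alpha>s \<alpha>c \<phi>)" for \<psi>
        using that \<alpha>s(2) \<alpha>c(2) \<phi> vars_subs[of \<psi>] by (fastforce simp: closure_list_def)
    qed (fact fin bij)+
    have closure: "closure_tree x = C"
      unfolding x_def C_def by (rule closure_tree_enc)
    \<comment> \<open>\<open>Node Leaf (left x)\<close> is the unary number
      \<open>card P + 1\<close>, one bit for \<open>end\<close> and one for each variable.\<close>
    have letters: "all_bits (Node Leaf (left x)) = Ls"
      by (simp add: x_def Ls_def enc_nat_def)
    let ?As = "component (E \<alpha>s) core" and ?Ac = "component (E (Not \<alpha>c)) core"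
    let ?Ag = "component (E (Not \<phi>)) (Node Leaf Leaf)"
    have "bad_prefix_dfa P \<alpha>s ?As"
      using \<alpha>s(1) by (intro bad_prefix_component) (simp_all add: closure_list_def self_in_subs)
    moreover have "good_prefix_dfa P \<alpha>c ?Ac"
      using \<alpha>c(1) by (intro good_prefix_component) (simp_all add: closure_list_def)
    moreover have "ltlf_dfa P \<phi> ?Ag"
      by (intro ltlf_component) (simp add: closure_list_def)
    moreover have "encodes_aut (enc_letter (card P) \<nu>) enc_pstate (spec_aut P ?As ?Ac ?Ag)
        (aut_tree (data_tree x))"
    proof (rule encodes_aut_tree)
      show "left (left (left (left (data_tree x)))) = enc_list [enc_nat (card P), E \<alpha>s, E \<alpha>c, E \<phi>]"
        by (simp add: data_tree_def Let_def x_def)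
    qed (simp_all add: data_tree_def Let_def closure letters Vs_def Qs_def)
    moreover have "computes_within M x
        (2 ^ ((8 * c + 4) * card P) * 2 ^ (2 ^ (s ^ (8 * c + 4)))) (aut_tree (data_tree x))"
    proof -
      have \<nu>: "\<nu> p < card P" if "p \<in> P" for p
        using bij that by (auto simp: bij_betw_def)
      obtain n where n: "n \<le> (size x + size (data_tree x) + 2) ^ c"
        "exec M M x n (aut_tree (data_tree x))"
        using M by blast
      note n(1)
      also have "(size x + size (data_tree x) + 2) ^ c \<le> ((2 ^ card P * 2 ^ (2 ^ (s + 3))) ^ 8) ^ c"
        using size_data_tree[OF \<nu> \<alpha>s(2) \<alpha>c(2) \<phi>] unfolding x_def s_def by (intro power_mono) auto
      also have "\<dots> \<le> 2 ^ ((8 * c + 4) * card P) * 2 ^ (2 ^ (s ^ (8 * c + 4)))"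
        using fsize_pos[of \<alpha>s] fsize_pos[of \<alpha>c] fsize_pos[of \<phi>]
        by (intro double_exponential_bound) (simp add: s_def)
      finally show ?thesis
        unfolding computes_within_def using n(2) by blast
    qed
    ultimately show "\<exists>As Ac Ag t. bad_prefix_dfa P \<alpha>s As \<and> good_prefix_dfa P \<alpha>c Ac \<and> ltlf_dfa P \<phi> Ag \<and>
        encodes_aut (enc_letter (card P) \<nu>) enc_pstate
          (spec_aut P As (Ac :: ('a set, tree) aut) (Ag :: ('a set, tree) aut)) t \<and>
        computes_within M
          (enc_list [enc_nat (card P), enc_ltl \<nu> \<alpha>s, enc_ltl \<nu> \<alpha>c, enc_ltl \<nu> \<phi>])
          (2 ^ ((8 * c + 4) * card P) *
            2 ^ (2 ^ ((fsize \<alpha>s + fsize \<alpha>c + fsize \<phi>) ^ (8 * c + 4)))) t"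
      unfolding x_def s_def by blast
  qed
qed

theorem theorem7:
  shows "(\<forall>(X :: 'a set) Y P \<alpha>s \<alpha>c \<phi>
            (As :: ('a set, 's) aut) (Ac :: ('a set, 'c) aut) (Ag :: ('a set, 'g) aut).
            finite X \<and> finite Y \<and> P = X \<union> Y \<and>
            safe \<alpha>s \<and> vars \<alpha>s \<subseteq> P \<and> cosafe \<alpha>c \<and> vars \<alpha>c \<subseteq> P \<and> vars \<phi> \<subseteq> P \<and>
            bad_prefix_dfa P \<alpha>s As \<and> good_prefix_dfa P \<alpha>c Ac \<and> ltlf_dfa P \<phi> Ag \<longrightarrow>
              det_aut (spec_aut P As Ac Ag) \<and>
              buchi_language (spec_aut P As Ac Ag) =
                {\<pi>. range \<pi> \<subseteq> Pow (ext P) \<and>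
                     ((\<exists>n. {i. None \<in> \<pi> i} = {n} \<and>
                           satf (map strip (prefix (Suc n) \<pi>)) 0 \<phi>) \<or>
                      ((\<forall>i. None \<notin> \<pi> i) \<and> \<not> sat (strip \<circ> \<pi>) 0 (And \<alpha>s \<alpha>c)))}) \<and>
         (\<exists>M c. \<forall>(X :: 'a set) Y P \<nu> \<alpha>s \<alpha>c \<phi>.
            finite X \<and> finite Y \<and> P = X \<union> Y \<and> bij_betw \<nu> P {..<card P} \<and>
            safe \<alpha>s \<and> vars \<alpha>s \<subseteq> P \<and> cosafe \<alpha>c \<and> vars \<alpha>c \<subseteq> P \<and> vars \<phi> \<subseteq> P \<longrightarrow>
              (\<exists>(As :: ('a set, tree) aut) (Ac :: ('a set, tree) aut) (Ag :: ('a set, tree) aut) t.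
                 bad_prefix_dfa P \<alpha>s As \<and> good_prefix_dfa P \<alpha>c Ac \<and> ltlf_dfa P \<phi> Ag \<and>
                 encodes_aut (enc_letter (card P) \<nu>) enc_pstate (spec_aut P As Ac Ag) t \<and>
                 computes_within M
                   (enc_list [enc_nat (card P), enc_ltl \<nu> \<alpha>s, enc_ltl \<nu> \<alpha>c, enc_ltl \<nu> \<phi>])
                   (2 ^ (c * card P) * 2 ^ (2 ^ ((fsize \<alpha>s + fsize \<alpha>c + fsize \<phi>) ^ c)))
                   t))"
proof (rule conjI, intro allI impI)
  fix X Y P :: "'a set" and \<alpha>s \<alpha>c \<phi> :: "'a ltl"
    and As :: "('a set, 's) aut" and Ac :: "('a set, 'c) aut" and Ag :: "('a set, 'g) aut"
  assume *: "finite X \<and> finite Y \<and> P = X \<union> Y \<and>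
    safe \<alpha>s \<and> vars \<alpha>s \<subseteq> P \<and> cosafe \<alpha>c \<and> vars \<alpha>c \<subseteq> P \<and> vars \<phi> \<subseteq> P \<and>
    bad_prefix_dfa P \<alpha>s As \<and> good_prefix_dfa P \<alpha>c Ac \<and> ltlf_dfa P \<phi> Ag"
  then have "finite P"
    by simp
  then show "det_aut (spec_aut P As Ac Ag) \<and>
      buchi_language (spec_aut P As Ac Ag) =
        {\<pi>. range \<pi> \<subseteq> Pow (ext P) \<and>
          ((\<exists>n. {i. None \<in> \<pi> i} = {n} \<and> satf (map strip (prefix (Suc n) \<pi>)) 0 \<phi>) \<or>
           ((\<forall>i. None \<notin> \<pi> i) \<and> \<not> sat (strip \<circ> \<pi>) 0 (And \<alpha>s \<alpha>c)))}"
    using buchi_language_spec_aut[of P \<alpha>s \<alpha>c As Ac \<phi> Ag] * by blast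
next
  obtain M c where M: "\<forall>(P :: 'a set) \<nu> \<alpha>s \<alpha>c \<phi>.
     finite P \<and> bij_betw \<nu> P {..<card P} \<and>
     safe \<alpha>s \<and> vars \<alpha>s \<subseteq> P \<and> cosafe \<alpha>c \<and> vars \<alpha>c \<subseteq> P \<and> vars \<phi> \<subseteq> P \<longrightarrow>
       (\<exists>(As :: ('a set, tree) aut) (Ac :: ('a set, tree) aut) (Ag :: ('a set, tree) aut) t.
          bad_prefix_dfa P \<alpha>s As \<and> good_prefix_dfa P \<alpha>c Ac \<and> ltlf_dfa P \<phi> Ag \<and>
          encodes_aut (enc_letter (card P) \<nu>) enc_pstate (spec_aut P As Ac Ag) t \<and>
          computes_within M
            (enc_list [enc_nat (card P), enc_ltl \<nu> \<alpha>s, enc_ltl \<nu> \<alpha>c, enc_ltl \<nu> \<phi>])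
            (2 ^ (c * card P) * 2 ^ (2 ^ ((fsize \<alpha>s + fsize \<alpha>c + fsize \<phi>) ^ c)))
            t)"
    using spec_aut_construction by (elim exE)
  show "\<exists>M c. \<forall>(X :: 'a set) Y P \<nu> \<alpha>s \<alpha>c \<phi>.
     finite X \<and> finite Y \<and> P = X \<union> Y \<and> bij_betw \<nu> P {..<card P} \<and>
     safe \<alpha>s \<and> vars \<alpha>s \<subseteq> P \<and> cosafe \<alpha>c \<and> vars \<alpha>c \<subseteq> P \<and> vars \<phi> \<subseteq> P \<longrightarrow>
       (\<exists>(As :: ('a set, tree) aut) (Ac :: ('a set, tree) aut) (Ag :: ('a set, tree) aut) t.
          bad_prefix_dfa P \<alpha>s As \<and> good_prefix_dfa P \<alpha>c Ac \<and> ltlf_dfa P \<phi> Ag \<and>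
          encodes_aut (enc_letter (card P) \<nu>) enc_pstate (spec_aut P As Ac Ag) t \<and>
          computes_within M
            (enc_list [enc_nat (card P), enc_ltl \<nu> \<alpha>s, enc_ltl \<nu> \<alpha>c, enc_ltl \<nu> \<phi>])
            (2 ^ (c * card P) * 2 ^ (2 ^ ((fsize \<alpha>s + fsize \<alpha>c + fsize \<phi>) ^ c)))
            t)"
    by (rule exI[of _ M], rule exI[of _ c], intro allI impI, rule M[rule_format]) blast
qed

end
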